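(* There exists an absolute constant $c>0$ such that the following holds. Let $A$ be the adjacency matrix generated from a stochastic block model $(\Theta,B)$ with $n$ nodes and $K$ communities. Let $P=\Theta B\Theta^T$ and assume that $P$ has rank $K$, that the smallest absolute nonzero eigenvalue of $P$ is at least $\gamma_n>0$, and that $\max_{k,\ell}B_{k\ell}\le\alpha_n$ for some $\alpha_n\ge \log n/n$. Let $\varepsilon>0$ and let $\hat\Theta$ be the output of spectral clustering of $A$ using $(1+\varepsilon)$-approximate $k$-means. If $$(2+\varepsilon)\frac{Kn\alpha_n}{\gamma_n^2}<c,$$ then, with probability at least $1-n^{-1}$, there exist subsets $S_k\subset G_k$ for $k=1,\ldots,K$ and a $K\times K$ permutation matrix $J$ such that $\hat\Theta_{G*}J=\Theta_{G*}$, where $G=\bigcup_{k=1}^K(G_k\setminus S_k)$, and $$\sum_{k=1}^K\frac{|S_k|}{n_k}\le c^{-1}(2+\varepsilon)\frac{Kn\alpha_n}{\gamma_n^2}.$$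
   Context: Membership matrices: $\mathbb M_{n,K}$ is the set of $n\times K$ matrices each of whose rows has exactly one entry $1$ and $K-1$ entries $0$. For $\Theta\in\mathbb M_{n,K}$, the community label $g_i\in\{1,\ldots,K\}$ of node $i$ is defined by $\Theta_{ig_i}=1$; $G_k=\{1\le i\le n: g_i=k\}$ and $n_k=|G_k|$. Stochastic block model (SBM) $(\Theta,B)$ with $n$ nodes and $K$ communities: $\Theta\in\mathbb M_{n,K}$ and $B\in[0,1]^{K\times K}$ is symmetric. The random adjacency matrix $A=(a_{ij})_{1\le i,j\le n}$ has independent entries $a_{ij}\sim\mathrm{Bernoulli}(B_{g_ig_j})$ for $i<j$, with $a_{ii}=0$ and $a_{ij}=a_{ji}$ for $i>j$. For a matrix $M$ and an index set $I$, $M_{I*}$ denotes the submatrix of the rows of $M$ indexed by $I$; $\|\cdot\|_F$ is the Frobenius norm. Spectral clustering with $(1+\varepsilon)$-approximate $k$-means: let $\hat U\in\mathbb R^{n\times K}$ have as columns $K$ orthonormal eigenvectors of $A$ corresponding to the $K$ largest eigenvalues in absolute value. Let $(\hat\Theta,\hat X)\in\mathbb M_{n,K}\times\mathbb R^{K\times K}$ be any pair satisfying $$\|\hat\Theta\hat X-\hat U\|_F^2\le(1+\varepsilon)\min_{\Theta'\in\mathbb M_{n,K},\,X'\in\mathbb R^{K\times K}}\|\Theta'X'-\hat U\|_F^2 .$$ The output is $\hat\Theta$. *)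

theory Defs
  imports
    "HOL-Probability.Probability"
    "HOL-Combinatorics.Permutations"
    "Jordan_Normal_Form.DL_Rank"
    "Jordan_Normal_Form.DL_Submatrix"
    "Jordan_Normal_Form.Spectral_Radius"
begin

hide_const (open) Finite_Cartesian_Product.mat Finite_Cartesian_Product.row
  Finite_Cartesian_Product.column Finite_Cartesian_Product.transpose
  Finite_Cartesian_Product.vec
no_notation Finite_Cartesian_Product.vec_nth (infixl "$" 90)

text \<open>Nodes are \<open>{..<n}\<close> and communities are \<open>{..<K}\<close>, following the 0-based indexing of
  the matrix library.\<close>

definition membership_matrices :: "nat \<Rightarrow> nat \<Rightarrow> real mat set" where
  "membership_matrices n K =
     {\<Theta> \<in> carrier_mat n K. \<forall>i<n. \<exists>k<K. \<Theta> $$ (i, k) = 1 \<and> (\<forall>l<K. l \<noteq> k \<longrightarrow> \<Theta> $$ (i, l) = 0)}"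

definition label :: "real mat \<Rightarrow> nat \<Rightarrow> nat" where
  "label \<Theta> i = (THE k. k < dim_col \<Theta> \<and> \<Theta> $$ (i, k) = 1)"

definition community :: "real mat \<Rightarrow> nat \<Rightarrow> nat set" where
  "community \<Theta> k = {i. i < dim_row \<Theta> \<and> label \<Theta> i = k}"

definition is_sbm :: "nat \<Rightarrow> nat \<Rightarrow> real mat \<Rightarrow> real mat \<Rightarrow> bool" where
  "is_sbm n K \<Theta> B \<longleftrightarrow>
     \<Theta> \<in> membership_matrices n K \<and> B \<in> carrier_mat K K \<and> transpose_mat B = B \<and>
     (\<forall>k<K. \<forall>l<K. B $$ (k, l) \<in> {0..1})"

text \<open>The law of the adjacency matrix \<open>A\<close>: the entries above the diagonal are drawn
  independently (\<^const>\<open>Pi_pmf\<close> is the product distribution; its second argument is only the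
  value of the function outside the index set), then mirrored.\<close>

definition sbm_adjacency :: "nat \<Rightarrow> real mat \<Rightarrow> real mat \<Rightarrow> real mat pmf" where
  "sbm_adjacency n \<Theta> B =
     map_pmf
       (\<lambda>a. mat n n (\<lambda>(i, j). if i < j then of_bool (a (i, j))
                             else if j < i then of_bool (a (j, i)) else 0))
       (Pi_pmf {(i, j). i < j \<and> j < n} False
         (\<lambda>(i, j). bernoulli_pmf (B $$ (label \<Theta> i, label \<Theta> j))))"

definition frobenius_norm :: "real mat \<Rightarrow> real" where
  "frobenius_norm M = sqrt (\<Sum>i<dim_row M. \<Sum>j<dim_col M. (M $$ (i, j))\<^sup>2)"

text \<open>The list \<open>es\<close> enumerates the eigenvalues of \<open>A\<close> with multiplicity. Ties in absolute value
  may be broken arbitrarily, and the \<open>K\<close> columns of \<open>U\<close> may come in any order.\<close>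

definition leading_eigenvectors :: "nat \<Rightarrow> real mat \<Rightarrow> real mat \<Rightarrow> bool" where
  "leading_eigenvectors K A U \<longleftrightarrow>
     U \<in> carrier_mat (dim_row A) K \<and> transpose_mat U * U = 1\<^sub>m K \<and>
     (\<exists>es. length es = dim_row A \<and> char_poly A = (\<Prod>e\<leftarrow>es. [:- e, 1:]) \<and>
           (\<forall>i<K. \<forall>j. K \<le> j \<and> j < dim_row A \<longrightarrow> \<bar>es ! j\<bar> \<le> \<bar>es ! i\<bar>) \<and>
           (\<forall>i<K. eigenvector A (col U i) (es ! i)))"

text \<open>The infimum below is attained: there are finitely many \<open>\<Theta>'\<close>, and for each of them the
  problem in \<open>X'\<close> is a linear least squares problem.\<close>

definition kmeans_min :: "nat \<Rightarrow> real mat \<Rightarrow> real" where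
  "kmeans_min K U =
     (INF (\<Theta>', X') \<in> membership_matrices (dim_row U) K \<times> carrier_mat K K.
        (frobenius_norm (\<Theta>' * X' - U))\<^sup>2)"

definition spectral_clustering_output :: "nat \<Rightarrow> real \<Rightarrow> real mat \<Rightarrow> real mat \<Rightarrow> bool" where
  "spectral_clustering_output K \<epsilon> A \<Theta>h \<longleftrightarrow>
     (\<exists>U X. leading_eigenvectors K A U \<and>
            \<Theta>h \<in> membership_matrices (dim_row A) K \<and> X \<in> carrier_mat K K \<and>
            (frobenius_norm (\<Theta>h * X - U))\<^sup>2 \<le> (1 + \<epsilon>) * kmeans_min K U)"

definition permutation_matrix :: "nat \<Rightarrow> real mat \<Rightarrow> bool" where
  "permutation_matrix K J \<longleftrightarrow>
     (\<exists>p. p permutes {..<K} \<and> J = mat K K (\<lambda>(i, j). if p i = j then 1 else 0))"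

abbreviation rows_of :: "real mat \<Rightarrow> nat set \<Rightarrow> real mat" where
  "rows_of M I \<equiv> submatrix M I UNIV"

definition min_abs_nonzero_eigenvalue :: "real mat \<Rightarrow> real" where
  "min_abs_nonzero_eigenvalue P = Min (abs ` (spectrum P - {0}))"

end

theory Submission
  imports Defs
begin

text \<open>Spectral clustering works as soon as \<open>\<parallel>A - P\<parallel> \<le> C \<surd>(n \<alpha>)\<close>, and this operator norm bound is
  the probabilistic heart of the matter. It comes from the trace moment \<open>E tr W\<^sup>2\<^sup>p\<close> of the centred
  adjacency matrix \<open>W\<close>, with \<open>p\<close> about \<open>n \<alpha> \<ge> ln n\<close>. Only closed walks that use every edge at
  least twice contribute, and grouping them by shape shows that the moment is at most \<open>n / r\<close> times
  the corresponding moment of a dense matrix \<open>Y\<close> of dimension \<open>r = 2 p\<close> with independent bounded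
  entries. For \<open>Y\<close>, where dimension and moment are of the same order, a net argument with Hoeffding's
  lemma is lossless up to a factor \<open>C\<^sup>p\<close>. Markov's inequality then gives probability \<open>1 - 1 / n\<close>.

  Deterministically, \<open>P\<close> has rank \<open>K\<close>, so its range is exactly the space of vectors that are constant
  on communities. Leading eigenvectors of \<open>A\<close> are therefore within \<open>\<tau> = O(K n \<alpha> / \<gamma>\<^sup>2)\<close> of that space
  (in squared Frobenius norm), and replacing them by their community means gives a competitor for
  \<open>k\<close>-means. The community means keep squared distance at least \<open>(1 - \<tau>) (1 / n\<^sub>k + 1 / n\<^sub>l)\<close>, so nodes
  whose fitted centre is close to their community mean are clustered correctly, and the other nodes
  are counted by the \<open>k\<close>-means objective.\<close>

text \<open>The obstacle is sparsity. For \<alpha> of order \<open>ln n / n\<close> a bound that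
  sees only the range of the entries ignores their small variance, and a net in dimension
  \<open>n\<close> is too expensive. Shape counting moves the problem to dimension
  \<open>2 p\<close>, where a net has size exponential in \<open>p\<close>, which costs only a
  constant once the \<open>2 p\<close>-th root is taken. The exponent \<open>p\<close> is pinned
  from three sides: \<open>p >= n \<alpha>\<close> makes \<open>2 p\<close> vertices enough to
  dominate every shape, \<open>p >= ln n\<close> lets Markov's inequality beat the factor
  \<open>n\<close> of the trace, and \<open>p = O(n \<alpha>)\<close> is needed because the final
  bound is a multiple of \<open>sqrt p\<close>. No eigenvector of \<open>A\<close> is matched with
  one of \<open>P\<close>; only the distance to the block-constant space enters. That this space has
  dimension \<open>K\<close>, the number of eigenvectors used, makes the matrix of scaled community
  means square, so that its lower singular value bound passes to the transpose and separates the
  means. The factor \<open>2 + \<epsilon>\<close> is \<open>1 + \<epsilon>\<close> from approximate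
  k-means plus \<open>1\<close> from the residual of the eigenvectors.\<close>

section \<open>Matrix powers and closed walks\<close>

text \<open>Vectors and matrices are plain functions read only at indices below \<open>n\<close>, so
  the walk expansions carry no dimension conditions; values at larger indices are arbitrary.\<close>

definition vnorm :: "nat \<Rightarrow> (nat \<Rightarrow> real) \<Rightarrow> real" where
  "vnorm n x = L2_set x {..<n}"

definition matvec :: "nat \<Rightarrow> (nat \<Rightarrow> nat \<Rightarrow> real) \<Rightarrow> (nat \<Rightarrow> real) \<Rightarrow> nat \<Rightarrow> real" where
  "matvec n M x i = (\<Sum>j<n. M i j * x j)"

primrec matpow :: "nat \<Rightarrow> (nat \<Rightarrow> nat \<Rightarrow> real) \<Rightarrow> nat \<Rightarrow> nat \<Rightarrow> nat \<Rightarrow> real" where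
  "matpow n M 0 = (\<lambda>i j. of_bool (i = j))"
| "matpow n M (Suc k) = (\<lambda>i j. \<Sum>l<n. matpow n M k i l * M l j)"

lemma vnorm_nonneg [simp]: "vnorm n x \<ge> 0"
  by (simp add: vnorm_def)

lemma vnorm_square: "(vnorm n x)\<^sup>2 = (\<Sum>i<n. (x i)\<^sup>2)"
  by (simp add: vnorm_def L2_set_def sum_nonneg)

lemma vnorm_cong: "(\<And>i. i < n \<Longrightarrow> x i = y i) \<Longrightarrow> vnorm n x = vnorm n y"
  by (auto simp: vnorm_def intro: L2_set_cong)

lemma vnorm_scale: "vnorm n (\<lambda>i. c * x i) = \<bar>c\<bar> * vnorm n x"
proof -
  have "(vnorm n (\<lambda>i. c * x i))\<^sup>2 = (\<bar>c\<bar> * vnorm n x)\<^sup>2"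
    by (simp add: vnorm_square power_mult_distrib sum_distrib_left)
  then show ?thesis by (simp add: power2_eq_iff_nonneg)
qed

lemma vnorm_triangle: "vnorm n (\<lambda>i. x i + y i) \<le> vnorm n x + vnorm n y"
  unfolding vnorm_def by (rule L2_set_triangle_ineq)

lemma vnorm_triangle_diff: "vnorm n (\<lambda>i. x i - y i) \<le> vnorm n x + vnorm n y"
  using vnorm_triangle[of n x "\<lambda>i. - 1 * y i"] vnorm_scale[of n "- 1" y] by simp

lemma abs_inner_le_vnorm: "\<bar>\<Sum>i<n. x i * y i\<bar> \<le> vnorm n x * vnorm n y"
proof -
  have "\<bar>\<Sum>i<n. x i * y i\<bar> \<le> (\<Sum>i<n. \<bar>x i\<bar> * \<bar>y i\<bar>)"
    by (rule order_trans[OF sum_abs]) (simp add: abs_mult)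
  also have "\<dots> \<le> vnorm n x * vnorm n y"
    unfolding vnorm_def by (rule L2_set_mult_ineq)
  finally show ?thesis .
qed

lemma matpow_matvec:
  "i < n \<Longrightarrow> (matvec n M ^^ k) x i = (\<Sum>j<n. matpow n M k i j * x j)"
proof (induction k arbitrary: x i)
  case (Suc k)
  have "(matvec n M ^^ Suc k) x i = (matvec n M ^^ k) (matvec n M x) i"
    by (simp add: funpow_swap1)
  also have "\<dots> = (\<Sum>l<n. matpow n M k i l * matvec n M x l)"
    using Suc by simp
  also have "\<dots> = (\<Sum>l<n. \<Sum>j<n. matpow n M k i l * M l j * x j)"
    by (simp add: matvec_def sum_distrib_left mult.assoc)
  also have "\<dots> = (\<Sum>j<n. \<Sum>l<n. matpow n M k i l * M l j * x j)"
    by (rule sum.swap)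
  finally show ?case by (simp add: sum_distrib_right)
qed (simp add: of_bool_def if_distrib[of "\<lambda>a. a * _"] cong: if_cong)

lemma matpow_add:
  assumes "j < n"
  shows "matpow n M (a + b) i j = (\<Sum>l<n. matpow n M a i l * matpow n M b l j)"
  using assms
proof (induction b arbitrary: j)
  case (Suc b)
  have "matpow n M (a + Suc b) i j = (\<Sum>m<n. (\<Sum>l<n. matpow n M a i l * matpow n M b l m) * M m j)"
    using Suc.IH by simp
  also have "\<dots> = (\<Sum>m<n. \<Sum>l<n. matpow n M a i l * (matpow n M b l m * M m j))"
    by (simp add: sum_distrib_right mult.assoc)
  also have "\<dots> = (\<Sum>l<n. \<Sum>m<n. matpow n M a i l * (matpow n M b l m * M m j))"
    by (rule sum.swap)
  finally show ?case by (simp add: sum_distrib_left)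
qed (simp add: of_bool_def if_distrib[of "\<lambda>a. _ * a"] cong: if_cong)

lemma matpow_sym:
  assumes "\<And>i j. M i j = M j i" "i < n" "j < n"
  shows "matpow n M k i j = matpow n M k j i"
  using assms(2,3)
proof (induction k arbitrary: i j)
  case (Suc k)
  \<comment> \<open>\<open>matpow\<close> grows on the right, but transposing needs a factor split
    off on the left; \<open>matpow_add\<close> with first exponent \<open>1\<close> provides
    it.\<close>
  have 1: "matpow n M 1 j l = M j l" for l
    using \<open>j < n\<close> by (simp add: of_bool_def if_distrib[of "\<lambda>a. a * _"] cong: if_cong)
  have "matpow n M (Suc k) i j = (\<Sum>l<n. matpow n M 1 j l * matpow n M k l i)"
    unfolding 1 using Suc assms(1) by (auto intro!: sum.cong simp: mult.commute)
  also have "\<dots> = matpow n M (Suc k) j i"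
    using matpow_add[of i n M 1 k j] Suc.prems by simp
  finally show ?case .
qed auto

text \<open>The diagonal of the product of \<open>M^p\<close> with itself pairs each entry with its
  mirror image. The sum of squares makes the trace nonnegative, as Markov's inequality needs, and is
  the squared Frobenius norm of \<open>M^p\<close>.\<close>

lemma trace_even_power:
  assumes "\<And>i j. M i j = M j i"
  shows "(\<Sum>i<n. matpow n M (2 * p) i i) = (\<Sum>i<n. \<Sum>j<n. (matpow n M p i j)\<^sup>2)"
proof (rule sum.cong)
  fix i assume i: "i \<in> {..<n}"
  have "matpow n M (p + p) i i = (\<Sum>j<n. matpow n M p i j * matpow n M p j i)"
    using i by (intro matpow_add) auto
  also have "\<dots> = (\<Sum>j<n. (matpow n M p i j)\<^sup>2)"
    using i matpow_sym[where M = M, OF assms] by (auto simp: power2_eq_square intro!: sum.cong)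
  finally show "matpow n M (2 * p) i i = (\<Sum>j<n. (matpow n M p i j)\<^sup>2)"
    by (simp add: mult_2)
qed simp

text \<open>For symmetric \<open>M\<close> the sequence \<open>k \<mapsto> \<parallel>M\<^sup>k x\<parallel>\<close> is log-convex, so it grows at least
  geometrically with ratio \<open>\<parallel>M x\<parallel> / \<parallel>x\<parallel>\<close>.\<close>

lemma vnorm_matvec_power_le:
  assumes sym: "\<And>i j. M i j = M j i"
  shows "vnorm n (matvec n M x) ^ Suc k \<le> vnorm n x ^ k * vnorm n ((matvec n M ^^ Suc k) x)"
proof -
  define a where "a k = vnorm n ((matvec n M ^^ k) x)" for k
  have a0: "a k \<ge> 0" for k by (simp add: a_def)
  have inner: "(\<Sum>i<n. matvec n M y i * z i) = (\<Sum>i<n. y i * matvec n M z i)" for y z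
  proof -
    have "(\<Sum>i<n. matvec n M y i * z i) = (\<Sum>i<n. \<Sum>j<n. M i j * y j * z i)"
      by (simp add: matvec_def sum_distrib_right)
    also have "\<dots> = (\<Sum>j<n. \<Sum>i<n. M i j * y j * z i)" by (rule sum.swap)
    also have "\<dots> = (\<Sum>j<n. y j * matvec n M z j)"
      using sym by (auto simp: matvec_def sum_distrib_left mult_ac intro!: sum.cong)
    finally show ?thesis .
  qed
  \<comment> \<open>Move one factor \<open>M\<close> across the inner product, then apply
    Cauchy-Schwarz to the iterates \<open>k\<close> and \<open>k + 2\<close>.\<close>
  have conv: "(a (Suc k))\<^sup>2 \<le> a k * a (Suc (Suc k))" for k
  proof -
    have "(a (Suc k))\<^sup>2 = (\<Sum>i<n. matvec n M ((matvec n M ^^ k) x) i * matvec n M ((matvec n M ^^ k) x) i)"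
      unfolding a_def vnorm_square by (simp add: power2_eq_square)
    also have "\<dots> = (\<Sum>i<n. (matvec n M ^^ k) x i * (matvec n M ^^ Suc (Suc k)) x i)"
      by (subst inner) simp
    also have "\<dots> \<le> a k * a (Suc (Suc k))"
      unfolding a_def using abs_inner_le_vnorm abs_le_D1 by blast
    finally show ?thesis .
  qed
  \<comment> \<open>Monotonicity of the growth ratios in cross-multiplied form; a vanishing iterate
    then makes the left side zero.\<close>
  have ratio: "a 1 * a k \<le> a 0 * a (Suc k)" for k
  proof (induction k)
    case (Suc k)
    show ?case
    proof (cases "a (Suc k) = 0")
      case False
      then have pos: "a (Suc k) > 0" using a0[of "Suc k"] by simp
      have "a 1 * (a (Suc k))\<^sup>2 \<le> (a 1 * a k) * a (Suc (Suc k))"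
        using mult_left_mono[OF conv[of k] a0[of 1]] by (simp add: mult.assoc)
      also have "\<dots> \<le> (a 0 * a (Suc k)) * a (Suc (Suc k))"
        using Suc a0 by (intro mult_right_mono)
      finally have "a (Suc k) * (a 1 * a (Suc k)) \<le> a (Suc k) * (a 0 * a (Suc (Suc k)))"
        by (simp add: power2_eq_square mult_ac)
      then show ?thesis using pos by simp
    qed (simp add: a0)
  qed (simp add: mult.commute)
  have "a 1 ^ Suc k \<le> a 0 ^ k * a (Suc k)" for k
  proof (induction k)
    case (Suc k)
    have "a 1 ^ Suc (Suc k) \<le> a 1 * (a 0 ^ k * a (Suc k))"
      using mult_left_mono[OF Suc a0[of 1]] by simp
    also have "\<dots> = a 0 ^ k * (a 1 * a (Suc k))" by simp
    also have "\<dots> \<le> a 0 ^ k * (a 0 * a (Suc (Suc k)))"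
      using ratio a0 by (intro mult_left_mono) auto
    finally show ?case by (simp add: mult_ac)
  qed simp
  then show ?thesis by (simp add: a_def)
qed

lemma vnorm_matvec_le_frobenius:
  "(vnorm n (matvec n M x))\<^sup>2 \<le> (\<Sum>i<n. \<Sum>j<n. (M i j)\<^sup>2) * (vnorm n x)\<^sup>2"
proof -
  have "(vnorm n (matvec n M x))\<^sup>2 = (\<Sum>i<n. (\<Sum>j<n. M i j * x j)\<^sup>2)"
    by (simp add: vnorm_square matvec_def)
  also have "\<dots> \<le> (\<Sum>i<n. (\<Sum>j<n. (M i j)\<^sup>2) * (\<Sum>j<n. (x j)\<^sup>2))"
    by (intro sum_mono Cauchy_Schwarz_ineq_sum)
  finally show ?thesis by (simp add: vnorm_square sum_distrib_right)
qed

text \<open>Usually read off from eigenvalues; here log-convexity passes from \<open>M x\<close> to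
  the \<open>p\<close>-th iterate, and the Frobenius norm of \<open>M^p\<close> bounds that iterate.
  This is how a trace moment controls the operator norm.\<close>

lemma vnorm_matvec_power_le_trace:
  assumes sym: "\<And>i j. M i j = M j i" and "p > 0"
  shows "vnorm n (matvec n M x) ^ (2 * p) \<le> (\<Sum>i<n. matpow n M (2 * p) i i) * vnorm n x ^ (2 * p)"
proof -
  obtain k where k: "p = Suc k" using \<open>p > 0\<close> gr0_conv_Suc by auto
  define T where "T = (\<Sum>i<n. matpow n M (2 * p) i i)"
  have "(matvec n M ^^ p) x i = matvec n (matpow n M p) x i" if "i < n" for i
    using that matpow_matvec[where i = i and n = n and M = M and k = p and x = x] by (simp add: matvec_def)
  then have "(vnorm n ((matvec n M ^^ p) x))\<^sup>2 \<le> T * (vnorm n x)\<^sup>2"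
    using vnorm_matvec_le_frobenius[of n "matpow n M p" x]
    by (simp add: T_def trace_even_power[where M = M, OF sym] vnorm_cong[of n "(matvec n M ^^ p) x"])
  moreover have "(vnorm n (matvec n M x) ^ p)\<^sup>2 \<le> (vnorm n x ^ k * vnorm n ((matvec n M ^^ p) x))\<^sup>2"
    using vnorm_matvec_power_le[where M = M and n = n and x = x and k = k, OF sym] by (intro power_mono) (auto simp: k)
  ultimately have "(vnorm n (matvec n M x) ^ p)\<^sup>2 \<le> (vnorm n x ^ k)\<^sup>2 * (T * (vnorm n x)\<^sup>2)"
    by (smt (verit) mult_left_mono power_mult_distrib zero_le_power2)
  then show ?thesis unfolding T_def[symmetric]
    by (simp add: k power_mult_distrib mult_ac power_mult flip: power_mult)
       (simp add: mult_ac power2_eq_square flip: power_add)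
qed

text \<open>Column \<open>j\<close> of \<open>M^p\<close> is the \<open>p\<close>-th iterate of the
  unit vector \<open>e\<close>, so each of the \<open>n\<close> columns has norm at most
  \<open>l^p\<close>. The bound is meant for matrices whose dimension is comparable to
  \<open>p\<close>, where the factor \<open>n\<close> is harmless.\<close>

lemma trace_even_power_le:
  assumes sym: "\<And>i j. M i j = M j i"
    and le: "\<And>x. vnorm n (matvec n M x) \<le> l * vnorm n x" and "l \<ge> 0"
  shows "(\<Sum>i<n. matpow n M (2 * p) i i) \<le> real n * l ^ (2 * p)"
proof -
  have pow: "vnorm n ((matvec n M ^^ k) x) \<le> l ^ k * vnorm n x" for k x
  proof (induction k)
    case (Suc k)
    have "vnorm n ((matvec n M ^^ Suc k) x) \<le> l * vnorm n ((matvec n M ^^ k) x)"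
      using le by simp
    also have "\<dots> \<le> l * (l ^ k * vnorm n x)"
      using Suc \<open>l \<ge> 0\<close> by (intro mult_left_mono)
    finally show ?case by simp
  qed simp
  have "(\<Sum>i<n. matpow n M (2 * p) i i) = (\<Sum>j<n. \<Sum>i<n. (matpow n M p i j)\<^sup>2)"
    unfolding trace_even_power[where M = M, OF sym] by (rule sum.swap)
  also have "\<dots> \<le> (\<Sum>j<n. (l ^ p)\<^sup>2)"
  proof (rule sum_mono)
    fix j assume j: "j \<in> {..<n}"
    define e where "e = (\<lambda>i. of_bool (i = j) :: real)"
    have e1: "vnorm n e = 1"
      using j by (simp add: vnorm_def L2_set_def e_def of_bool_def if_distrib[of "\<lambda>a. a ^ _"] cong: if_cong)
    have "(\<Sum>i<n. (matpow n M p i j)\<^sup>2) = (vnorm n ((matvec n M ^^ p) e))\<^sup>2"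
      unfolding vnorm_square
    proof (rule sum.cong)
      fix i assume "i \<in> {..<n}"
      then show "(matpow n M p i j)\<^sup>2 = ((matvec n M ^^ p) e i)\<^sup>2"
        using j matpow_matvec[where i = i and n = n and M = M and k = p and x = e]
        by (simp add: e_def of_bool_def if_distrib[of "\<lambda>a. _ * a"] cong: if_cong)
    qed simp
    also have "\<dots> \<le> (l ^ p)\<^sup>2"
      using pow[of p e] e1 by (intro power_mono) auto
    finally show "(\<Sum>i<n. (matpow n M p i j)\<^sup>2) \<le> (l ^ p)\<^sup>2" .
  qed
  finally show ?thesis by (simp add: power_mult mult.commute flip: power_mult)
qed

text \<open>The arbitrary endpoint weight \<open>h\<close> is what the induction needs: the last
  step of the walk is absorbed into it. Taking \<open>h i j = M j i\<close> closes the walk.\<close>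

lemma sum_PiE_matpow:
  "(\<Sum>u\<in>{..<Suc k} \<rightarrow>\<^sub>E {..<n}. (\<Prod>t<k. M (u t) (u (Suc t))) * h (u 0) (u k)) =
   (\<Sum>i<n. \<Sum>j<n. matpow n M k i j * h i j)"
proof (induction k arbitrary: h)
  case 0
  have "(\<Sum>u\<in>{..<Suc 0} \<rightarrow>\<^sub>E {..<n}. h (u 0) (u 0)) = (\<Sum>i<n. h i i)"
    by (rule sum.reindex_bij_witness[of _ "\<lambda>i. (\<lambda>_. undefined)(0 := i)" "\<lambda>u. u 0"])
       (auto simp: PiE_def extensional_def fun_eq_iff)
  then show ?case
    by (simp add: of_bool_def if_distrib[of "\<lambda>a. a * _"] cong: if_cong)
next
  case (Suc k)
  have ins: "{..<Suc (Suc k)} = insert (Suc k) {..<Suc k}" by auto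
  have "(\<Sum>u\<in>{..<Suc (Suc k)} \<rightarrow>\<^sub>E {..<n}. (\<Prod>t<Suc k. M (u t) (u (Suc t))) * h (u 0) (u (Suc k)))
     = (\<Sum>(y,g)\<in>{..<n} \<times> ({..<Suc k} \<rightarrow>\<^sub>E {..<n}). (\<Prod>t<k. M (g t) (g (Suc t))) * (M (g k) y * h (g 0) y))"
    unfolding ins
    by (rule sum.reindex_bij_witness[of _ "\<lambda>(y,g). g(Suc k := y)" "\<lambda>u. (u (Suc k), u(Suc k := undefined))"])
       (auto simp: PiE_def extensional_def fun_eq_iff mult.assoc intro!: prod.cong)
  also have "\<dots> = (\<Sum>y<n. \<Sum>g\<in>{..<Suc k} \<rightarrow>\<^sub>E {..<n}. (\<Prod>t<k. M (g t) (g (Suc t))) * (M (g k) y * h (g 0) y))"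
    by (rule sum.cartesian_product[symmetric])
  also have "\<dots> = (\<Sum>g\<in>{..<Suc k} \<rightarrow>\<^sub>E {..<n}. (\<Prod>t<k. M (g t) (g (Suc t))) * (\<Sum>y<n. M (g k) y * h (g 0) y))"
    by (subst sum.swap) (simp add: sum_distrib_left)
  also have "\<dots> = (\<Sum>i<n. \<Sum>j<n. matpow n M k i j * (\<Sum>y<n. M j y * h i y))"
    by (rule Suc.IH)
  also have "\<dots> = (\<Sum>i<n. \<Sum>y<n. \<Sum>j<n. matpow n M k i j * M j y * h i y)"
    by (subst (2) sum.swap) (simp add: sum_distrib_left mult.assoc)
  finally show ?case by (simp add: sum_distrib_right)
qed

lemma trace_matpow_closed_walks:
  assumes "q > 0"
  shows "(\<Sum>i<n. matpow n M q i i) =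
         (\<Sum>u\<in>{..<q} \<rightarrow>\<^sub>E {..<n}. \<Prod>t<q. M (u t) (u (Suc t mod q)))"
proof -
  obtain k where k: "q = Suc k" using assms gr0_conv_Suc by auto
  have "(\<Sum>i<n. matpow n M q i i) = (\<Sum>i<n. \<Sum>j<n. matpow n M k i j * M j i)"
    by (simp add: k)
  also have "\<dots> = (\<Sum>u\<in>{..<q} \<rightarrow>\<^sub>E {..<n}. (\<Prod>t<k. M (u t) (u (Suc t))) * M (u k) (u 0))"
    unfolding k by (rule sum_PiE_matpow[symmetric])
  also have "\<dots> = (\<Sum>u\<in>{..<q} \<rightarrow>\<^sub>E {..<n}. \<Prod>t<q. M (u t) (u (Suc t mod q)))"
    by (simp add: k)
  finally show ?thesis .
qed

section \<open>Shapes of closed walks\<close>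

definition step_edge :: "nat \<Rightarrow> (nat \<Rightarrow> nat) \<Rightarrow> nat \<Rightarrow> nat set" where
  "step_edge q u t = {u t, u (Suc t mod q)}"

text \<open>Only these closed walks can have nonzero expected weight: a loop step meets the zero
  diagonal, and an edge traversed exactly once contributes a factor of mean zero.\<close>

definition no_simple_step :: "nat \<Rightarrow> (nat \<Rightarrow> nat) \<Rightarrow> bool" where
  "no_simple_step q u \<longleftrightarrow>
     (\<forall>t<q. u t \<noteq> u (Suc t mod q) \<and> (\<exists>t'<q. t' \<noteq> t \<and> step_edge q u t' = step_edge q u t))"

text \<open>Canonical representative of the equality pattern of a walk: each time is sent to the
  first time at which its vertex is visited. The shape is itself a walk on \<open>{..<q}\<close>, so
  the notions for walks apply to it directly.\<close>

definition walk_kernel :: "nat \<Rightarrow> (nat \<Rightarrow> nat) \<Rightarrow> nat \<Rightarrow> nat" where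
  "walk_kernel q u = (\<lambda>t\<in>{..<q}. Min {t'. t' < q \<and> u t' = u t})"

lemma card_vertices_le_edges:
  assumes "q > 0"
  shows "card (u ` {..<q}) \<le> Suc (card (step_edge q u ` {..<q}))"
proof -
  \<comment> \<open>The induction stops at \<open>q - 1\<close>, so \<open>Suc t mod q\<close> is
    just \<open>Suc t\<close> on the steps considered; the closing step can only add an
    edge.\<close>
  have "t < q \<Longrightarrow> card (u ` {..t}) \<le> Suc (card (step_edge q u ` {..<t}))" for t
  proof (induction t)
    case (Suc t)
    have img: "u ` {..Suc t} = insert (u (Suc t)) (u ` {..t})"
      by (simp add: atMost_Suc)
    have edg: "step_edge q u ` {..<Suc t} = insert (step_edge q u t) (step_edge q u ` {..<t})"
      by (simp add: lessThan_Suc)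
    show ?case
    proof (cases "u (Suc t) \<in> u ` {..t}")
      case True
      have "card (step_edge q u ` {..<t}) \<le> card (step_edge q u ` {..<Suc t})"
        by (intro card_mono image_mono) auto
      then show ?thesis using Suc img True by (simp add: insert_absorb)
    next
      case False
      have "step_edge q u s \<subseteq> u ` {..t}" if "s < t" for s
        using that Suc.prems by (auto simp: step_edge_def)
      moreover have "u (Suc t) \<in> step_edge q u t"
        using Suc.prems by (simp add: step_edge_def)
      ultimately have "step_edge q u t \<notin> step_edge q u ` {..<t}"
        using False by blast
      then show ?thesis using Suc False unfolding img edg by simp
    qed
  qed simp
  from this[of "q - 1"] assms
  have "card (u ` {..q - 1}) \<le> Suc (card (step_edge q u ` {..<q - 1}))" by simp
  moreover have "{..q - 1} = {..<q}" using assms by auto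
  moreover have "card (step_edge q u ` {..<q - 1}) \<le> card (step_edge q u ` {..<q})"
    by (intro card_mono image_mono) auto
  ultimately show ?thesis by simp
qed

text \<open>Double counting: every edge accounts for at least two of the \<open>q\<close>
  times.\<close>

lemma card_edges_no_simple_step:
  assumes "no_simple_step q u"
  shows "2 * card (step_edge q u ` {..<q}) \<le> q"
proof -
  have "(\<Sum>e\<in>step_edge q u ` {..<q}. 2) \<le>
        (\<Sum>e\<in>step_edge q u ` {..<q}. card {t \<in> {..<q}. step_edge q u t = e})"
  proof (rule sum_mono)
    fix e assume "e \<in> step_edge q u ` {..<q}"
    then obtain t t' where "t < q" "t' < q" "t' \<noteq> t" "step_edge q u t = e" "step_edge q u t' = e"
      using assms by (auto simp: no_simple_step_def)
    then have "card {t, t'} \<le> card {t \<in> {..<q}. step_edge q u t = e}"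
      by (intro card_mono) auto
    then show "2 \<le> card {t \<in> {..<q}. step_edge q u t = e}"
      using \<open>t' \<noteq> t\<close> by simp
  qed
  also have "\<dots> = (\<Sum>t<q. 1)"
    using sum.image_gen[of "{..<q}" "\<lambda>_. 1::nat" "step_edge q u"] by simp
  finally show ?thesis by simp
qed

section \<open>Equality patterns of walks and their multiplicities\<close>

lemma kernel_in: "walk_kernel q u \<in> {..<q} \<rightarrow>\<^sub>E {..<q}"
proof -
  have "Min {t'. t' < q \<and> u t' = u t} \<in> {t'. t' < q \<and> u t' = u t}" if "t < q" for t
    using that by (intro Min_in) auto
  then show ?thesis by (auto simp: walk_kernel_def)
qed

lemma apply_kernel: "t < q \<Longrightarrow> u (walk_kernel q u t) = u t"
proof -
  assume "t < q"
  then have "Min {t'. t' < q \<and> u t' = u t} \<in> {t'. t' < q \<and> u t' = u t}"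
    by (intro Min_in) auto
  then show ?thesis using \<open>t < q\<close> by (auto simp: walk_kernel_def)
qed

lemma kernel_eq_iff:
  assumes "t < q" "t' < q"
  shows "walk_kernel q u t = walk_kernel q u t' \<longleftrightarrow> u t = u t'"
proof
  assume "walk_kernel q u t = walk_kernel q u t'"
  then have "u (walk_kernel q u t) = u (walk_kernel q u t')" by simp
  then show "u t = u t'" using assms by (simp only: apply_kernel)
next
  assume "u t = u t'"
  then show "walk_kernel q u t = walk_kernel q u t'" using assms by (simp add: walk_kernel_def)
qed

lemma kernel_cong:
  assumes "\<And>t t'. t < q \<Longrightarrow> t' < q \<Longrightarrow> u t = u t' \<longleftrightarrow> v t = v t'"
  shows "walk_kernel q u = walk_kernel q v"
proof
  fix t
  show "walk_kernel q u t = walk_kernel q v t"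
  proof (cases "t < q")
    case True
    have "{t'. t' < q \<and> u t' = u t} = {t'. t' < q \<and> v t' = v t}"
      by (intro Collect_cong conj_cong refl) (rule assms[OF _ True])
    then show ?thesis by (simp only: walk_kernel_def restrict_def)
  qed (simp only: walk_kernel_def restrict_def lessThan_iff if_False)
qed

lemma kernel_idem: "walk_kernel q (walk_kernel q u) = walk_kernel q u"
  by (intro kernel_cong kernel_eq_iff)

lemma step_edge_comp:
  assumes "t < q" "\<And>t. t < q \<Longrightarrow> u t = f (s t)"
  shows "step_edge q u t = f ` step_edge q s t"
proof -
  have "Suc t mod q < q" using assms(1) by simp
  then show ?thesis using assms by (simp add: step_edge_def)
qed

text \<open>Both quantities depend only on which vertices coincide, hence survive an injective
  relabelling. Applied with \<open>f = u\<close> and \<open>s = walk_kernel q u\<close>, this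
  transfers them between a walk and its shape.\<close>

lemma
  assumes u: "\<And>t. t < q \<Longrightarrow> u t = f (s t)" and inj: "inj_on f (s ` {..<q})"
  shows no_simple_step_comp: "no_simple_step q u \<longleftrightarrow> no_simple_step q s"
    and card_edges_comp: "card (step_edge q u ` {..<q}) = card (step_edge q s ` {..<q})"
proof -
  have m: "Suc t mod q < q" if "t < q" for t using that by simp
  have injP: "inj_on ((`) f) (Pow (s ` {..<q}))"
    using inj by (rule inj_on_image_Pow)
  have sub: "step_edge q s t \<in> Pow (s ` {..<q})" if "t < q" for t
    using that m[OF that] by (auto simp: step_edge_def)
  have e: "step_edge q u t = f ` step_edge q s t" if "t < q" for t
    using that u by (rule step_edge_comp)
  have 1: "step_edge q u t = step_edge q u t' \<longleftrightarrow> step_edge q s t = step_edge q s t'"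
    if "t < q" "t' < q" for t t'
    using inj_on_eq_iff[OF injP sub sub] that e by simp
  have 2: "u t = u (Suc t mod q) \<longleftrightarrow> s t = s (Suc t mod q)" if "t < q" for t
    using inj_on_eq_iff[OF inj, of "s t" "s (Suc t mod q)"] that m[OF that] u by simp
  show "no_simple_step q u \<longleftrightarrow> no_simple_step q s"
    unfolding no_simple_step_def by (intro all_cong1 imp_cong) (simp_all add: 1 2 cong: conj_cong)
  have "step_edge q u ` {..<q} = (`) f ` (step_edge q s ` {..<q})"
    by (auto simp: e image_iff)
  moreover have "inj_on ((`) f) (step_edge q s ` {..<q})"
    using sub by (intro inj_on_subset[OF injP]) auto
  ultimately show "card (step_edge q u ` {..<q}) = card (step_edge q s ` {..<q})"
    by (simp add: card_image)
qed

lemma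
  shows no_simple_step_kernel: "no_simple_step q (walk_kernel q u) \<longleftrightarrow> no_simple_step q u"
    and card_edges_kernel:
      "card (step_edge q (walk_kernel q u) ` {..<q}) = card (step_edge q u ` {..<q})"
proof -
  have inj: "inj_on u (walk_kernel q u ` {..<q})"
    by (auto simp: inj_on_def apply_kernel kernel_eq_iff)
  have "u t = u (walk_kernel q u t)" if "t < q" for t using that by (simp add: apply_kernel)
  from no_simple_step_comp[OF this inj] card_edges_comp[OF this inj]
  show "no_simple_step q (walk_kernel q u) \<longleftrightarrow> no_simple_step q u"
    "card (step_edge q (walk_kernel q u) ` {..<q}) = card (step_edge q u ` {..<q})"
    by auto
qed

lemma card_kernel_class:
  assumes s: "walk_kernel q s = s"
  shows "card {u \<in> {..<q} \<rightarrow>\<^sub>E {..<n}. walk_kernel q u = s} = (\<Prod>i<card (s ` {..<q}). n - i)"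
proof -
  define V where "V = s ` {..<q}"
  have sq: "s t < q" if "t < q" for t
    using kernel_in[of q s] that unfolding s by auto
  have idem: "s (s t) = s t" if "t < q" for t
    using apply_kernel[OF that, of s] unfolding s .
  have "bij_betw (\<lambda>f. \<lambda>t\<in>{..<q}. f (s t)) {f \<in> V \<rightarrow>\<^sub>E {..<n}. inj_on f V}
      {u \<in> {..<q} \<rightarrow>\<^sub>E {..<n}. walk_kernel q u = s}"
  proof (rule bij_betw_byWitness[of _ "\<lambda>u. restrict u V"], goal_cases)
    case 1
    show ?case
    proof safe
      fix f assume f: "f \<in> V \<rightarrow>\<^sub>E {..<n}"
      show "restrict (\<lambda>t\<in>{..<q}. f (s t)) V = f"
      proof
        fix v show "restrict (\<lambda>t\<in>{..<q}. f (s t)) V v = f v"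
          using f sq idem by (cases "v \<in> V") (auto simp: V_def PiE_def extensional_def)
      qed
    qed
  next
    case 2
    show ?case
    proof
      fix u assume "u \<in> {u \<in> {..<q} \<rightarrow>\<^sub>E {..<n}. walk_kernel q u = s}"
      then have u: "u \<in> {..<q} \<rightarrow>\<^sub>E {..<n}" and k: "walk_kernel q u = s" by auto
      show "(\<lambda>t\<in>{..<q}. restrict u V (s t)) = u"
      proof
        fix t show "(\<lambda>t\<in>{..<q}. restrict u V (s t)) t = u t"
          using u apply_kernel[of t q u, unfolded k]
          by (cases "t < q") (auto simp: V_def PiE_def extensional_def)
      qed
    qed
  next
    case 3
    show ?case
    proof
      fix u assume "u \<in> (\<lambda>f. \<lambda>t\<in>{..<q}. f (s t)) ` {f \<in> V \<rightarrow>\<^sub>E {..<n}. inj_on f V}"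
      then obtain f where f: "f \<in> V \<rightarrow>\<^sub>E {..<n}" and inj: "inj_on f V"
        and u: "u = (\<lambda>t\<in>{..<q}. f (s t))" by auto
      have "u \<in> {..<q} \<rightarrow>\<^sub>E {..<n}"
        using f by (auto simp: u V_def)
      moreover have "walk_kernel q u = walk_kernel q s"
        using inj by (intro kernel_cong) (simp add: u V_def inj_on_eq_iff)
      ultimately show "u \<in> {u \<in> {..<q} \<rightarrow>\<^sub>E {..<n}. walk_kernel q u = s}" by (simp add: s)
    qed
  next
    case 4
    show ?case
    proof
      fix w assume "w \<in> (\<lambda>u. restrict u V) ` {u \<in> {..<q} \<rightarrow>\<^sub>E {..<n}. walk_kernel q u = s}"
      then obtain u where u: "u \<in> {..<q} \<rightarrow>\<^sub>E {..<n}" and k: "walk_kernel q u = s" and w: "w = restrict u V"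
        by auto
      have "restrict u V \<in> V \<rightarrow>\<^sub>E {..<n}"
        using u sq by (auto simp: V_def PiE_def Pi_def)
      moreover have "inj_on (restrict u V) V"
      proof (rule inj_onI)
        fix v v' assume v: "v \<in> V" "v' \<in> V" "restrict u V v = restrict u V v'"
        then obtain t t' where t: "t < q" "t' < q" "v = s t" "v' = s t'" by (auto simp: V_def)
        then have "u t = u t'" using v apply_kernel[of t q u] apply_kernel[of t' q u] k by simp
        then show "v = v'" using t kernel_eq_iff[of t q t' u] k by simp
      qed
      ultimately show "w \<in> {f \<in> V \<rightarrow>\<^sub>E {..<n}. inj_on f V}" using w by simp
    qed
  qed
  then have "card {u \<in> {..<q} \<rightarrow>\<^sub>E {..<n}. walk_kernel q u = s} = card {f \<in> V \<rightarrow>\<^sub>E {..<n}. inj_on f V}"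
    by (simp add: bij_betw_same_card)
  also have "\<dots> = (\<Prod>i<card V. n - i)"
    using card_inj_on_subset_funcset[of V "{..<n}" V] by (simp add: V_def atLeast0LessThan)
  finally show ?thesis by (simp add: V_def)
qed

text \<open>Each shape of a closed walk with \<open>m\<close> vertices and at least \<open>m - 1\<close> edges is realised at most
  \<open>n\<^sup>m\<close> times on \<open>n\<close> vertices, and at least \<open>r (n \<alpha>)\<^bsup>m - 1\<^esup>\<close> times on \<open>r\<close> vertices; this is the
  comparison argument of Bandeira and van Handel.\<close>

lemma closed_walk_comparison:
  fixes \<alpha> :: real
  assumes p: "p > 0" and \<alpha>: "0 \<le> \<alpha>" "\<alpha> \<le> 1" and r: "real r \<ge> real n * \<alpha> + real p"
  shows "(\<Sum>u | u \<in> {..<2 * p} \<rightarrow>\<^sub>E {..<n} \<and> no_simple_step (2 * p) u.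
            \<alpha> ^ card (step_edge (2 * p) u ` {..<2 * p}))
         \<le> real n / real r * real (card {u \<in> {..<2 * p} \<rightarrow>\<^sub>E {..<r}. no_simple_step (2 * p) u})"
proof -
  define q where "q = 2 * p"
  define D where "D = {..<q} \<rightarrow>\<^sub>E {..<q}"
  define S where "S N = {u \<in> {..<q} \<rightarrow>\<^sub>E {..<N}. no_simple_step q u}" for N
  have q0: "q > 0" using p by (simp add: q_def)
  have r0: "real r > 0" using r p \<alpha> by (smt (verit) mult_nonneg_nonneg of_nat_0_le_iff of_nat_0_less_iff)
  have fin: "finite D" "finite (S N)" for N
    by (simp_all add: D_def S_def finite_PiE)
  have ker: "walk_kernel q ` S N \<subseteq> D" for N
    using kernel_in by (auto simp: D_def)
  have class_le: "(\<Sum>u | u \<in> S n \<and> walk_kernel q u = s. \<alpha> ^ card (step_edge q u ` {..<q}))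
      \<le> real n / real r * (\<Sum>u | u \<in> S r \<and> walk_kernel q u = s. 1)" if "s \<in> D" for s
  proof (cases "walk_kernel q s = s \<and> no_simple_step q s")
    case False
    have "{u. u \<in> S n \<and> walk_kernel q u = s} = {}"
      using False kernel_idem[of q] no_simple_step_kernel[of q] unfolding S_def by blast
    then show ?thesis by (simp only: sum.empty) simp
  next
    case True
    define m where "m = card (s ` {..<q})"
    define E where "E = card (step_edge q s ` {..<q})"
    have eq: "{u. u \<in> S N \<and> walk_kernel q u = s} = {u \<in> {..<q} \<rightarrow>\<^sub>E {..<N}. walk_kernel q u = s}" for N
      using True no_simple_step_kernel[of q] by (auto simp: S_def)
    have card: "card {u. u \<in> S N \<and> walk_kernel q u = s} = (\<Prod>i<m. N - i)" for N
      unfolding eq m_def using True by (intro card_kernel_class) auto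
    have m0: "m > 0" using q0 by (auto simp: m_def card_gt_0_iff)
    then obtain k where k: "m = Suc k" using gr0_conv_Suc by auto
    \<comment> \<open>Both sides are compared at exponent \<open>k = m - 1\<close>. On
      \<open>n\<close> vertices, \<open>k <= E\<close> lets \<alpha> to the power \<open>E\<close>
      grow to the power \<open>k\<close>; on \<open>r\<close> vertices, \<open>k <= E <= p\<close>
      keeps each factor of the falling factorial after the first at least
      \<open>r - p >= n \<alpha>\<close>.\<close>
    have kE: "k \<le> E" using card_vertices_le_edges[OF q0, of s] by (simp add: k E_def flip: m_def)
    have Ep: "E \<le> p" using card_edges_no_simple_step[of q s] True by (simp add: E_def q_def)
    have "(\<Sum>u | u \<in> S n \<and> walk_kernel q u = s. \<alpha> ^ card (step_edge q u ` {..<q}))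
        = real (\<Prod>i<m. n - i) * \<alpha> ^ E"
    proof -
      have "\<alpha> ^ card (step_edge q u ` {..<q}) = \<alpha> ^ E" if "walk_kernel q u = s" for u
        using card_edges_kernel[of q u] that by (simp add: E_def)
      then have "(\<Sum>u | u \<in> S n \<and> walk_kernel q u = s. \<alpha> ^ card (step_edge q u ` {..<q}))
          = (\<Sum>u | u \<in> S n \<and> walk_kernel q u = s. \<alpha> ^ E)"
        by (intro sum.cong) auto
      then show ?thesis using card[of n] by simp
    qed
    also have "\<dots> \<le> real n ^ m * \<alpha> ^ k"
    proof (intro mult_mono)
      have "real (\<Prod>i<m. n - i) \<le> real (\<Prod>i<m. n)"
        by (intro of_nat_mono prod_mono) auto
      then show "real (\<Prod>i<m. n - i) \<le> real n ^ m" by simp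
      show "\<alpha> ^ E \<le> \<alpha> ^ k" using kE \<alpha> by (rule power_decreasing)
    qed (use \<alpha> in auto)
    also have "\<dots> = real n / real r * (real r * (real n * \<alpha>) ^ k)"
      using r0 by (simp add: k power_mult_distrib)
    also have "\<dots> \<le> real n / real r * real (\<Prod>i<m. r - i)"
    proof (intro mult_left_mono)
      have "(real n * \<alpha>) ^ k = (\<Prod>i<k. real n * \<alpha>)" by simp
      also have "\<dots> \<le> (\<Prod>i<k. real (r - Suc i))"
      proof (rule prod_mono, safe)
        fix i assume "i < k"
        then have "real (Suc i) \<le> real p" using kE Ep by simp
        moreover have "real (r - Suc i) \<ge> real r - real (Suc i)" by simp
        ultimately show "real n * \<alpha> \<le> real (r - Suc i)" using r by linarith
      qed (use \<alpha> in auto)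
      finally have "(real n * \<alpha>) ^ k \<le> (\<Prod>i<k. real (r - Suc i))" .
      then have "real r * (real n * \<alpha>) ^ k \<le> real r * (\<Prod>i<k. real (r - Suc i))"
        by (intro mult_left_mono) auto
      also have "\<dots> = real (\<Prod>i<m. r - i)"
        unfolding k prod.lessThan_Suc_shift by simp
      finally show "real r * (real n * \<alpha>) ^ k \<le> real (\<Prod>i<m. r - i)" .
    qed auto
    also have "real (\<Prod>i<m. r - i) = (\<Sum>u | u \<in> S r \<and> walk_kernel q u = s. 1)"
      using card[of r] by simp
    finally show ?thesis .
  qed
  have "(\<Sum>u\<in>S n. \<alpha> ^ card (step_edge q u ` {..<q}))
     = (\<Sum>s\<in>D. \<Sum>u | u \<in> S n \<and> walk_kernel q u = s. \<alpha> ^ card (step_edge q u ` {..<q}))"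
    by (rule sum.group[symmetric]) (use fin ker in auto)
  also have "\<dots> \<le> (\<Sum>s\<in>D. real n / real r * (\<Sum>u | u \<in> S r \<and> walk_kernel q u = s. 1))"
    using class_le by (rule sum_mono)
  also have "\<dots> = real n / real r * (\<Sum>u\<in>S r. 1)"
    unfolding sum_distrib_left[symmetric]
    by (subst sum.group) (use fin ker in auto)
  finally show ?thesis by (simp add: S_def q_def)
qed

section \<open>Trace moments of random symmetric matrices\<close>

definition pairs :: "nat \<Rightarrow> (nat \<times> nat) set" where
  "pairs n = {(i, j). i < j \<and> j < n}"

definition symmat :: "(nat \<times> nat \<Rightarrow> real) \<Rightarrow> nat \<Rightarrow> nat \<Rightarrow> real" where
  "symmat X i j = (if i = j then 0 else X (min i j, max i j))"

definition edge_count :: "nat \<Rightarrow> (nat \<Rightarrow> nat) \<Rightarrow> nat \<times> nat \<Rightarrow> nat" where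
  "edge_count q u e = card {t \<in> {..<q}. step_edge q u t = {fst e, snd e}}"

lemma finite_pairs [simp]: "finite (pairs n)"
  by (rule finite_subset[of _ "{..<n} \<times> {..<n}"]) (auto simp: pairs_def)

lemma symmat_sym: "symmat X i j = symmat X j i"
  by (simp add: symmat_def min.commute max.commute)

lemma inj_on_pairs: "inj_on (\<lambda>e. {fst e, snd e}) (pairs n)"
  by (auto simp: inj_on_def pairs_def doubleton_eq_iff)

text \<open>The ordered pair \<open>g t\<close> represents the undirected edge of step
  \<open>t\<close>. Grouping the times by it turns the walk weight into a product of powers of
  independent entries.\<close>

lemma
  assumes u: "\<And>t. t < q \<Longrightarrow> u t < n" and ne: "\<And>t. t < q \<Longrightarrow> u t \<noteq> u (Suc t mod q)"
  shows prod_symmat_walk: "(\<Prod>t<q. symmat X (u t) (u (Suc t mod q))) = (\<Prod>e\<in>pairs n. X e ^ edge_count q u e)"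
    and step_edge_pairs: "step_edge q u ` {..<q} = (\<lambda>e. {fst e, snd e}) ` {e \<in> pairs n. edge_count q u e > 0}"
    and no_simple_step_iff_edge_count: "no_simple_step q u \<longleftrightarrow> (\<forall>e\<in>pairs n. edge_count q u e \<noteq> 1)"
proof -
  define g where "g t = (min (u t) (u (Suc t mod q)), max (u t) (u (Suc t mod q)))" for t
  have m: "Suc t mod q < q" if "t < q" for t using that by simp
  have g: "g t \<in> pairs n" if "t < q" for t
    using u[OF that] u[OF m[OF that]] ne[OF that] by (auto simp: g_def pairs_def)
  have gs: "step_edge q u t = {fst (g t), snd (g t)}" for t
    by (auto simp: g_def step_edge_def min_def max_def)
  have iff: "step_edge q u t = {fst e, snd e} \<longleftrightarrow> g t = e" if "t < q" "e \<in> pairs n" for t e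
    unfolding gs using inj_on_eq_iff[OF inj_on_pairs g[OF that(1)] that(2)] by simp
  have cnt: "edge_count q u e = card {t \<in> {..<q}. g t = e}" if "e \<in> pairs n" for e
    unfolding edge_count_def using iff that by (metis (mono_tags, lifting) lessThan_iff)
  have "(\<Prod>t<q. symmat X (u t) (u (Suc t mod q))) = (\<Prod>t<q. X (g t))"
    using ne by (intro prod.cong) (auto simp: symmat_def g_def)
  also have "\<dots> = (\<Prod>e\<in>pairs n. \<Prod>t | t \<in> {..<q} \<and> g t = e. X (g t))"
    by (rule prod.group[symmetric]) (use g in auto)
  also have "\<dots> = (\<Prod>e\<in>pairs n. X e ^ edge_count q u e)"
    by (intro prod.cong) (auto simp: cnt)
  finally show "(\<Prod>t<q. symmat X (u t) (u (Suc t mod q))) = (\<Prod>e\<in>pairs n. X e ^ edge_count q u e)" .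
  have "{e \<in> pairs n. edge_count q u e > 0} = g ` {..<q}"
    using g by (force simp: cnt card_gt_0_iff)
  then show "step_edge q u ` {..<q} = (\<lambda>e. {fst e, snd e}) ` {e \<in> pairs n. edge_count q u e > 0}"
    by (auto simp: gs)
  show "no_simple_step q u \<longleftrightarrow> (\<forall>e\<in>pairs n. edge_count q u e \<noteq> 1)"
  proof
    assume nss: "no_simple_step q u"
    show "\<forall>e\<in>pairs n. edge_count q u e \<noteq> 1"
    proof (intro ballI notI)
      fix e assume e: "e \<in> pairs n" "edge_count q u e = 1"
      from e(2) obtain t where t: "{t \<in> {..<q}. step_edge q u t = {fst e, snd e}} = {t}"
        unfolding edge_count_def by (rule card_1_singletonE)
      then have "t < q" "step_edge q u t = {fst e, snd e}" by auto
      with nss obtain t' where "t' < q" "t' \<noteq> t" "step_edge q u t' = {fst e, snd e}"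
        unfolding no_simple_step_def by metis
      then have "t' \<in> {t \<in> {..<q}. step_edge q u t = {fst e, snd e}}" by simp
      then show False using \<open>t' \<noteq> t\<close> unfolding t by simp
    qed
  next
    assume c: "\<forall>e\<in>pairs n. edge_count q u e \<noteq> 1"
    show "no_simple_step q u"
      unfolding no_simple_step_def
    proof (intro allI impI conjI ne)
      fix t assume t: "t < q"
      let ?T = "{s \<in> {..<q}. step_edge q u s = step_edge q u t}"
      have "card ?T \<noteq> 1"
        using c g[OF t] gs[of t] by (simp add: edge_count_def)
      moreover have "?T = {t}" if "\<not> (\<exists>t'<q. t' \<noteq> t \<and> step_edge q u t' = step_edge q u t)"
        using that t by auto
      ultimately show "\<exists>t'<q. t' \<noteq> t \<and> step_edge q u t' = step_edge q u t" by fastforce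
    qed
  qed
qed

section \<open>Independence and expected traces\<close>

lemma expectation_prod_Pi_pmf_finite:
  fixes f :: "'a \<Rightarrow> 'b \<Rightarrow> real"
  assumes "finite I" "\<And>x. x \<in> I \<Longrightarrow> finite (set_pmf (D x))"
  shows "measure_pmf.expectation (Pi_pmf I d D) (\<lambda>\<omega>. \<Prod>x\<in>I. f x (\<omega> x)) =
         (\<Prod>x\<in>I. measure_pmf.expectation (D x) (f x))"
proof -
  have fin: "finite (set_pmf (Pi_pmf I d D))"
    using assms by (auto simp: set_Pi_pmf intro!: finite_PiE_dflt)
  have ind: "prob_space.indep_vars (measure_pmf (Pi_pmf I d D)) (\<lambda>_. borel) (\<lambda>x \<omega>. f x (\<omega> x)) I"
    by (rule prob_space.indep_vars_compose2[OF measure_pmf.prob_space_axioms indep_vars_Pi_pmf[OF assms(1)]])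
       auto
  have "measure_pmf.expectation (Pi_pmf I d D) (\<lambda>\<omega>. \<Prod>x\<in>I. f x (\<omega> x)) =
      (\<Prod>x\<in>I. measure_pmf.expectation (Pi_pmf I d D) (\<lambda>\<omega>. f x (\<omega> x)))"
    by (rule prob_space.indep_vars_lebesgue_integral[OF measure_pmf.prob_space_axioms assms(1) ind])
       (auto intro: integrable_measure_pmf_finite fin)
  also have "\<dots> = (\<Prod>x\<in>I. measure_pmf.expectation (map_pmf (\<lambda>\<omega>. \<omega> x) (Pi_pmf I d D)) (f x))"
    by simp
  also have "\<dots> = (\<Prod>x\<in>I. measure_pmf.expectation (D x) (f x))"
    using assms(1) by (intro prod.cong) (simp_all add: Pi_pmf_component)
  finally show ?thesis .
qed

definition bernoulli_field :: "nat \<Rightarrow> (nat \<times> nat \<Rightarrow> real) \<Rightarrow> (nat \<times> nat \<Rightarrow> bool) pmf" where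
  "bernoulli_field n \<rho> = Pi_pmf (pairs n) False (\<lambda>e. bernoulli_pmf (\<rho> e))"

lemma finite_set_bernoulli_field: "finite (set_pmf (bernoulli_field n \<rho>))"
  unfolding bernoulli_field_def by (subst set_Pi_pmf) (auto intro!: finite_PiE_dflt)

lemma integrable_bernoulli_field [simp]:
  fixes f :: "(nat \<times> nat \<Rightarrow> bool) \<Rightarrow> real"
  shows "integrable (measure_pmf (bernoulli_field n \<rho>)) f"
  by (rule integrable_measure_pmf_finite) (rule finite_set_bernoulli_field)

lemma expectation_prod_bernoulli_field:
  "measure_pmf.expectation (bernoulli_field n \<rho>) (\<lambda>\<omega>. \<Prod>e\<in>pairs n. f e (\<omega> e) :: real) =
     (\<Prod>e\<in>pairs n. measure_pmf.expectation (bernoulli_pmf (\<rho> e)) (f e))"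
  unfolding bernoulli_field_def by (rule expectation_prod_Pi_pmf_finite) auto

lemma expectation_trace_bernoulli_field:
  assumes "q > 0"
  shows "measure_pmf.expectation (bernoulli_field n \<rho>)
           (\<lambda>\<omega>. \<Sum>i<n. matpow n (symmat (\<lambda>e. f e (\<omega> e))) q i i) =
     (\<Sum>u | u \<in> {..<q} \<rightarrow>\<^sub>E {..<n} \<and> (\<forall>t<q. u t \<noteq> u (Suc t mod q)).
        \<Prod>e\<in>pairs n. measure_pmf.expectation (bernoulli_pmf (\<rho> e)) (\<lambda>b. f e b ^ edge_count q u e))"
proof -
  let ?E = "measure_pmf.expectation (bernoulli_field n \<rho>)"
  let ?w = "\<lambda>u \<omega>. \<Prod>t<q. symmat (\<lambda>e. f e (\<omega> e)) (u t) (u (Suc t mod q))"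
  have "?E (\<lambda>\<omega>. \<Sum>i<n. matpow n (symmat (\<lambda>e. f e (\<omega> e))) q i i) =
      (\<Sum>u\<in>{..<q} \<rightarrow>\<^sub>E {..<n}. ?E (?w u))"
    using assms by (simp add: trace_matpow_closed_walks Bochner_Integration.integral_sum)
  also have "\<dots> = (\<Sum>u | u \<in> {..<q} \<rightarrow>\<^sub>E {..<n} \<and> (\<forall>t<q. u t \<noteq> u (Suc t mod q)). ?E (?w u))"
  proof (rule sum.mono_neutral_right)
    show "\<forall>u\<in>({..<q} \<rightarrow>\<^sub>E {..<n}) - {u. u \<in> {..<q} \<rightarrow>\<^sub>E {..<n} \<and> (\<forall>t<q. u t \<noteq> u (Suc t mod q))}. ?E (?w u) = 0"
    proof
      fix u assume "u \<in> ({..<q} \<rightarrow>\<^sub>E {..<n}) - {u. u \<in> {..<q} \<rightarrow>\<^sub>E {..<n} \<and> (\<forall>t<q. u t \<noteq> u (Suc t mod q))}"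
      then obtain t where "t < q" "u t = u (Suc t mod q)" by auto
      then have "?w u = (\<lambda>\<omega>. 0)"
        by (intro ext prod_zero) (auto simp: symmat_def)
      then show "?E (?w u) = 0" by (simp only: integral_zero)
    qed
  qed (auto simp: finite_PiE)
  also have "\<dots> = (\<Sum>u | u \<in> {..<q} \<rightarrow>\<^sub>E {..<n} \<and> (\<forall>t<q. u t \<noteq> u (Suc t mod q)).
      \<Prod>e\<in>pairs n. measure_pmf.expectation (bernoulli_pmf (\<rho> e)) (\<lambda>b. f e b ^ edge_count q u e))"
  proof (rule sum.cong)
    fix u assume "u \<in> {u. u \<in> {..<q} \<rightarrow>\<^sub>E {..<n} \<and> (\<forall>t<q. u t \<noteq> u (Suc t mod q))}"
    then have u: "\<And>t. t < q \<Longrightarrow> u t < n" "\<And>t. t < q \<Longrightarrow> u t \<noteq> u (Suc t mod q)"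
      by (auto simp: PiE_def Pi_def)
    show "?E (?w u) = (\<Prod>e\<in>pairs n. measure_pmf.expectation (bernoulli_pmf (\<rho> e)) (\<lambda>b. f e b ^ edge_count q u e))"
      by (simp add: prod_symmat_walk[where q = q and u = u and n = n, OF u] expectation_prod_bernoulli_field[where f = "\<lambda>e b. f e b ^ edge_count q u e"])
  qed simp
  finally show ?thesis .
qed

lemma card_edges_pairs:
  assumes "\<And>t. t < q \<Longrightarrow> u t < n" "\<And>t. t < q \<Longrightarrow> u t \<noteq> u (Suc t mod q)"
  shows "card (step_edge q u ` {..<q}) = card {e \<in> pairs n. edge_count q u e > 0}"
proof -
  have "inj_on (\<lambda>e. {fst e, snd e}) {e \<in> pairs n. edge_count q u e > 0}"
    by (rule inj_on_subset[OF inj_on_pairs]) auto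
  from card_image[OF this] show ?thesis
    using step_edge_pairs[where q = q and u = u and n = n, OF assms] by (simp only:)
qed

lemma expectation_trace_upper:
  assumes "q > 0" and \<alpha>: "0 \<le> \<alpha>"
    and mean0: "\<And>e. e \<in> pairs n \<Longrightarrow> measure_pmf.expectation (bernoulli_pmf (\<rho> e)) (f e) = 0"
    and mom: "\<And>e k. e \<in> pairs n \<Longrightarrow> k \<ge> 2 \<Longrightarrow>
                 \<bar>measure_pmf.expectation (bernoulli_pmf (\<rho> e)) (\<lambda>b. f e b ^ k)\<bar> \<le> \<alpha>"
  shows "measure_pmf.expectation (bernoulli_field n \<rho>)
           (\<lambda>\<omega>. \<Sum>i<n. matpow n (symmat (\<lambda>e. f e (\<omega> e))) q i i)
     \<le> (\<Sum>u | u \<in> {..<q} \<rightarrow>\<^sub>E {..<n} \<and> no_simple_step q u. \<alpha> ^ card (step_edge q u ` {..<q}))"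
proof -
  let ?m = "\<lambda>e k. measure_pmf.expectation (bernoulli_pmf (\<rho> e)) (\<lambda>b. f e b ^ k)"
  let ?L = "{u. u \<in> {..<q} \<rightarrow>\<^sub>E {..<n} \<and> (\<forall>t<q. u t \<noteq> u (Suc t mod q))}"
  have fin: "finite ?L" by (simp add: finite_PiE)
  have "(\<Sum>u\<in>?L. \<Prod>e\<in>pairs n. ?m e (edge_count q u e))
      \<le> (\<Sum>u\<in>?L. if no_simple_step q u then \<alpha> ^ card (step_edge q u ` {..<q}) else 0)"
  proof (rule sum_mono)
    fix u assume "u \<in> ?L"
    then have u: "\<And>t. t < q \<Longrightarrow> u t < n" "\<And>t. t < q \<Longrightarrow> u t \<noteq> u (Suc t mod q)"
      by (auto simp: PiE_def Pi_def)
    show "(\<Prod>e\<in>pairs n. ?m e (edge_count q u e))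
       \<le> (if no_simple_step q u then \<alpha> ^ card (step_edge q u ` {..<q}) else 0)"
    proof (cases "no_simple_step q u")
      case True
      then have ne1: "\<forall>e\<in>pairs n. edge_count q u e \<noteq> 1"
        using no_simple_step_iff_edge_count[where q = q and u = u and n = n, OF u] by blast
      have "(\<Prod>e\<in>pairs n. ?m e (edge_count q u e)) \<le> (\<Prod>e\<in>pairs n. \<bar>?m e (edge_count q u e)\<bar>)"
        unfolding abs_prod[symmetric] by simp
      also have "\<dots> \<le> (\<Prod>e\<in>pairs n. if edge_count q u e > 0 then \<alpha> else 1)"
      proof (rule prod_mono, safe)
        fix i j assume e: "(i, j) \<in> pairs n"
        show "\<bar>?m (i, j) (edge_count q u (i, j))\<bar> \<le> (if edge_count q u (i, j) > 0 then \<alpha> else 1)"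
        proof (cases "edge_count q u (i, j) = 0")
          case False
          then have "edge_count q u (i, j) \<ge> 2" using ne1 e by (metis One_nat_def Suc_1 less_2_cases not_le)
          then show ?thesis using mom[OF e] False by simp
        qed simp
      qed simp
      also have "\<dots> = \<alpha> ^ card {e \<in> pairs n. edge_count q u e > 0}"
        by (subst prod.inter_filter[symmetric]) auto
      also have "\<dots> = \<alpha> ^ card (step_edge q u ` {..<q})"
        using card_edges_pairs[where q = q and u = u and n = n, OF u] by simp
      finally show ?thesis using True by simp
    next
      case False
      then obtain e where e: "e \<in> pairs n" "edge_count q u e = 1"
        using no_simple_step_iff_edge_count[where q = q and u = u and n = n, OF u] by blast
      then have "?m e (edge_count q u e) = 0"
        using mean0[of e] by simp
      with e(1) have "(\<Prod>e\<in>pairs n. ?m e (edge_count q u e)) = 0"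
        by (intro prod_zero) auto
      then show ?thesis using False by (simp only: if_False order_refl)
    qed
  qed
  also have "\<dots> = (\<Sum>u | u \<in> ?L \<and> no_simple_step q u. \<alpha> ^ card (step_edge q u ` {..<q}))"
    by (rule sum.inter_filter[OF fin, symmetric])
  also have "{u. u \<in> ?L \<and> no_simple_step q u} = {u. u \<in> {..<q} \<rightarrow>\<^sub>E {..<n} \<and> no_simple_step q u}"
    by (auto simp: no_simple_step_def)
  finally show ?thesis
    unfolding expectation_trace_bernoulli_field[OF assms(1)] .
qed

text \<open>The reverse direction turns a count of walks into a trace moment, which can be estimated
  by linear algebra. It needs every admissible walk to weigh at least \<open>1\<close>, including
  those with edges of odd multiplicity.\<close>

lemma expectation_trace_lower:
  assumes "q > 0"
    and mean0: "\<And>e. e \<in> pairs n \<Longrightarrow> measure_pmf.expectation (bernoulli_pmf (\<rho> e)) (f e) = 0"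
    and mom: "\<And>e k. e \<in> pairs n \<Longrightarrow> k \<ge> 2 \<Longrightarrow>
                 measure_pmf.expectation (bernoulli_pmf (\<rho> e)) (\<lambda>b. f e b ^ k) \<ge> 1"
  shows "real (card {u \<in> {..<q} \<rightarrow>\<^sub>E {..<n}. no_simple_step q u}) \<le>
         measure_pmf.expectation (bernoulli_field n \<rho>)
           (\<lambda>\<omega>. \<Sum>i<n. matpow n (symmat (\<lambda>e. f e (\<omega> e))) q i i)"
proof -
  let ?m = "\<lambda>e k. measure_pmf.expectation (bernoulli_pmf (\<rho> e)) (\<lambda>b. f e b ^ k)"
  let ?L = "{u. u \<in> {..<q} \<rightarrow>\<^sub>E {..<n} \<and> (\<forall>t<q. u t \<noteq> u (Suc t mod q))}"
  have fin: "finite ?L" by (simp add: finite_PiE)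
  have "real (card {u \<in> {..<q} \<rightarrow>\<^sub>E {..<n}. no_simple_step q u}) = (\<Sum>u | u \<in> ?L \<and> no_simple_step q u. 1)"
    by (auto simp: no_simple_step_def intro!: arg_cong[of _ _ card])
  also have "\<dots> = (\<Sum>u\<in>?L. if no_simple_step q u then 1 else 0)"
    by (rule sum.inter_filter[OF fin])
  also have "\<dots> \<le> (\<Sum>u\<in>?L. \<Prod>e\<in>pairs n. ?m e (edge_count q u e))"
  proof (rule sum_mono)
    fix u assume "u \<in> ?L"
    then have u: "\<And>t. t < q \<Longrightarrow> u t < n" "\<And>t. t < q \<Longrightarrow> u t \<noteq> u (Suc t mod q)"
      by (auto simp: PiE_def Pi_def)
    have mz: "?m e 0 = 1" for e by simp
    show "(if no_simple_step q u then 1 else 0) \<le> (\<Prod>e\<in>pairs n. ?m e (edge_count q u e))"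
    proof (cases "no_simple_step q u")
      case True
      then have ne1: "\<forall>e\<in>pairs n. edge_count q u e \<noteq> 1"
        using no_simple_step_iff_edge_count[where q = q and u = u and n = n, OF u] by blast
      have "1 \<le> (\<Prod>e\<in>pairs n. ?m e (edge_count q u e))"
      proof (rule prod_ge_1)
        fix e assume e: "e \<in> pairs n"
        then consider "edge_count q u e = 0" | "edge_count q u e \<ge> 2"
          using ne1 by (metis One_nat_def Suc_1 less_2_cases not_le)
        then show "1 \<le> ?m e (edge_count q u e)"
          using mom[OF e] by cases simp_all
      qed
      then show ?thesis using True by simp
    next
      case False
      then obtain e where e: "e \<in> pairs n" "edge_count q u e = 1"
        using no_simple_step_iff_edge_count[where q = q and u = u and n = n, OF u] by blast
      then have "?m e (edge_count q u e) = 0"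
        using mean0[of e] by simp
      with e(1) have "(\<Prod>e\<in>pairs n. ?m e (edge_count q u e)) = 0"
        by (intro prod_zero) auto
      then show ?thesis using False by (simp only: if_False order_refl)
    qed
  qed
  finally show ?thesis
    unfolding expectation_trace_bernoulli_field[OF assms(1)] .
qed

section \<open>A net for the operator norm\<close>

definition bilin :: "nat \<Rightarrow> (nat \<Rightarrow> nat \<Rightarrow> real) \<Rightarrow> (nat \<Rightarrow> real) \<Rightarrow> (nat \<Rightarrow> real) \<Rightarrow> real" where
  "bilin n M x y = (\<Sum>i<n. x i * matvec n M y i)"

text \<open>Since \<open>grid_point\<close> scales by \<open>1 / (2 \<surd>n)\<close>, vectors of norm at most \<open>5 / 4\<close> have integer
  coordinates with sum of squares at most \<open>25 n / 4 \<le> 7 n\<close>.\<close>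

definition grid :: "nat \<Rightarrow> (nat \<Rightarrow> int) set" where
  "grid n = {k \<in> {..<n} \<rightarrow>\<^sub>E {- int (7 * n)..int (7 * n)}. (\<Sum>i<n. (k i)\<^sup>2) \<le> int (7 * n)}"

definition grid_point :: "nat \<Rightarrow> (nat \<Rightarrow> int) \<Rightarrow> nat \<Rightarrow> real" where
  "grid_point n k i = of_int (k i) / (2 * sqrt (real n))"

lemma sum_half_power_abs_le: "(\<Sum>j\<in>{- int m..int m}. (1 / 2 :: real) ^ nat \<bar>j\<bar>) \<le> 3"
proof -
  have "(\<Sum>j\<in>{- int m..int m}. (1 / 2 :: real) ^ nat \<bar>j\<bar>) = 3 - 2 * (1 / 2) ^ m"
  proof (induction m)
    case (Suc m)
    have "{- int (Suc m)..int (Suc m)} = insert (- int (Suc m)) (insert (int (Suc m)) {- int m..int m})"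
      by auto
    moreover have "nat \<bar>- int (Suc m)\<bar> = Suc m" "nat \<bar>int (Suc m)\<bar> = Suc m" by auto
    ultimately show ?case using Suc by simp
  qed simp
  then show ?thesis by simp
qed

lemma finite_grid [simp]: "finite (grid n)"
  by (simp add: grid_def finite_PiE)

text \<open>A generating function count. On the grid the sum of \<open>\<bar>k i\<bar>\<close> is at
  most the sum of squares, so the weight \<open>(1 / 2)\<close> to that sum is at least
  \<open>(1 / 2) ^ (7 * n)\<close>. Over the whole box the weight factorises, with at most
  \<open>3\<close> per coordinate, and \<open>2 ^ 7 * 3 = 384\<close>.\<close>

lemma card_grid_le: "real (card (grid n)) \<le> 384 ^ n"
proof -
  define D where "D = {- int (7 * n)..int (7 * n)}"
  let ?P = "{..<n} \<rightarrow>\<^sub>E D"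
  have "real (card (grid n)) = (\<Sum>k\<in>grid n. 1)" by simp
  also have "\<dots> \<le> (\<Sum>k\<in>grid n. 2 ^ (7 * n) * (\<Prod>i<n. (1 / 2) ^ nat \<bar>k i\<bar>))"
  proof (rule sum_mono)
    fix k assume "k \<in> grid n"
    then have le: "(\<Sum>i<n. (k i)\<^sup>2) \<le> int (7 * n)" by (simp add: grid_def)
    have abs: "\<bar>a\<bar> \<le> a\<^sup>2" for a :: int
      using self_le_power[of "\<bar>a\<bar>" 2] by (cases "a = 0") (auto simp: power2_abs)
    have "int (\<Sum>i<n. nat \<bar>k i\<bar>) \<le> (\<Sum>i<n. (k i)\<^sup>2)"
      using abs by (auto intro!: sum_mono)
    then have "(\<Sum>i<n. nat \<bar>k i\<bar>) \<le> 7 * n" using le by linarith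
    then have "(1 / 2 :: real) ^ (7 * n) \<le> (1 / 2) ^ (\<Sum>i<n. nat \<bar>k i\<bar>)"
      by (intro power_decreasing) auto
    then have "2 ^ (7 * n) * (1 / 2 :: real) ^ (7 * n) \<le> 2 ^ (7 * n) * (1 / 2) ^ (\<Sum>i<n. nat \<bar>k i\<bar>)"
      by (intro mult_left_mono) auto
    moreover have "2 ^ (7 * n) * (1 / 2 :: real) ^ (7 * n) = 1"
      by (simp flip: power_mult_distrib)
    ultimately show "1 \<le> 2 ^ (7 * n) * (\<Prod>i<n. (1 / 2 :: real) ^ nat \<bar>k i\<bar>)"
      by (simp add: power_sum)
  qed
  also have "\<dots> \<le> (\<Sum>k\<in>?P. 2 ^ (7 * n) * (\<Prod>i<n. (1 / 2) ^ nat \<bar>k i\<bar>))"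
  proof (rule sum_mono2)
    show "grid n \<subseteq> ?P" by (simp add: grid_def D_def subset_iff)
  qed (simp_all add: D_def finite_PiE prod_nonneg)
  also have "\<dots> = 2 ^ (7 * n) * (\<Prod>i<n. \<Sum>j\<in>D. (1 / 2) ^ nat \<bar>j\<bar>)"
    by (subst prod_sum_PiE) (simp_all add: D_def sum_distrib_left)
  also have "\<dots> \<le> 2 ^ (7 * n) * (\<Prod>i<n. 3)"
  proof (intro mult_left_mono prod_mono conjI)
    show "(\<Sum>j\<in>D. (1 / 2 :: real) ^ nat \<bar>j\<bar>) \<le> 3"
      unfolding D_def by (rule sum_half_power_abs_le)
  qed (simp_all add: sum_nonneg)
  also have "\<dots> = 384 ^ n" by (simp add: power_mult flip: power_mult_distrib)
  finally show ?thesis .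
qed

lemma vnorm_grid_point:
  assumes "k \<in> grid n"
  shows "(vnorm n (grid_point n k))\<^sup>2 \<le> 7 / 4"
proof (cases "n = 0")
  case False
  have "(vnorm n (grid_point n k))\<^sup>2 = of_int (\<Sum>i<n. (k i)\<^sup>2) / (4 * real n)"
    by (simp add: vnorm_square grid_point_def power_divide power_mult_distrib sum_divide_distrib)
  moreover have "of_int (\<Sum>i<n. (k i)\<^sup>2) \<le> (of_int (int (7 * n)) :: real)"
    using assms unfolding grid_def by (intro of_int_le_iff[THEN iffD2]) auto
  ultimately show ?thesis using False by (simp add: pos_divide_le_eq)
qed (simp add: vnorm_square)

text \<open>Round each coordinate to the lattice of spacing \<open>1 / (2 * sqrt n)\<close>: the
  error per coordinate is at most \<open>1 / (4 * sqrt n)\<close>, so the error in norm is at most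
  \<open>1 / 4\<close>.\<close>

lemma exists_grid_point:
  assumes n: "n > 0" and v: "vnorm n v \<le> 1"
  obtains k where "k \<in> grid n" "vnorm n (\<lambda>i. grid_point n k i - v i) \<le> 1 / 4"
    "vnorm n (grid_point n k) \<le> 5 / 4"
proof -
  define k where "k = (\<lambda>i\<in>{..<n}. round (2 * sqrt (real n) * v i))"
  have s: "sqrt (real n) > 0" using n by simp
  have pt: "\<bar>grid_point n k i - v i\<bar> \<le> 1 / (4 * sqrt (real n))" if "i < n" for i
  proof -
    have "grid_point n k i - v i = (of_int (round (2 * sqrt (real n) * v i)) - 2 * sqrt (real n) * v i) / (2 * sqrt (real n))"
      using that s by (simp add: grid_point_def k_def field_simps)
    also have "\<bar>\<dots>\<bar> \<le> (1 / 2) / (2 * sqrt (real n))"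
      unfolding abs_divide using s of_int_round_abs_le[of "2 * sqrt (real n) * v i"]
      by (intro frac_le) auto
    finally show ?thesis by simp
  qed
  have "(vnorm n (\<lambda>i. grid_point n k i - v i))\<^sup>2 \<le> (\<Sum>i<n. (1 / (4 * sqrt (real n)))\<^sup>2)"
    unfolding vnorm_square
  proof (rule sum_mono)
    fix i assume "i \<in> {..<n}"
    then have "\<bar>grid_point n k i - v i\<bar>\<^sup>2 \<le> (1 / (4 * sqrt (real n)))\<^sup>2"
      using pt by (intro power_mono) auto
    then show "(grid_point n k i - v i)\<^sup>2 \<le> (1 / (4 * sqrt (real n)))\<^sup>2" by simp
  qed
  also have "\<dots> = (1 / 4)\<^sup>2" using n by (simp add: power_divide power_mult_distrib)
  finally have d: "vnorm n (\<lambda>i. grid_point n k i - v i) \<le> 1 / 4"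
    by (rule power2_le_imp_le) simp
  have "vnorm n (\<lambda>i. (grid_point n k i - v i) + v i) \<le> vnorm n (\<lambda>i. grid_point n k i - v i) + vnorm n v"
    by (rule vnorm_triangle)
  then have z: "vnorm n (grid_point n k) \<le> 5 / 4" using d v by simp
  have "(vnorm n (grid_point n k))\<^sup>2 \<le> (5 / 4)\<^sup>2"
    using z by (intro power_mono) auto
  moreover have "(vnorm n (grid_point n k))\<^sup>2 = of_int (\<Sum>i<n. (k i)\<^sup>2) / (4 * real n)"
    by (simp add: vnorm_square grid_point_def power_divide power_mult_distrib sum_divide_distrib)
  ultimately have "of_int (\<Sum>i<n. (k i)\<^sup>2) \<le> (25 / 16) * (4 * real n)"
    using n by (simp add: power2_eq_square pos_divide_le_eq)
  also have "\<dots> \<le> of_int (int (7 * n))" by simp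
  finally have sq: "(\<Sum>i<n. (k i)\<^sup>2) \<le> int (7 * n)"
    by (simp only: of_int_le_iff)
  have "\<bar>k i\<bar> \<le> int (7 * n)" if "i < n" for i
  proof -
    have "\<bar>k i\<bar> \<le> (k i)\<^sup>2"
      using self_le_power[of "\<bar>k i\<bar>" 2] by (cases "k i = 0") (auto simp: power2_abs)
    also have "\<dots> \<le> (\<Sum>i<n. (k i)\<^sup>2)"
      using that by (intro member_le_sum) auto
    finally show ?thesis using sq by simp
  qed
  then have "k \<in> {..<n} \<rightarrow>\<^sub>E {- int (7 * n)..int (7 * n)}"
    by (auto simp: abs_le_iff k_def simp del: of_nat_mult; fastforce)
  then have "k \<in> grid n" using sq by (simp add: grid_def)
  then show ?thesis using d z by (rule that)
qed

lemma bilin_diff_left: "bilin n M (\<lambda>i. x i - y i) z = bilin n M x z - bilin n M y z"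
  by (simp add: bilin_def left_diff_distrib sum_subtractf)

lemma bilin_diff_right: "bilin n M x (\<lambda>i. y i - z i) = bilin n M x y - bilin n M x z"
  by (simp add: bilin_def matvec_def right_diff_distrib sum_subtractf)

text \<open>Rounding a nearly norming pair of unit vectors to the grid changes the bilinear form by at
  most \<open>9 / 16\<close> of the operator norm.\<close>

lemma grid_norming:
  assumes n: "n > 0"
  obtains l :: real where "l \<ge> 0" "\<And>x. vnorm n (matvec n M x) \<le> l * vnorm n x"
    "\<exists>k\<in>grid n. \<exists>k'\<in>grid n. l \<le> 8 / 3 * \<bar>bilin n M (grid_point n k) (grid_point n k')\<bar>"
proof -
  define F where "F = sqrt (\<Sum>i<n. \<Sum>j<n. (M i j)\<^sup>2)"
  define B where "B = {bilin n M x y | x y. vnorm n x \<le> 1 \<and> vnorm n y \<le> 1}"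
  define l where "l = Sup B"
  have frob: "vnorm n (matvec n M y) \<le> F * vnorm n y" for y
  proof (rule power2_le_imp_le)
    have "(F * vnorm n y)\<^sup>2 = (\<Sum>i<n. \<Sum>j<n. (M i j)\<^sup>2) * (vnorm n y)\<^sup>2"
      by (simp add: F_def power_mult_distrib sum_nonneg)
    then show "(vnorm n (matvec n M y))\<^sup>2 \<le> (F * vnorm n y)\<^sup>2"
      using vnorm_matvec_le_frobenius[of n M y] by simp
  qed (simp add: F_def sum_nonneg)
  have "bilin n M x y \<le> F" if "vnorm n x \<le> 1" "vnorm n y \<le> 1" for x y
  proof -
    have F0: "F \<ge> 0" by (simp add: F_def sum_nonneg)
    have "bilin n M x y \<le> vnorm n x * vnorm n (matvec n M y)"
      unfolding bilin_def using abs_inner_le_vnorm abs_le_D1 by blast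
    also have "\<dots> \<le> 1 * (F * 1)"
      using that F0 frob[of y] mult_left_mono[OF that(2) F0] by (intro mult_mono) auto
    finally show ?thesis by simp
  qed
  then have bdd: "bdd_above B" by (auto simp: B_def intro!: bdd_aboveI)
  have z: "vnorm n (\<lambda>_. 0) = 0" by (simp add: vnorm_def L2_set_def)
  have "bilin n M (\<lambda>_. 0) (\<lambda>_. 0) = 0" by (simp add: bilin_def)
  then have zB: "0 \<in> B" using z unfolding B_def by (intro CollectI exI[of _ "\<lambda>_. 0"]) auto
  have l0: "l \<ge> 0" unfolding l_def using zB bdd by (rule cSup_upper)
  have scale: "bilin n M (\<lambda>i. a * x i) (\<lambda>i. b * y i) = a * b * bilin n M x y" for a b x y
    by (simp add: bilin_def matvec_def sum_distrib_left mult_ac)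
  have bil: "bilin n M x y \<le> l * (vnorm n x * vnorm n y)" for x y
  proof (cases "vnorm n x = 0 \<or> vnorm n y = 0")
    case True
    have "bilin n M x y \<le> vnorm n x * vnorm n (matvec n M y)"
      unfolding bilin_def using abs_inner_le_vnorm abs_le_D1 by blast
    also have "\<dots> \<le> vnorm n x * (F * vnorm n y)"
      using frob by (intro mult_left_mono) auto
    also have "\<dots> = l * (vnorm n x * vnorm n y)" using True by auto
    finally show ?thesis .
  next
    case False
    then have pos: "vnorm n x > 0" "vnorm n y > 0"
      using vnorm_nonneg[of n x] vnorm_nonneg[of n y] by linarith+
    let ?x = "\<lambda>i. inverse (vnorm n x) * x i" and ?y = "\<lambda>i. inverse (vnorm n y) * y i"
    have "vnorm n ?x = 1" "vnorm n ?y = 1" using pos by (simp_all add: vnorm_scale)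
    then have "bilin n M ?x ?y \<in> B"
      unfolding B_def mem_Collect_eq by (intro exI[of _ ?x] exI[of _ ?y]) simp
    then have "bilin n M ?x ?y \<le> l" unfolding l_def using bdd by (rule cSup_upper)
    then show ?thesis using pos unfolding scale by (simp add: field_simps)
  qed
  have abs_bil: "\<bar>bilin n M x y\<bar> \<le> l * (vnorm n x * vnorm n y)" for x y
    using bil[of x y] bil[of "\<lambda>i. - 1 * x i" y] scale[of "- 1" x 1 y] vnorm_scale[of n "- 1" x] by simp
  have opn: "vnorm n (matvec n M x) \<le> l * vnorm n x" for x
  proof (cases "vnorm n (matvec n M x) = 0")
    case False
    then have pos: "vnorm n (matvec n M x) > 0" using vnorm_nonneg[of n "matvec n M x"] by linarith
    have "vnorm n (matvec n M x) * vnorm n (matvec n M x) = bilin n M (matvec n M x) x"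
      unfolding power2_eq_square[symmetric] vnorm_square by (simp add: bilin_def power2_eq_square)
    also have "\<dots> \<le> vnorm n (matvec n M x) * (l * vnorm n x)"
      using bil[of "matvec n M x" x] by (simp add: mult_ac)
    finally show ?thesis using pos by simp
  qed (use l0 in simp)
  \<comment> \<open>A pair within the factor \<open>15 / 16\<close> of the supremum avoids showing
    that it is attained. Rounding costs \<open>1 / 4 * (5 / 4) + 1 / 4 = 9 / 16\<close>, leaving
    \<open>3 / 8\<close>, whose inverse is the \<open>8 / 3\<close> of the claim.\<close>
  obtain x y where xy: "vnorm n x \<le> 1" "vnorm n y \<le> 1" "bilin n M x y \<ge> 15 / 16 * l"
  proof (cases "l = 0")
    case True
    then show ?thesis using that[of "\<lambda>_. 0" "\<lambda>_. 0"] z \<open>bilin n M (\<lambda>_. 0) (\<lambda>_. 0) = 0\<close> by simp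
  next
    case False
    then have "15 / 16 * l < Sup B" using l0 by (simp add: l_def)
    then obtain b where "b \<in> B" "15 / 16 * l < b" using zB by (elim less_cSupE) auto
    then show ?thesis using that by (auto simp: B_def)
  qed
  obtain k where k: "k \<in> grid n" "vnorm n (\<lambda>i. grid_point n k i - x i) \<le> 1 / 4"
    using exists_grid_point[OF n xy(1)] by blast
  obtain k' where k': "k' \<in> grid n" "vnorm n (\<lambda>i. grid_point n k' i - y i) \<le> 1 / 4"
    "vnorm n (grid_point n k') \<le> 5 / 4"
    using exists_grid_point[OF n xy(2)] by blast
  let ?z = "grid_point n k" and ?z' = "grid_point n k'"
  have "bilin n M ?z ?z' - bilin n M x y =
      bilin n M (\<lambda>i. ?z i - x i) ?z' + bilin n M x (\<lambda>i. ?z' i - y i)"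
    by (simp add: bilin_diff_left bilin_diff_right)
  moreover have "vnorm n (\<lambda>i. ?z i - x i) * vnorm n ?z' \<le> 1 / 4 * (5 / 4)"
    using k k' by (intro mult_mono) simp_all
  then have "\<bar>bilin n M (\<lambda>i. ?z i - x i) ?z'\<bar> \<le> l * (1 / 4 * (5 / 4))"
    using abs_bil mult_left_mono[OF _ l0] by (meson order_trans)
  moreover have "vnorm n x * vnorm n (\<lambda>i. ?z' i - y i) \<le> 1 * (1 / 4)"
    using k' xy by (intro mult_mono) simp_all
  then have "\<bar>bilin n M x (\<lambda>i. ?z' i - y i)\<bar> \<le> l * (1 * (1 / 4))"
    using abs_bil mult_left_mono[OF _ l0] by (meson order_trans)
  ultimately have "bilin n M ?z ?z' \<ge> 3 / 8 * l" using xy(3) by (simp add: abs_le_iff)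
  then have "l \<le> 8 / 3 * \<bar>bilin n M ?z ?z'\<bar>" by linarith
  with k k' have "\<exists>k\<in>grid n. \<exists>k'\<in>grid n. l \<le> 8 / 3 * \<bar>bilin n M (grid_point n k) (grid_point n k')\<bar>"
    by blast
  with l0 opn show ?thesis by (rule that)
qed

text \<open>The maximum over grid pairs is replaced by the sum of even powers, which commutes with
  expectation. The base \<open>8\<close> rounds up \<open>(8 / 3)^2 = 64 / 9\<close>.\<close>

lemma trace_even_power_le_grid:
  assumes n: "n > 0" and sym: "\<And>i j. M i j = M j i"
  shows "(\<Sum>i<n. matpow n M (2 * p) i i) \<le>
    real n * (8 ^ p * (\<Sum>k\<in>grid n. \<Sum>k'\<in>grid n. bilin n M (grid_point n k) (grid_point n k') ^ (2 * p)))"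
proof -
  let ?b = "\<lambda>k k'. bilin n M (grid_point n k) (grid_point n k')"
  obtain l where l: "l \<ge> 0" "\<And>x. vnorm n (matvec n M x) \<le> l * vnorm n x"
    and ex: "\<exists>k\<in>grid n. \<exists>k'\<in>grid n. l \<le> 8 / 3 * \<bar>?b k k'\<bar>"
    using grid_norming[OF n, of M] by metis
  from ex obtain k k' where k: "k \<in> grid n" "k' \<in> grid n" "l \<le> 8 / 3 * \<bar>?b k k'\<bar>" by blast
  have "l ^ (2 * p) \<le> (8 / 3 * \<bar>?b k k'\<bar>) ^ (2 * p)"
    using k l by (intro power_mono)
  also have "\<dots> = (64 / 9) ^ p * ?b k k' ^ (2 * p)"
    by (simp add: power_mult_distrib power_mult power_divide)
  also have "\<dots> \<le> 8 ^ p * (\<Sum>k\<in>grid n. \<Sum>k'\<in>grid n. ?b k k' ^ (2 * p))"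
  proof (intro mult_mono power_mono)
    have "?b k k' ^ (2 * p) \<le> (\<Sum>k'\<in>grid n. ?b k k' ^ (2 * p))"
      using k by (intro member_le_sum) auto
    also have "\<dots> \<le> (\<Sum>k\<in>grid n. \<Sum>k'\<in>grid n. ?b k k' ^ (2 * p))"
      using k by (intro member_le_sum[where f = "\<lambda>k. \<Sum>k'\<in>grid n. ?b k k' ^ (2 * p)"]) (auto intro: sum_nonneg)
    finally show "?b k k' ^ (2 * p) \<le> (\<Sum>k\<in>grid n. \<Sum>k'\<in>grid n. ?b k k' ^ (2 * p))" .
  qed auto
  finally have "l ^ (2 * p) \<le> 8 ^ p * (\<Sum>k\<in>grid n. \<Sum>k'\<in>grid n. ?b k k' ^ (2 * p))" .
  then have "real n * l ^ (2 * p) \<le> real n * (8 ^ p * (\<Sum>k\<in>grid n. \<Sum>k'\<in>grid n. ?b k k' ^ (2 * p)))"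
    by (intro mult_left_mono) auto
  then show ?thesis
    using trace_even_power_le[where M = M and n = n and l = l and p = p, OF sym l(2,1)] by linarith
qed

section \<open>Concentration of the adjacency matrix\<close>

text \<open>Entries of the auxiliary matrix: mean zero, but all higher moments at least \<open>1\<close>, so that it
  can dominate walks with edges of odd multiplicity.\<close>

definition skew_sign :: "bool \<Rightarrow> real" where
  "skew_sign b = (if b then 2 else - 1)"

lemma expectation_skew_sign:
  "measure_pmf.expectation (bernoulli_pmf (1 / 3)) (\<lambda>b. h (skew_sign b) :: real) = (h 2 + 2 * h (- 1)) / 3"
  by (simp add: skew_sign_def)

lemma skew_sign_moment_ge_1:
  assumes "k \<ge> 2"
  shows "measure_pmf.expectation (bernoulli_pmf (1 / 3)) (\<lambda>b. skew_sign b ^ k) \<ge> 1"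
proof -
  have "2 ^ k + 2 * (- 1) ^ k \<ge> (3 :: real)"
  proof (cases "even k")
    case True
    have "(2 :: real) ^ k \<ge> 2 ^ 1" using assms by (intro power_increasing) auto
    then show ?thesis using True by simp
  next
    case False
    then have "k \<ge> 3" using assms by (metis One_nat_def Suc_1 even_numeral le_antisym not_less_eq_eq numeral_3_eq_3)
    then have "(2 :: real) ^ k \<ge> 2 ^ 3" by (intro power_increasing) auto
    then show ?thesis using False by simp
  qed
  then show ?thesis by (simp add: expectation_skew_sign[where h = "\<lambda>x. x ^ k"])
qed

text \<open>Hoeffding's lemma for a centred variable on an interval of length \<open>3\<close>,
  whence \<open>3^2 / 8\<close>.\<close>

lemma skew_sign_mgf:
  "measure_pmf.expectation (bernoulli_pmf (1 / 3)) (\<lambda>b. exp (s * skew_sign b)) \<le> exp (9 / 8 * s\<^sup>2)"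
proof -
  have "(exp (2 * s) + 2 * exp (- s)) / 3 \<le> exp (9 / 8 * s\<^sup>2)"
  proof (cases "s \<ge> 0")
    case True
    have "- (3 * s) * (1 / 3) + ln (1 + (1 / 3) * (exp (3 * s) - 1)) \<le> (3 * s)\<^sup>2 / 8"
      using Hoeffdings_lemma_aux[of "3 * s" "1 / 3"] True by simp
    then have "ln (1 + (1 / 3) * (exp (3 * s) - 1)) \<le> 9 / 8 * s\<^sup>2 + s"
      by (simp add: power_mult_distrib)
    moreover have pos: "1 + (1 / 3) * (exp (3 * s) - 1) > 0"
    proof -
      have "1 + (1 / 3) * (exp (3 * s) - 1) = 2 / 3 + exp (3 * s) / 3" by (simp add: field_simps)
      then show ?thesis by (simp add: add_pos_pos)
    qed
    ultimately have "1 + (1 / 3) * (exp (3 * s) - 1) \<le> exp (9 / 8 * s\<^sup>2 + s)"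
      by (metis exp_le_cancel_iff exp_ln)
    then have "exp (- s) * (1 + (1 / 3) * (exp (3 * s) - 1)) \<le> exp (- s) * exp (9 / 8 * s\<^sup>2 + s)"
      by (intro mult_left_mono) auto
    moreover have "exp (- s) * exp (9 / 8 * s\<^sup>2 + s) = exp (9 / 8 * s\<^sup>2)"
      by (simp flip: exp_add)
    moreover have "exp (- s) * exp (3 * s) = exp (2 * s)" by (simp flip: exp_add)
    ultimately show ?thesis by (simp add: algebra_simps)
  next
    case False
    \<comment> \<open>The auxiliary inequality is used with a nonnegative argument, so for negative
      \<open>s\<close> the two atoms exchange roles and the weight \<open>1 / 3\<close> becomes
      \<open>2 / 3\<close>.\<close>
    have "- (- 3 * s) * (2 / 3) + ln (1 + (2 / 3) * (exp (- 3 * s) - 1)) \<le> (- 3 * s)\<^sup>2 / 8"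
      using Hoeffdings_lemma_aux[of "- 3 * s" "2 / 3"] False by simp
    then have "ln (1 + (2 / 3) * (exp (- 3 * s) - 1)) \<le> 9 / 8 * s\<^sup>2 - 2 * s"
      by (simp add: power_mult_distrib)
    moreover have pos: "1 + (2 / 3) * (exp (- 3 * s) - 1) > 0"
    proof -
      have "1 + (2 / 3) * (exp (- 3 * s) - 1) = 1 / 3 + 2 / 3 * exp (- 3 * s)" by (simp add: field_simps)
      then show ?thesis by (simp add: add_pos_pos)
    qed
    ultimately have "1 + (2 / 3) * (exp (- 3 * s) - 1) \<le> exp (9 / 8 * s\<^sup>2 - 2 * s)"
      by (metis exp_le_cancel_iff exp_ln)
    then have "exp (2 * s) * (1 + (2 / 3) * (exp (- 3 * s) - 1)) \<le> exp (2 * s) * exp (9 / 8 * s\<^sup>2 - 2 * s)"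
      by (intro mult_left_mono) auto
    moreover have "exp (2 * s) * exp (9 / 8 * s\<^sup>2 - 2 * s) = exp (9 / 8 * s\<^sup>2)"
      by (simp flip: exp_add)
    moreover have "exp (2 * s) * exp (- 3 * s) = exp (- s)" by (simp flip: exp_add)
    ultimately show ?thesis by (simp add: algebra_simps)
  qed
  then show ?thesis by (simp add: expectation_skew_sign[where h = "\<lambda>x. exp (s * x)"] mult.commute)
qed

text \<open>Written as a linear form in the independent entries above the diagonal, the bilinear
  form has a factorising exponential moment.\<close>

lemma bilin_symmat:
  "bilin n (symmat X) x y = (\<Sum>e\<in>pairs n. X e * (x (fst e) * y (snd e) + x (snd e) * y (fst e)))"
proof -
  let ?g = "\<lambda>(i, j). x i * (symmat X i j * y j)"
  let ?P = "pairs n" and ?Q = "prod.swap ` pairs n" and ?D = "(\<lambda>i. (i, i)) ` {..<n}"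
  have "bilin n (symmat X) x y = (\<Sum>i<n. \<Sum>j<n. x i * (symmat X i j * y j))"
    by (simp add: bilin_def matvec_def sum_distrib_left)
  also have "\<dots> = sum ?g ({..<n} \<times> {..<n})"
    by (rule sum.cartesian_product)
  also have "{..<n} \<times> {..<n} = (?P \<union> ?Q) \<union> ?D"
  proof (intro equalityI subsetI)
    fix e assume "e \<in> {..<n} \<times> {..<n}"
    then obtain i j where e: "e = (i, j)" "i < n" "j < n" by auto
    consider "i < j" | "j < i" | "i = j" by linarith
    then show "e \<in> (?P \<union> ?Q) \<union> ?D"
    proof cases
      case 2
      then have "(j, i) \<in> pairs n" using e by (simp add: pairs_def)
      then have "prod.swap (j, i) \<in> ?Q" by (rule imageI)
      then show ?thesis using e by simp
    qed (use e in \<open>auto simp: pairs_def\<close>)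
  qed (auto simp: pairs_def)
  also have "sum ?g \<dots> = sum ?g ?P + sum ?g ?Q + sum ?g ?D"
  proof -
    have "?P \<inter> ?Q = {}" "(?P \<union> ?Q) \<inter> ?D = {}" by (auto simp: pairs_def)
    then show ?thesis by (simp add: sum.union_disjoint)
  qed
  also have "sum ?g ?D = 0"
    by (intro sum.neutral) (auto simp: symmat_def)
  also have "sum ?g ?Q = (\<Sum>e\<in>?P. X e * (x (snd e) * y (fst e)))"
    by (subst sum.reindex) (auto simp: pairs_def symmat_def intro!: sum.cong)
  also have "sum ?g ?P = (\<Sum>e\<in>?P. X e * (x (fst e) * y (snd e)))"
    by (intro sum.cong) (auto simp: pairs_def symmat_def)
  finally show ?thesis by (simp add: sum.distrib distrib_left)
qed

text \<open>After \<open>(a + b)^2 <= 2 * (a^2 + b^2)\<close>, the sum is the bilinear form of the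
  all-ones matrix with zero diagonal at the squared vectors; restoring the diagonal makes it a
  product of squared norms.\<close>

lemma sum_pairs_square_le:
  "(\<Sum>e\<in>pairs n. (x (fst e) * y (snd e) + x (snd e) * y (fst e))\<^sup>2) \<le> 2 * ((vnorm n x)\<^sup>2 * (vnorm n y)\<^sup>2)"
proof -
  let ?a = "\<lambda>i. (x i)\<^sup>2" and ?b = "\<lambda>i. (y i)\<^sup>2"
  have "(\<Sum>e\<in>pairs n. (x (fst e) * y (snd e) + x (snd e) * y (fst e))\<^sup>2)
      \<le> (\<Sum>e\<in>pairs n. 2 * (1 * (?a (fst e) * ?b (snd e) + ?a (snd e) * ?b (fst e))))"
  proof (rule sum_mono)
    fix e
    have "0 \<le> (x (fst e) * y (snd e) - x (snd e) * y (fst e))\<^sup>2" by simp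
    then show "(x (fst e) * y (snd e) + x (snd e) * y (fst e))\<^sup>2
        \<le> 2 * (1 * (?a (fst e) * ?b (snd e) + ?a (snd e) * ?b (fst e)))"
      unfolding power2_sum power2_diff by (simp add: power_mult_distrib)
  qed
  also have "\<dots> = 2 * bilin n (symmat (\<lambda>_. 1)) ?a ?b"
    unfolding bilin_symmat sum_distrib_left ..
  also have "bilin n (symmat (\<lambda>_. 1)) ?a ?b \<le> (\<Sum>i<n. ?a i * (\<Sum>j<n. ?b j))"
    unfolding bilin_def matvec_def
  proof (intro sum_mono mult_left_mono)
    fix i j show "symmat (\<lambda>_. 1) i j * ?b j \<le> ?b j" by (simp add: symmat_def)
  qed auto
  finally show ?thesis by (simp add: vnorm_square sum_distrib_right)
qed

lemma power_le_fact_exp: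
  fixes x :: real
  assumes "x \<ge> 0"
  shows "x ^ k \<le> fact k * exp x"
proof -
  have "x ^ k / fact k \<le> exp x"
  proof -
    have "(\<Sum>i\<in>{k}. inverse (fact i) * x ^ i) \<le> (\<Sum>i. inverse (fact i) * x ^ i)"
      using assms summable_exp[of x] by (intro sum_le_suminf) auto
    then show ?thesis by (simp add: exp_def field_simps)
  qed
  then show ?thesis by (simp add: field_simps)
qed

lemma skew_field_even_moment:
  assumes x: "(vnorm n x)\<^sup>2 \<le> 7 / 4" and y: "(vnorm n y)\<^sup>2 \<le> 7 / 4" and p: "p > 0"
  shows "measure_pmf.expectation (bernoulli_field n (\<lambda>_. 1 / 3))
           (\<lambda>\<omega>. bilin n (symmat (\<lambda>e. skew_sign (\<omega> e))) x y ^ (2 * p)) \<le> 2 * (4 * exp 7 * real p) ^ p"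
proof -
  let ?E = "measure_pmf.expectation (bernoulli_field n (\<lambda>_. 1 / 3))"
  define c where "c e = x (fst e) * y (snd e) + x (snd e) * y (fst e)" for e
  define F where "F \<omega> = bilin n (symmat (\<lambda>e. skew_sign (\<omega> e))) x y" for \<omega>
  \<comment> \<open>The choice \<open>s^2 = p\<close> balances two costs:
    \<open>fact (2 * p) / s ^ (2 * p)\<close> is at most \<open>(4 * p) ^ p\<close>, and the
    subgaussian factor \<open>exp (O(s^2))\<close> is a constant to the power
    \<open>p\<close>.\<close>
  define s where "s = sqrt (real p)"
  have s: "s > 0" "s\<^sup>2 = real p" using p by (auto simp: s_def)
  have F: "F \<omega> = (\<Sum>e\<in>pairs n. skew_sign (\<omega> e) * c e)" for \<omega>
    by (simp add: F_def bilin_symmat c_def)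
  have c2: "(\<Sum>e\<in>pairs n. (c e)\<^sup>2) \<le> 49 / 8"
  proof -
    have "(vnorm n x)\<^sup>2 * (vnorm n y)\<^sup>2 \<le> 7 / 4 * (7 / 4)"
      using x y by (intro mult_mono) auto
    then show ?thesis using sum_pairs_square_le[where n = n and x = x and y = y] unfolding c_def by linarith
  qed
  have mgf: "?E (\<lambda>\<omega>. exp (a * F \<omega>)) \<le> exp (7 * real p)" if a: "a\<^sup>2 = real p" for a
  proof -
    have "?E (\<lambda>\<omega>. exp (a * F \<omega>)) = ?E (\<lambda>\<omega>. \<Prod>e\<in>pairs n. exp (a * c e * skew_sign (\<omega> e)))"
      by (simp add: F exp_sum sum_distrib_left mult_ac flip: exp_sum)
    also have "\<dots> = (\<Prod>e\<in>pairs n. measure_pmf.expectation (bernoulli_pmf (1 / 3)) (\<lambda>b. exp (a * c e * skew_sign b)))"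
      by (rule expectation_prod_bernoulli_field)
    also have "\<dots> \<le> (\<Prod>e\<in>pairs n. exp (9 / 8 * (a * c e)\<^sup>2))"
      by (intro prod_mono conjI skew_sign_mgf Bochner_Integration.integral_nonneg) auto
    also have "\<dots> = exp (9 / 8 * real p * (\<Sum>e\<in>pairs n. (c e)\<^sup>2))"
      by (simp add: exp_sum[symmetric] sum_distrib_left power_mult_distrib a mult_ac)
    also have "\<dots> \<le> exp (9 / 8 * real p * (49 / 8))"
      using c2 by (intro exp_le_cancel_iff[THEN iffD2] mult_left_mono) auto
    \<comment> \<open>Numerically \<open>9 / 8 * (49 / 8) = 441 / 64 < 7\<close>, where
      \<open>49 / 8 = 2 * (7 / 4)^2\<close>.\<close>
    also have "\<dots> \<le> exp (7 * real p)" by simp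
    finally show ?thesis .
  qed
  have "s ^ (2 * p) * ?E (\<lambda>\<omega>. F \<omega> ^ (2 * p)) = ?E (\<lambda>\<omega>. \<bar>s * F \<omega>\<bar> ^ (2 * p))"
    by (simp add: power_even_abs power_mult_distrib)
  also have "\<dots> \<le> ?E (\<lambda>\<omega>. fact (2 * p) * (exp (s * F \<omega>) + exp ((- s) * F \<omega>)))"
  proof (intro integral_mono integrable_bernoulli_field)
    fix \<omega>
    have "\<bar>s * F \<omega>\<bar> ^ (2 * p) \<le> fact (2 * p) * exp \<bar>s * F \<omega>\<bar>"
      by (rule power_le_fact_exp) simp
    also have "\<dots> \<le> fact (2 * p) * (exp (s * F \<omega>) + exp ((- s) * F \<omega>))"
      by (intro mult_left_mono) (auto simp: abs_if)
    finally show "\<bar>s * F \<omega>\<bar> ^ (2 * p) \<le> fact (2 * p) * (exp (s * F \<omega>) + exp ((- s) * F \<omega>))" .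
  qed
  also have "\<dots> = fact (2 * p) * (?E (\<lambda>\<omega>. exp (s * F \<omega>)) + ?E (\<lambda>\<omega>. exp ((- s) * F \<omega>)))"
    by (simp only: Bochner_Integration.integral_mult_right_zero Bochner_Integration.integral_add integrable_bernoulli_field)
  also have "\<dots> \<le> (2 * real p) ^ (2 * p) * (2 * exp (7 * real p))"
  proof (intro mult_mono)
    have "fact (2 * p) \<le> real ((2 * p) ^ (2 * p))"
      by (rule fact_le_power)
    then show "fact (2 * p) \<le> (2 * real p) ^ (2 * p)" by simp
    have s2: "(- s)\<^sup>2 = real p" using s by simp
    show "?E (\<lambda>\<omega>. exp (s * F \<omega>)) + ?E (\<lambda>\<omega>. exp ((- s) * F \<omega>)) \<le> 2 * exp (7 * real p)"
      using mgf[OF s(2)] mgf[OF s2] by linarith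
  qed (auto intro!: add_nonneg_nonneg Bochner_Integration.integral_nonneg)
  also have "\<dots> = s ^ (2 * p) * (2 * (4 * exp 7 * real p) ^ p)"
  proof -
    have "exp (7 * real p) = exp 7 ^ p" by (metis exp_of_nat2_mult mult.commute)
    moreover have "(2 * real p) ^ (2 * p) = (4 * real p * real p) ^ p"
      by (simp add: power_mult power2_eq_square power_mult_distrib)
    moreover have "s ^ (2 * p) = real p ^ p" by (simp add: power_mult s(2))
    ultimately show ?thesis by (simp add: power_mult_distrib mult_ac)
  qed
  finally show ?thesis using s(1) unfolding F_def by simp
qed

text \<open>The constant collects \<open>8\<close> from rounding to the grid, \<open>384\<^sup>4\<close> from pairs of grid points in
  dimension \<open>2 p\<close>, \<open>4 exp 7\<close> from the moments of a subgaussian variable, and a factor \<open>2\<close>.\<close>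

definition moment_const :: real where
  "moment_const = 64 * 384 ^ 4 * exp 7"

lemma expectation_trace_skew_le:
  assumes p: "p > 0"
  shows "measure_pmf.expectation (bernoulli_field (2 * p) (\<lambda>_. 1 / 3))
      (\<lambda>\<omega>. \<Sum>i<2 * p. matpow (2 * p) (symmat (\<lambda>e. skew_sign (\<omega> e))) (2 * p) i i)
    \<le> real (2 * p) * (moment_const * real p) ^ p"
proof -
  let ?r = "2 * p"
  let ?E = "measure_pmf.expectation (bernoulli_field ?r (\<lambda>_. 1 / 3))"
  let ?b = "\<lambda>\<omega> k k'. bilin ?r (symmat (\<lambda>e. skew_sign (\<omega> e))) (grid_point ?r k) (grid_point ?r k') ^ (2 * p)"
  define m where "m = 2 * (4 * exp 7 * real p) ^ p"
  have m0: "m \<ge> 0" by (simp add: m_def)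
  have "?E (\<lambda>\<omega>. \<Sum>i<?r. matpow ?r (symmat (\<lambda>e. skew_sign (\<omega> e))) (2 * p) i i)
      \<le> ?E (\<lambda>\<omega>. real ?r * (8 ^ p * (\<Sum>k\<in>grid ?r. \<Sum>k'\<in>grid ?r. ?b \<omega> k k')))"
    using p by (intro integral_mono integrable_bernoulli_field trace_even_power_le_grid symmat_sym) auto
  also have "\<dots> = real ?r * (8 ^ p * (\<Sum>k\<in>grid ?r. \<Sum>k'\<in>grid ?r. ?E (\<lambda>\<omega>. ?b \<omega> k k')))"
    by (simp only: Bochner_Integration.integral_mult_right_zero Bochner_Integration.integral_sum integrable_bernoulli_field)
  also have "\<dots> \<le> real ?r * (8 ^ p * (\<Sum>k\<in>grid ?r. \<Sum>k'\<in>grid ?r. m))"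
    unfolding m_def using p
    by (intro mult_left_mono sum_mono skew_field_even_moment vnorm_grid_point) auto
  also have "\<dots> = real ?r * (8 ^ p * (real (card (grid ?r)) * real (card (grid ?r)) * m))"
    by (simp add: mult.assoc)
  also have "\<dots> \<le> real ?r * (8 ^ p * (384 ^ ?r * 384 ^ ?r * m))"
    using card_grid_le[of ?r] m0 by (intro mult_left_mono mult_right_mono mult_mono) auto
  also have "\<dots> = real ?r * (2 * (32 * 384 ^ 4 * exp 7 * real p) ^ p)"
  proof -
    have "c ^ ?r * c ^ ?r = (c ^ 4) ^ p" for c :: real by (simp flip: power_add power_mult)
    moreover have "8 ^ p * (x ^ p * (2 * y ^ p)) = 2 * (8 * x * y) ^ p" for x y :: real
      by (simp add: power_mult_distrib)
    moreover have "8 * 384 ^ 4 * (4 * exp 7 * real p) = 32 * 384 ^ 4 * exp 7 * real p" by simp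
    ultimately show ?thesis unfolding m_def by (simp only:)
  qed
  also have "\<dots> \<le> real ?r * (2 ^ p * (32 * 384 ^ 4 * exp 7 * real p) ^ p)"
    using self_le_power[of "2::real" p] p by (intro mult_left_mono mult_right_mono) auto
  also have "\<dots> = real ?r * (moment_const * real p) ^ p"
  proof -
    have "2 * (32 * 384 ^ 4 * exp 7 * real p) = moment_const * real p"
      by (simp add: moment_const_def)
    then show ?thesis by (metis power_mult_distrib)
  qed
  finally show ?thesis .
qed

text \<open>The centred variable is bounded by \<open>1\<close>, so its higher absolute moments are
  at most the variance \<open>\<rho> * (1 - \<rho>)\<close>. Here the sparsity enters.\<close>

lemma centered_bernoulli_moment:
  fixes \<rho> :: real
  assumes \<rho>: "0 \<le> \<rho>" "\<rho> \<le> 1" and k: "k \<ge> 2"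
  shows "\<bar>measure_pmf.expectation (bernoulli_pmf \<rho>) (\<lambda>b. (of_bool b - \<rho>) ^ k)\<bar> \<le> \<rho>"
proof -
  have "\<bar>(1 - \<rho>) ^ k * \<rho> + (- \<rho>) ^ k * (1 - \<rho>)\<bar> \<le> \<bar>1 - \<rho>\<bar> ^ k * \<rho> + \<bar>\<rho>\<bar> ^ k * (1 - \<rho>)"
    using \<rho> by (intro order_trans[OF abs_triangle_ineq]) (simp add: abs_mult power_abs)
  also have "\<dots> \<le> (1 - \<rho>)\<^sup>2 * \<rho> + \<rho>\<^sup>2 * (1 - \<rho>)"
    using \<rho> k by (intro add_mono mult_right_mono) (auto intro!: power_decreasing)
  also have "\<dots> = \<rho> * (1 - \<rho>)" by (simp add: power2_eq_square algebra_simps)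
  also have "\<dots> \<le> \<rho> * 1" using \<rho> by (intro mult_left_mono) auto
  finally show ?thesis using \<rho> by simp
qed

lemma expectation_trace_centered_le:
  assumes \<rho>: "\<And>e. e \<in> pairs n \<Longrightarrow> 0 \<le> \<rho> e \<and> \<rho> e \<le> \<alpha>"
    and \<alpha>: "0 \<le> \<alpha>" "\<alpha> \<le> 1" and p: "p > 0" "real n * \<alpha> \<le> real p"
  shows "measure_pmf.expectation (bernoulli_field n \<rho>)
      (\<lambda>\<omega>. \<Sum>i<n. matpow n (symmat (\<lambda>e. of_bool (\<omega> e) - \<rho> e)) (2 * p) i i)
    \<le> real n * (moment_const * real p) ^ p"
proof -
  let ?r = "2 * p"
  have "measure_pmf.expectation (bernoulli_field n \<rho>)
      (\<lambda>\<omega>. \<Sum>i<n. matpow n (symmat (\<lambda>e. of_bool (\<omega> e) - \<rho> e)) (2 * p) i i)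
    \<le> (\<Sum>u | u \<in> {..<2 * p} \<rightarrow>\<^sub>E {..<n} \<and> no_simple_step (2 * p) u.
        \<alpha> ^ card (step_edge (2 * p) u ` {..<2 * p}))"
  proof (rule expectation_trace_upper[where f = "\<lambda>e b. of_bool b - \<rho> e"])
    fix e assume "e \<in> pairs n"
    then have "0 \<le> \<rho> e \<and> \<rho> e \<le> \<alpha>" by (rule \<rho>)
    then have e: "0 \<le> \<rho> e" "\<rho> e \<le> 1" "\<rho> e \<le> \<alpha>" using \<alpha> by auto
    show "measure_pmf.expectation (bernoulli_pmf (\<rho> e)) (\<lambda>b. of_bool b - \<rho> e) = 0"
      using e by (simp add: algebra_simps)
    fix k :: nat assume "k \<ge> 2"
    then show "\<bar>measure_pmf.expectation (bernoulli_pmf (\<rho> e)) (\<lambda>b. (of_bool b - \<rho> e) ^ k)\<bar> \<le> \<alpha>"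
      using centered_bernoulli_moment[OF e(1,2)] e(3) by (meson order_trans)
  qed (use p \<alpha> in auto)
  \<comment> \<open>With \<open>r = 2 p\<close> the requirement \<open>r >= n \<alpha> + p\<close>
    is exactly \<open>n \<alpha> <= p\<close>. The trace in dimension \<open>r\<close> then restores
    the factor \<open>r\<close> that the comparison divides out.\<close>
  also have "\<dots> \<le> real n / real ?r * real (card {u \<in> {..<2 * p} \<rightarrow>\<^sub>E {..<?r}. no_simple_step (2 * p) u})"
    using p \<alpha> by (intro closed_walk_comparison) auto
  also have "\<dots> \<le> real n / real ?r * (real ?r * (moment_const * real p) ^ p)"
  proof (intro mult_left_mono)
    have "real (card {u \<in> {..<2 * p} \<rightarrow>\<^sub>E {..<?r}. no_simple_step (2 * p) u})
      \<le> measure_pmf.expectation (bernoulli_field ?r (\<lambda>_. 1 / 3))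
        (\<lambda>\<omega>. \<Sum>i<?r. matpow ?r (symmat (\<lambda>e. skew_sign (\<omega> e))) (2 * p) i i)"
    proof (rule expectation_trace_lower[where f = "\<lambda>e b. skew_sign b"])
      show "measure_pmf.expectation (bernoulli_pmf (1 / 3)) skew_sign = 0"
        using expectation_skew_sign[of "\<lambda>x. x"] by simp
    qed (use p skew_sign_moment_ge_1 in auto)
    also have "\<dots> \<le> real ?r * (moment_const * real p) ^ p"
      by (rule expectation_trace_skew_le[OF p(1)])
    finally show "real (card {u \<in> {..<2 * p} \<rightarrow>\<^sub>E {..<?r}. no_simple_step (2 * p) u})
      \<le> real ?r * (moment_const * real p) ^ p" .
  qed auto
  also have "\<dots> = real n * (moment_const * real p) ^ p" using p by simp
  finally show ?thesis .
qed

text \<open>The factor \<open>exp 2\<close> in the threshold contributes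
  \<open>exp (2 * p) >= n^2\<close> to its \<open>2 p\<close>-th power. Markov's inequality thus
  loses \<open>n\<close> from the trace and gains \<open>n^2\<close>.\<close>

lemma prob_matvec_large_le:
  assumes \<rho>: "\<And>e. e \<in> pairs n \<Longrightarrow> 0 \<le> \<rho> e \<and> \<rho> e \<le> \<alpha>"
    and \<alpha>: "0 \<le> \<alpha>" "\<alpha> \<le> 1" and p: "p > 0" "real n * \<alpha> \<le> real p" "ln (real n) \<le> real p"
    and n: "n > 0"
  shows "measure_pmf.prob (bernoulli_field n \<rho>)
     {\<omega>. \<exists>x. vnorm n (matvec n (symmat (\<lambda>e. of_bool (\<omega> e) - \<rho> e)) x)
           > sqrt (exp 2 * moment_const * real p) * vnorm n x} \<le> 1 / real n"
proof -
  define t where "t = sqrt (exp 2 * moment_const * real p)"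
  define W where "W \<omega> = symmat (\<lambda>e. of_bool (\<omega> e) - \<rho> e)" for \<omega> :: "nat \<times> nat \<Rightarrow> bool"
  define T where "T \<omega> = (\<Sum>i<n. matpow n (W \<omega>) (2 * p) i i)" for \<omega>
  have mc: "moment_const > 0" by (simp add: moment_const_def)
  have t: "t > 0" "t\<^sup>2 = exp 2 * moment_const * real p" using mc p by (auto simp: t_def)
  have sym: "W \<omega> i j = W \<omega> j i" for \<omega> i j unfolding W_def by (rule symmat_sym)
  have T0: "T \<omega> \<ge> 0" for \<omega>
    unfolding T_def by (subst trace_even_power[where M = "W \<omega>", OF sym]) (auto intro!: sum_nonneg)
  have "measure_pmf.prob (bernoulli_field n \<rho>) {\<omega>. \<exists>x. vnorm n (matvec n (W \<omega>) x) > t * vnorm n x}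
     \<le> measure_pmf.prob (bernoulli_field n \<rho>) {\<omega> \<in> space (measure_pmf (bernoulli_field n \<rho>)). T \<omega> \<ge> t ^ (2 * p)}"
  proof (rule measure_pmf.finite_measure_mono)
    show "{\<omega>. \<exists>x. vnorm n (matvec n (W \<omega>) x) > t * vnorm n x}
      \<subseteq> {\<omega> \<in> space (measure_pmf (bernoulli_field n \<rho>)). T \<omega> \<ge> t ^ (2 * p)}"
    proof
      fix \<omega> assume "\<omega> \<in> {\<omega>. \<exists>x. vnorm n (matvec n (W \<omega>) x) > t * vnorm n x}"
      then obtain x where x: "vnorm n (matvec n (W \<omega>) x) > t * vnorm n x" by auto
      have le: "vnorm n (matvec n (W \<omega>) x) ^ (2 * p) \<le> T \<omega> * vnorm n x ^ (2 * p)"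
        unfolding T_def using p by (intro vnorm_matvec_power_le_trace sym) auto
      have "vnorm n x \<noteq> 0"
      proof
        assume z: "vnorm n x = 0"
        then have "vnorm n (matvec n (W \<omega>) x) ^ (2 * p) \<le> 0" using le p by (simp add: power_0_left)
        moreover have "vnorm n (matvec n (W \<omega>) x) ^ (2 * p) > 0"
          using x z by (intro zero_less_power) simp
        ultimately show False by simp
      qed
      then have pos: "vnorm n x > 0" using vnorm_nonneg[of n x] by linarith
      have "(t * vnorm n x) ^ (2 * p) \<le> vnorm n (matvec n (W \<omega>) x) ^ (2 * p)"
        using x t pos by (intro power_mono) auto
      then have "t ^ (2 * p) * vnorm n x ^ (2 * p) \<le> T \<omega> * vnorm n x ^ (2 * p)"
        using le by (simp add: power_mult_distrib)
      then have "t ^ (2 * p) \<le> T \<omega>"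
        using pos by (simp add: mult_le_cancel_right)
      then show "\<omega> \<in> {\<omega> \<in> space (measure_pmf (bernoulli_field n \<rho>)). T \<omega> \<ge> t ^ (2 * p)}" by simp
    qed
  qed simp
  also have "\<dots> \<le> measure_pmf.expectation (bernoulli_field n \<rho>) T / t ^ (2 * p)"
    by (rule integral_Markov_inequality_measure[where A = "{}"]) (use T0 t in auto)
  also have "\<dots> \<le> real n * (moment_const * real p) ^ p / t ^ (2 * p)"
    using expectation_trace_centered_le[OF \<rho> \<alpha> p(1,2)] t
    unfolding T_def W_def by (intro divide_right_mono) auto
  also have "t ^ (2 * p) = exp (2 * real p) * (moment_const * real p) ^ p"
  proof -
    have "exp (2 * real p) = exp 2 ^ p" by (metis exp_of_nat2_mult mult.commute)
    moreover have "t ^ (2 * p) = (exp 2 * moment_const * real p) ^ p"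
      by (simp only: power_mult t(2))
    ultimately show ?thesis by (simp only: power_mult_distrib mult_ac)
  qed
  also have "real n * (moment_const * real p) ^ p / (exp (2 * real p) * (moment_const * real p) ^ p)
      = real n / exp (2 * real p)"
    using mc p by simp
  also have "\<dots> \<le> real n / (real n)\<^sup>2"
  proof (intro divide_left_mono)
    have "real n \<le> exp (real p)" using p(3) n by (metis exp_le_cancel_iff exp_ln of_nat_0_less_iff)
    then have "(real n)\<^sup>2 \<le> exp (real p) ^ 2" by (intro power_mono) auto
    also have "\<dots> = exp (2 * real p)" by (simp add: exp_double)
    finally show "(real n)\<^sup>2 \<le> exp (2 * real p)" .
  qed (use n in auto)
  also have "\<dots> = 1 / real n" by (simp add: power2_eq_square)
  finally show ?thesis unfolding t_def W_def .
qed

text \<open>The \<open>3\<close> pays for rounding \<open>p\<close> up to an integer, the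
  \<open>+ 1\<close> for the diagonal of the mean matrix, which the adjacency matrix does not
  have.\<close>

definition concentration_const :: real where
  "concentration_const = (sqrt (3 * (exp 2 * moment_const)) + 1)\<^sup>2"

lemma concentration_const_pos: "concentration_const > 0"
  unfolding concentration_const_def moment_const_def
  by (intro zero_less_power add_nonneg_pos) auto

section \<open>Concentration for the block model\<close>

lemma label_props:
  assumes "\<Theta> \<in> membership_matrices n K" "i < n"
  shows "label \<Theta> i < K" "l < K \<Longrightarrow> \<Theta> $$ (i, l) = of_bool (l = label \<Theta> i)"
proof -
  have c: "\<Theta> \<in> carrier_mat n K" using assms by (simp add: membership_matrices_def)
  obtain k where k: "k < K" "\<Theta> $$ (i, k) = 1" "\<And>l. l < K \<Longrightarrow> l \<noteq> k \<Longrightarrow> \<Theta> $$ (i, l) = 0"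
    using assms unfolding membership_matrices_def by blast
  have "label \<Theta> i = k"
    unfolding label_def using c k by (intro the_equality) (auto, metis zero_neq_one)
  with k show "label \<Theta> i < K" "l < K \<Longrightarrow> \<Theta> $$ (i, l) = of_bool (l = label \<Theta> i)" by auto
qed

lemma sbm_adjacency_concentration:
  assumes sbm: "is_sbm n K \<Theta> B" and n: "n \<ge> 2"
    and B: "\<And>k l. k < K \<Longrightarrow> l < K \<Longrightarrow> B $$ (k, l) \<le> \<alpha>" and \<alpha>: "\<alpha> \<ge> ln (real n) / real n"
  shows "measure_pmf.prob (sbm_adjacency n \<Theta> B)
    {A. A \<in> carrier_mat n n \<and> A\<^sup>T = A \<and>
        (\<forall>x. vnorm n (matvec n (\<lambda>i j. A $$ (i, j) - B $$ (label \<Theta> i, label \<Theta> j)) x)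
          \<le> sqrt (concentration_const * (real n * \<alpha>)) * vnorm n x)} \<ge> 1 - inverse (real n)"
proof -
  \<comment> \<open>The bound \<alpha> may exceed \<open>1\<close>, while the moment comparison
    needs a parameter in the unit interval. Since the entries of \<open>B\<close> are at most
    \<open>1\<close>, truncating loses nothing, and \<open>ln n <= n\<close> preserves the lower
    bound.\<close>
  define \<beta> where "\<beta> = min \<alpha> 1"
  define g where "g = label \<Theta>"
  define \<rho> where "\<rho> e = B $$ (g (fst e), g (snd e))" for e
  define p where "p = nat \<lceil>real n * \<beta>\<rceil>"
  define t where "t = sqrt (exp 2 * moment_const * real p)"
  define W where "W \<omega> = symmat (\<lambda>e. of_bool (\<omega> e) - \<rho> e)" for \<omega> :: "nat \<times> nat \<Rightarrow> bool"
  define Adj where "Adj a = mat n n (\<lambda>(i, j). if i < j then of_bool (a (i, j))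
      else if j < i then of_bool (a (j, i)) else 0 :: real)" for a :: "nat \<times> nat \<Rightarrow> bool"
  have \<Theta>: "\<Theta> \<in> membership_matrices n K" and Bc: "B \<in> carrier_mat K K" and Bs: "B\<^sup>T = B"
    and B01: "\<And>k l. k < K \<Longrightarrow> l < K \<Longrightarrow> 0 \<le> B $$ (k, l) \<and> B $$ (k, l) \<le> 1"
    using sbm by (auto simp: is_sbm_def)
  have g: "g i < K" if "i < n" for i using label_props(1)[OF \<Theta> that] by (simp add: g_def)
  have Bsym: "B $$ (k, l) = B $$ (l, k)" if "k < K" "l < K" for k l
    using Bs Bc that by (metis carrier_matD index_transpose_mat(1))
  have B\<beta>: "0 \<le> B $$ (g i, g j)" "B $$ (g i, g j) \<le> \<beta>" if "i < n" "j < n" for i j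
    using B[OF g g] B01[OF g g] that by (auto simp: \<beta>_def)
  have ln0: "ln (real n) / real n \<ge> 0" using n by simp
  have \<beta>: "0 \<le> \<beta>" "\<beta> \<le> 1" "\<beta> \<le> \<alpha>" using \<alpha> ln0 by (auto simp: \<beta>_def)
  have "ln (real n) \<le> real n" using n ln_le_minus_one[of "real n"] by simp
  then have "ln (real n) / real n \<le> \<beta>" using \<alpha> n by (simp add: \<beta>_def)
  then have ln: "ln (real n) \<le> real n * \<beta>" using n by (simp add: pos_divide_le_eq mult.commute)
  \<comment> \<open>From \<open>x >= 1 / 2\<close> follows that the ceiling of \<open>x\<close> is
    at most \<open>x + 1 <= 3 * x\<close>; this is where \<open>n >= 2\<close> is needed.\<close>
  have half: "1 / 2 \<le> real n * \<beta>"
  proof -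
    have "exp (1 / 2 :: real) \<le> 2"
      using exp_bound_half[of "1/2::real"] by simp
    then have "(1 :: real) / 2 \<le> ln 2" by (subst ln_ge_iff) auto
    also have "\<dots> \<le> ln (real n)" using n by simp
    finally show ?thesis using ln by linarith
  qed
  have p: "real n * \<beta> \<le> real p" "real p \<le> 3 * (real n * \<beta>)"
    using half by (auto simp: p_def) linarith+
  then have p0: "p > 0" using half by (simp add: p_def)
  have le: "t + \<beta> \<le> sqrt (concentration_const * (real n * \<alpha>))"
  proof -
    have mc: "moment_const > 0" by (simp add: moment_const_def)
    have "t \<le> sqrt (3 * (exp 2 * moment_const) * (real n * \<beta>))"
      unfolding t_def using p mc by (intro real_sqrt_le_mono) (simp add: mult_ac)
    also have "\<dots> = sqrt (3 * (exp 2 * moment_const)) * sqrt (real n * \<beta>)"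
      by (rule real_sqrt_mult)
    finally have 1: "t \<le> sqrt (3 * (exp 2 * moment_const)) * sqrt (real n * \<beta>)" .
    have "\<beta>\<^sup>2 \<le> real n * \<beta>"
      unfolding power2_eq_square using \<beta> n by (intro mult_right_mono) auto
    then have 2: "\<beta> \<le> sqrt (real n * \<beta>)" using \<beta> by (simp add: real_le_rsqrt)
    have "t + \<beta> \<le> (sqrt (3 * (exp 2 * moment_const)) + 1) * sqrt (real n * \<beta>)"
      using 1 2 by (simp add: distrib_right)
    also have "\<dots> = sqrt (concentration_const * (real n * \<beta>))"
      unfolding concentration_const_def real_sqrt_mult using mc by simp
    also have "\<dots> \<le> sqrt (concentration_const * (real n * \<alpha>))"
      using \<beta> concentration_const_pos by (intro real_sqrt_le_mono mult_left_mono) auto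
    finally show ?thesis .
  qed
  have adj: "sbm_adjacency n \<Theta> B = map_pmf Adj (bernoulli_field n \<rho>)"
    unfolding sbm_adjacency_def bernoulli_field_def pairs_def Adj_def \<rho>_def g_def
    by (simp add: case_prod_beta')
  let ?good = "{A. A \<in> carrier_mat n n \<and> A\<^sup>T = A \<and>
        (\<forall>x. vnorm n (matvec n (\<lambda>i j. A $$ (i, j) - B $$ (label \<Theta> i, label \<Theta> j)) x)
          \<le> sqrt (concentration_const * (real n * \<alpha>)) * vnorm n x)}"
  let ?bad = "{\<omega>. \<exists>x. vnorm n (matvec n (W \<omega>) x) > t * vnorm n x}"
  have sub: "- ?bad \<subseteq> Adj -` ?good"
  proof
    fix \<omega> assume "\<omega> \<in> - ?bad"
    then have W: "vnorm n (matvec n (W \<omega>) x) \<le> t * vnorm n x" for x by (auto simp: not_less)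
    have "vnorm n (matvec n (\<lambda>i j. Adj \<omega> $$ (i, j) - B $$ (g i, g j)) x)
        \<le> sqrt (concentration_const * (real n * \<alpha>)) * vnorm n x" for x
    proof -
      \<comment> \<open>\<open>A\<close> has zero diagonal, the mean matrix does not, so their
        difference is the centred matrix minus a diagonal matrix of norm at most \<beta>.\<close>
      have entry: "Adj \<omega> $$ (i, j) - B $$ (g i, g j) = W \<omega> i j - of_bool (i = j) * B $$ (g i, g i)"
        if "i < n" "j < n" for i j
        using that Bsym[OF g g, of i j] by (auto simp: Adj_def W_def symmat_def \<rho>_def min_def max_def)
      have "vnorm n (matvec n (\<lambda>i j. Adj \<omega> $$ (i, j) - B $$ (g i, g j)) x)
          = vnorm n (\<lambda>i. matvec n (W \<omega>) x i - B $$ (g i, g i) * x i)"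
      proof (rule vnorm_cong)
        fix i assume i: "i < n"
        have "matvec n (\<lambda>i j. Adj \<omega> $$ (i, j) - B $$ (g i, g j)) x i
            = (\<Sum>j<n. W \<omega> i j * x j - (if j = i then B $$ (g i, g i) * x i else 0))"
          unfolding matvec_def using i entry by (intro sum.cong) (auto simp: left_diff_distrib)
        then show "matvec n (\<lambda>i j. Adj \<omega> $$ (i, j) - B $$ (g i, g j)) x i
            = matvec n (W \<omega>) x i - B $$ (g i, g i) * x i"
          using i by (simp add: sum_subtractf matvec_def)
      qed
      also have "\<dots> \<le> vnorm n (matvec n (W \<omega>) x) + vnorm n (\<lambda>i. B $$ (g i, g i) * x i)"
        by (rule vnorm_triangle_diff)
      also have "\<dots> \<le> t * vnorm n x + \<beta> * vnorm n x"
      proof (intro add_mono W)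
        show "vnorm n (\<lambda>i. B $$ (g i, g i) * x i) \<le> \<beta> * vnorm n x"
        proof (rule power2_le_imp_le)
          have "(vnorm n (\<lambda>i. B $$ (g i, g i) * x i))\<^sup>2 \<le> (\<Sum>i<n. \<beta>\<^sup>2 * (x i)\<^sup>2)"
            unfolding vnorm_square power_mult_distrib
            using B\<beta> by (intro sum_mono mult_right_mono power_mono) auto
          then show "(vnorm n (\<lambda>i. B $$ (g i, g i) * x i))\<^sup>2 \<le> (\<beta> * vnorm n x)\<^sup>2"
            by (simp add: power_mult_distrib vnorm_square sum_distrib_left)
        qed (use \<beta> in simp)
      qed
      also have "\<dots> = (t + \<beta>) * vnorm n x" by (simp add: distrib_right)
      also have "\<dots> \<le> sqrt (concentration_const * (real n * \<alpha>)) * vnorm n x"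
        using le by (intro mult_right_mono) auto
      finally show ?thesis .
    qed
    moreover have "(Adj \<omega>)\<^sup>T = Adj \<omega>"
      by (rule eq_matI) (auto simp: Adj_def)
    ultimately show "\<omega> \<in> Adj -` ?good" by (simp add: g_def Adj_def)
  qed
  have "measure_pmf.prob (bernoulli_field n \<rho>) ?bad \<le> 1 / real n"
    unfolding W_def t_def
  proof (rule prob_matvec_large_le)
    fix e assume "e \<in> pairs n"
    then show "0 \<le> \<rho> e \<and> \<rho> e \<le> \<beta>" using B\<beta> by (auto simp: pairs_def \<rho>_def)
  qed (use \<beta> p p0 ln n in auto)
  then have "1 - inverse (real n) \<le> measure_pmf.prob (bernoulli_field n \<rho>) (- ?bad)"
    using measure_pmf.prob_compl[of ?bad "bernoulli_field n \<rho>"] by (simp add: Compl_eq_Diff_UNIV divide_inverse)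
  also have "\<dots> \<le> measure_pmf.prob (bernoulli_field n \<rho>) (Adj -` ?good)"
    using sub by (intro measure_pmf.finite_measure_mono) auto
  finally show ?thesis unfolding adj by simp
qed

section \<open>Spectral theorem for real symmetric matrices\<close>

text \<open>Factor over the complex numbers; comparing \<open>c\<close> with its conjugate in the
  Hermitian form of an eigenvector shows that each root is real. For \<open>A\<close> the
  factorisation is part of \<open>leading_eigenvectors\<close>; for \<open>P\<close> it has to be
  proved.\<close>

lemma real_symmetric_char_poly_splits:
  fixes A :: "real mat"
  assumes A: "A \<in> carrier_mat n n" and sym: "A\<^sup>T = A"
  shows "\<exists>es. length es = n \<and> char_poly A = (\<Prod>e\<leftarrow>es. [:- e, 1:])"
proof -
  let ?A = "map_mat complex_of_real A"
  interpret h: map_poly_inj_idom_hom complex_of_real ..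
  have cA: "?A \<in> carrier_mat n n" using A by simp
  obtain cs where cs: "char_poly ?A = (\<Prod>c\<leftarrow>cs. [:- c, 1:])" "length cs = n"
    using char_poly_factorized[OF cA] by blast
  have symc: "?A\<^sup>T = ?A"
  proof (rule eq_matI)
    fix i j assume "i < dim_row ?A" "j < dim_col ?A"
    then have ij: "i < n" "j < n" using A by auto
    then have "A $$ (j, i) = A $$ (i, j)" using sym A by (metis carrier_matD index_transpose_mat(1))
    then show "?A\<^sup>T $$ (i, j) = ?A $$ (i, j)" using ij A by simp
  qed (use A in auto)
  have real: "c \<in> \<real>" if "c \<in> set cs" for c
  proof -
    have "poly (char_poly ?A) c = 0"
      unfolding cs(1) poly_prod_list using that by (auto simp: prod_list_zero_iff image_iff)
    then have "eigenvalue ?A c" using eigenvalue_root_char_poly[OF cA] by simp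
    then obtain v where v: "v \<in> carrier_vec n" "v \<noteq> 0\<^sub>v n" "?A *\<^sub>v v = c \<cdot>\<^sub>v v"
      using A by (auto simp: eigenvalue_def eigenvector_def)
    have conj: "?A *\<^sub>v conjugate v = cnj c \<cdot>\<^sub>v conjugate v"
    proof -
      have "?A *\<^sub>v conjugate v = conjugate (?A *\<^sub>v v)"
      proof (rule eq_vecI)
        fix i assume "i < dim_vec (conjugate (?A *\<^sub>v v))"
        then have i: "i < n" using A by simp
        then show "(?A *\<^sub>v conjugate v) $ i = conjugate (?A *\<^sub>v v) $ i"
          using A v(1) by (simp add: scalar_prod_def cnj_sum)
      qed (use A in auto)
      also have "\<dots> = cnj c \<cdot>\<^sub>v conjugate v"
        unfolding v(3) by (rule eq_vecI) auto
      finally show ?thesis .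
    qed
    have "c * (v \<bullet>c v) = (?A *\<^sub>v v) \<bullet> conjugate v"
      using v by simp
    also have "\<dots> = conjugate v \<bullet> (?A *\<^sub>v v)"
      using v cA by (intro comm_scalar_prod[of _ n]) auto
    also have "\<dots> = (?A\<^sup>T *\<^sub>v conjugate v) \<bullet> v"
      using v cA by (intro transpose_vec_mult_scalar[symmetric]) auto
    also have "\<dots> = cnj c * (conjugate v \<bullet> v)"
      unfolding symc conj using v by simp
    also have "conjugate v \<bullet> v = v \<bullet>c v"
      using v by (intro comm_scalar_prod[of _ n]) auto
    finally have "c * (v \<bullet>c v) = cnj c * (v \<bullet>c v)" .
    moreover have "v \<bullet>c v \<noteq> 0" using v conjugate_square_eq_0_vec by blast
    ultimately have "c = cnj c" by simp
    then show ?thesis by (simp add: Reals_cnj_iff)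
  qed
  have "map_poly complex_of_real (char_poly A) = (\<Prod>c\<leftarrow>cs. [:- c, 1:])"
    unfolding cs(1)[symmetric] by (rule of_real_hom.char_poly_hom[OF A, symmetric])
  also have "\<dots> = (\<Prod>c\<leftarrow>cs. map_poly complex_of_real [:- Re c, 1:])"
    using real by (intro arg_cong[of _ _ prod_list] map_cong refl) (auto simp: of_real_Re)
  also have "\<dots> = map_poly complex_of_real (\<Prod>e\<leftarrow>map Re cs. [:- e, 1:])"
    by (simp add: h.hom_prod_list o_def)
  finally have "char_poly A = (\<Prod>e\<leftarrow>map Re cs. [:- e, 1:])"
    by (rule h.injectivity)
  then show ?thesis using cs(2) by (intro exI[of _ "map Re cs"]) simp
qed

lemma real_scalar_prod_self_nonneg: "(v :: real vec) \<bullet> v \<ge> 0"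
  by (simp add: scalar_prod_def sum_nonneg)

text \<open>Deflation: a unit eigenvector for the head of the list is completed to an orthonormal
  basis, symmetry makes the transformed matrix block diagonal, and cancelling a linear factor leaves
  the tail for the smaller block. The list is prescribed, so that the diagonal follows the ordering
  fixed in \<open>leading_eigenvectors\<close>.\<close>

theorem real_symmetric_diagonalization:
  fixes A :: "real mat"
  assumes "A \<in> carrier_mat n n" "A\<^sup>T = A" "char_poly A = (\<Prod>e\<leftarrow>es. [:- e, 1:])"
  shows "\<exists>V \<in> carrier_mat n n. V\<^sup>T * V = 1\<^sub>m n \<and> V\<^sup>T * A * V = mat n n (\<lambda>(i, j). if i = j then es ! i else 0)"
  using assms
proof (induction es arbitrary: n A)
  case Nil
  then have "n = 0" using degree_monic_char_poly[of A n] by auto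
  then show ?case using Nil by (intro bexI[of _ "1\<^sub>m 0"] conjI eq_matI) auto
next
  case (Cons e es n A)
  note A = Cons.prems(1) and sym = Cons.prems(2)
  have cp: "char_poly A = [:- e, 1:] * (\<Prod>e\<leftarrow>es. [:- e, 1:])" using Cons.prems by simp
  have mon: "monic (\<Prod>e\<leftarrow>es. [:- e, 1:])" by (rule monic_prod_list) auto
  then have "degree (char_poly A) = Suc (degree (\<Prod>e\<leftarrow>es. [:- e, 1:]))"
    unfolding cp by (subst degree_mult_eq) auto
  with degree_monic_char_poly[OF A] obtain m where n: "n = 1 + m"
    by (cases n) auto
  have "eigenvalue A e" unfolding eigenvalue_root_char_poly[OF A] cp by simp
  then obtain v where v: "v \<in> carrier_vec n" "v \<noteq> 0\<^sub>v n" "A *\<^sub>v v = e \<cdot>\<^sub>v v"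
    using A by (auto simp: eigenvalue_def eigenvector_def)
  interpret cof_vec_space n "TYPE(real)" .
  \<comment> \<open>Gram-Schmidt keeps its first vector, so \<open>v\<close> survives as the first
    column up to scaling. Its output is orthogonal but not normalised, hence the division by
    \<open>nw\<close> below.\<close>
  define ws where "ws = gram_schmidt n (basis_completion v)"
  note bc = basis_completion[OF v(1,2)]
  from bc(6,7) n obtain vs where bv: "basis_completion v = v # vs"
    by (cases "basis_completion v") auto
  from gram_schmidt_result[OF bc(2,4,5) refl, folded ws_def] bc(6)
  have ws: "set ws \<subseteq> carrier_vec n" "corthogonal ws" "length ws = n" by auto
  have "hd ws = v" unfolding ws_def bv using v(1) by (rule gram_schmidt_hd)
  then have ws0: "ws ! 0 = v" using ws(3) n by (simp add: hd_conv_nth[symmetric] length_greater_0_conv[symmetric] del: length_greater_0_conv)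
  have wsc: "ws ! i \<in> carrier_vec n" if "i < n" for i using ws that by (metis nth_mem subsetD)
  have conj: "conjugate w = w" for w :: "real vec" by (rule eq_vecI) auto
  have orth: "(ws ! i \<bullet> ws ! j = 0) = (i \<noteq> j)" if "i < n" "j < n" for i j
    using corthogonalD[OF ws(2)] that ws(3) by (simp add: conj)
  define nw where "nw i = sqrt (ws ! i \<bullet> ws ! i)" for i
  have nw: "nw i > 0" "nw i * nw i = ws ! i \<bullet> ws ! i" if "i < n" for i
    using orth[OF that that] real_scalar_prod_self_nonneg[of "ws ! i"] by (auto simp: nw_def)
  define W where "W = mat n n (\<lambda>(i, j). ws ! j $ i / nw j)"
  have W: "W \<in> carrier_mat n n" by (simp add: W_def)
  have colW: "col W j = (1 / nw j) \<cdot>\<^sub>v ws ! j" if "j < n" for j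
    using that wsc[OF that] by (intro eq_vecI) (auto simp: W_def)
  have colsW: "col W i \<bullet> col W j = of_bool (i = j)" if "i < n" "j < n" for i j
  proof -
    have "col W i \<bullet> col W j = 1 / nw i * (1 / nw j * (ws ! i \<bullet> ws ! j))"
      using wsc[OF that(1)] wsc[OF that(2)] that
      by (simp add: colW smult_scalar_prod_distrib[of _ n] scalar_prod_smult_distrib[of _ n])
    then show ?thesis using orth[OF that] nw[OF that(1)] by (auto simp flip: nw(2))
  qed
  have WW: "W\<^sup>T * W = 1\<^sub>m n"
    using W colsW by (intro eq_matI) auto
  have WW': "W * W\<^sup>T = 1\<^sub>m n"
    using mat_mult_left_right_inverse[OF _ W WW] W by simp
  define A' where "A' = W\<^sup>T * A * W"
  have A': "A' \<in> carrier_mat n n" using A W by (auto simp: A'_def)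
  have symA': "A'\<^sup>T = A'"
  proof -
    have "A'\<^sup>T = W\<^sup>T * (W\<^sup>T * A)\<^sup>T"
      unfolding A'_def using A W by (intro transpose_mult[of _ n n]) auto
    also have "(W\<^sup>T * A)\<^sup>T = A\<^sup>T * (W\<^sup>T)\<^sup>T"
      using A W by (intro transpose_mult[of _ n n]) auto
    finally show ?thesis using A W sym by (simp add: A'_def assoc_mult_mat[of _ n n _ n _ n])
  qed
  have col0: "A' $$ (i, 0) = (if i = 0 then e else 0)" if i: "i < n" for i
  proof -
    have 0: "0 < n" using n by simp
    have "A' = W\<^sup>T * (A * W)" using A W by (simp add: A'_def assoc_mult_mat[of _ n n _ n _ n])
    then have "A' $$ (i, 0) = row W\<^sup>T i \<bullet> col (A * W) 0" using A W i 0 by simp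
    also have "row W\<^sup>T i = col W i" using W i by simp
    also have "col (A * W) 0 = A *\<^sub>v col W 0" using A W 0 by (intro col_mult2) auto
    also have "col W 0 = (1 / nw 0) \<cdot>\<^sub>v v" using colW[OF 0] ws0 by simp
    also have "A *\<^sub>v \<dots> = (1 / nw 0) \<cdot>\<^sub>v (e \<cdot>\<^sub>v v)"
      using A v by (simp add: mult_mat_vec)
    also have "\<dots> = e \<cdot>\<^sub>v col W 0" using colW[OF 0] ws0 by (simp add: smult_smult_assoc mult.commute)
    also have "col W i \<bullet> (e \<cdot>\<^sub>v col W 0) = e * (col W i \<bullet> col W 0)"
      using W by (intro scalar_prod_smult_distrib[of _ n]) auto
    finally show ?thesis using colsW[OF i 0] by simp
  qed
  have row0: "A' $$ (0, i) = (if i = 0 then e else 0)" if i: "i < n" for i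
  proof -
    have "A' $$ (0, i) = A'\<^sup>T $$ (i, 0)" using A' i n by simp
    then show ?thesis using col0[OF i] by (simp add: symA')
  qed
  define A1 :: "real mat" where "A1 = mat 1 1 (\<lambda>_. e)"
  define A3 where "A3 = mat m m (\<lambda>(i, j). A' $$ (Suc i, Suc j))"
  have A1: "A1 \<in> carrier_mat 1 1" and A3: "A3 \<in> carrier_mat m m" by (auto simp: A1_def A3_def)
  have blk: "A' = four_block_mat A1 (0\<^sub>m 1 m) (0\<^sub>m m 1) A3"
    using A' by (intro eq_matI) (auto simp: A1_def A3_def n col0 row0)
  have symA3: "A3\<^sup>T = A3"
  proof (rule eq_matI)
    fix i j assume "i < dim_row A3" "j < dim_col A3"
    then have ij: "i < m" "j < m" by (auto simp: A3_def)
    have "A' $$ (Suc j, Suc i) = A'\<^sup>T $$ (Suc i, Suc j)" using A' ij n by simp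
    then show "A3\<^sup>T $$ (i, j) = A3 $$ (i, j)" using ij by (simp add: A3_def symA')
  qed (auto simp: A3_def)
  have "similar_mat_wit A' A W\<^sup>T W"
    using A A' W WW WW' by (intro similar_mat_witI[of _ _ n]) (auto simp: A'_def)
  then have "char_poly A' = char_poly A"
    by (intro char_poly_similar) (auto simp: similar_mat_def)
  moreover have "char_poly A' = char_poly A1 * char_poly A3"
    unfolding blk by (rule char_poly_four_block_zeros_col[OF A1 _ A3]) simp
  moreover have "char_poly A1 = [:- e, 1:]"
    by (simp add: A1_def char_poly_defs det_def sign_def)
  ultimately have "char_poly A3 = (\<Prod>e\<leftarrow>es. [:- e, 1:])"
    using cp by (metis mult_cancel_left pCons_eq_0_iff zero_neq_one)
  from Cons.IH[OF A3 symA3 this] obtain V3 where V3: "V3 \<in> carrier_mat m m" "V3\<^sup>T * V3 = 1\<^sub>m m"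
    "V3\<^sup>T * A3 * V3 = mat m m (\<lambda>(i, j). if i = j then es ! i else 0)" by blast
  define F where "F = four_block_mat (1\<^sub>m 1) (0\<^sub>m 1 m) (0\<^sub>m m 1) V3"
  have F: "F \<in> carrier_mat n n" using V3 by (auto simp: F_def n)
  have FT: "F\<^sup>T = four_block_mat (1\<^sub>m 1) (0\<^sub>m 1 m) (0\<^sub>m m 1) (V3\<^sup>T)"
    unfolding F_def using V3 by (subst transpose_four_block_mat[of _ 1 1 _ m _ m]) auto
  have FF: "F\<^sup>T * F = 1\<^sub>m n"
    unfolding FT unfolding F_def using V3
    by (subst mult_four_block_mat[of _ 1 1 _ m _ m _ _ 1 _ m]) (auto simp: n four_block_one_mat)
  have FAF: "F\<^sup>T * A' * F = mat n n (\<lambda>(i, j). if i = j then (e # es) ! i else 0)"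
  proof -
    have "F\<^sup>T * A' = four_block_mat A1 (0\<^sub>m 1 m) (0\<^sub>m m 1) (V3\<^sup>T * A3)"
      unfolding FT blk using V3 A1 A3
      by (subst mult_four_block_mat[of _ 1 1 _ m _ m _ _ 1 _ m]) auto
    then have "F\<^sup>T * A' * F = four_block_mat A1 (0\<^sub>m 1 m) (0\<^sub>m m 1) (V3\<^sup>T * A3 * V3)"
      unfolding F_def using V3 A1 A3
      by (simp, subst mult_four_block_mat[of _ 1 1 _ m _ m _ _ 1 _ m]) auto
    also have "\<dots> = mat n n (\<lambda>(i, j). if i = j then (e # es) ! i else 0)"
      unfolding V3(3) by (intro eq_matI) (auto simp: A1_def n nth_Cons')
    finally show ?thesis .
  qed
  let ?V = "W * F"
  have V: "?V \<in> carrier_mat n n" using W F by simp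
  have VT: "?V\<^sup>T = F\<^sup>T * W\<^sup>T" using W F by (rule transpose_mult)
  have "?V\<^sup>T * ?V = F\<^sup>T * (W\<^sup>T * W) * F"
    unfolding VT using W F by (simp add: assoc_mult_mat[of _ n n _ n _ n])
  then have "?V\<^sup>T * ?V = 1\<^sub>m n" using W F by (simp add: WW FF)
  moreover have "?V\<^sup>T * A * ?V = F\<^sup>T * A' * F"
    unfolding VT A'_def using W F A by (simp add: assoc_mult_mat[of _ n n _ n _ n])
  ultimately show ?case using V FAF by (intro bexI[of _ ?V]) auto
qed

text \<open>\<open>v\<close> is an orthonormal eigenbasis in the order of \<open>es\<close>. For
  \<open>A\<close> it need not contain the columns of the given eigenvector matrix; it serves only
  to locate eigenvalues.\<close>

lemma spectral_decomposition:
  fixes A :: "real mat"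
  assumes A: "A \<in> carrier_mat n n" "A\<^sup>T = A" and cp: "char_poly A = (\<Prod>e\<leftarrow>es. [:- e, 1:])"
  obtains v :: "nat \<Rightarrow> nat \<Rightarrow> real" where
    "\<And>x. (vnorm n x)\<^sup>2 = (\<Sum>j<n. (\<Sum>i<n. v j i * x i)\<^sup>2)"
    "\<And>x j. j < n \<Longrightarrow> (\<Sum>i<n. v j i * matvec n (\<lambda>i j. A $$ (i, j)) x i) = es ! j * (\<Sum>i<n. v j i * x i)"
proof -
  obtain V where V: "V \<in> carrier_mat n n" "V\<^sup>T * V = 1\<^sub>m n"
    and VAV: "V\<^sup>T * A * V = mat n n (\<lambda>(i, j). if i = j then es ! i else 0)"
    using real_symmetric_diagonalization[OF A cp] by blast
  have VV: "V * V\<^sup>T = 1\<^sub>m n"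
    using mat_mult_left_right_inverse[OF _ V(1) V(2)] V(1) by simp
  define v where "v j i = V $$ (i, j)" for j i
  define D where "D = mat n n (\<lambda>(i, j). if i = j then es ! i else 0)"
  have D: "D \<in> carrier_mat n n" by (simp add: D_def)
  have VA: "V\<^sup>T * A = D * V\<^sup>T"
  proof -
    have "V\<^sup>T * A = V\<^sup>T * A * (V * V\<^sup>T)" using A V VV by simp
    also have "\<dots> = (V\<^sup>T * A * V) * V\<^sup>T" using A V by (simp add: assoc_mult_mat[of _ n n _ n _ n])
    finally show ?thesis by (simp add: VAV D_def)
  qed
  have coord: "(V\<^sup>T *\<^sub>v vec n x) $ j = (\<Sum>i<n. v j i * x i)" if "j < n" for x j
    using V that by (simp add: scalar_prod_def v_def atLeast0LessThan)
  show thesis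
  proof (rule that[of v])
    fix x
    let ?w = "V\<^sup>T *\<^sub>v vec n x"
    have "V *\<^sub>v ?w = (V * V\<^sup>T) *\<^sub>v vec n x"
      using V by (intro assoc_mult_mat_vec[symmetric, of _ n n _ n]) auto
    then have Vw: "V *\<^sub>v ?w = vec n x" by (simp add: VV)
    have "(vnorm n x)\<^sup>2 = vec n x \<bullet> (V *\<^sub>v ?w)"
      unfolding vnorm_square Vw by (simp add: scalar_prod_def power2_eq_square atLeast0LessThan)
    also have "\<dots> = ?w \<bullet> ?w"
      using V by (intro transpose_vec_mult_scalar[symmetric]) auto
    also have "\<dots> = (\<Sum>j<n. (\<Sum>i<n. v j i * x i)\<^sup>2)"
    proof -
      have "dim_vec ?w = n" using V by simp
      then have "?w \<bullet> ?w = (\<Sum>j<n. ?w $ j * ?w $ j)"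
        by (simp only: scalar_prod_def atLeast0LessThan)
      also have "\<dots> = (\<Sum>j<n. (\<Sum>i<n. v j i * x i)\<^sup>2)"
        by (intro sum.cong) (simp_all only: lessThan_iff coord power2_eq_square)
      finally show ?thesis .
    qed
    finally show "(vnorm n x)\<^sup>2 = (\<Sum>j<n. (\<Sum>i<n. v j i * x i)\<^sup>2)" .
  next
    fix x j assume j: "j < n"
    have "vec n (matvec n (\<lambda>i j. A $$ (i, j)) x) = A *\<^sub>v vec n x"
      using A by (intro eq_vecI) (auto simp: matvec_def scalar_prod_def atLeast0LessThan)
    then have "(\<Sum>i<n. v j i * matvec n (\<lambda>i j. A $$ (i, j)) x i) = (V\<^sup>T *\<^sub>v (A *\<^sub>v vec n x)) $ j"
      using coord[OF j, of "matvec n (\<lambda>i j. A $$ (i, j)) x"] by simp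
    also have "V\<^sup>T *\<^sub>v (A *\<^sub>v vec n x) = (D * V\<^sup>T) *\<^sub>v vec n x"
      unfolding VA[symmetric] using A V by (intro assoc_mult_mat_vec[symmetric, of _ n n _ n]) auto
    also have "\<dots> = D *\<^sub>v (V\<^sup>T *\<^sub>v vec n x)"
      using V D by (intro assoc_mult_mat_vec[of _ n n _ n]) auto
    also have "\<dots> $ j = (\<Sum>i<n. (if j = i then es ! j else 0) * (V\<^sup>T *\<^sub>v vec n x) $ i)"
      using j V by (simp add: scalar_prod_def D_def atLeast0LessThan)
    also have "\<dots> = es ! j * (V\<^sup>T *\<^sub>v vec n x) $ j"
      using j by (simp add: if_distrib[of "\<lambda>a. a * _"] cong: if_cong)
    finally show "(\<Sum>i<n. v j i * matvec n (\<lambda>i j. A $$ (i, j)) x i) = es ! j * (\<Sum>i<n. v j i * x i)"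
      using coord[OF j] by simp
  qed
qed

section \<open>Perturbation of block-constant signals\<close>

lemma matvec_eq_mult_mat_vec:
  "M \<in> carrier_mat n n \<Longrightarrow> i < n \<Longrightarrow> matvec n (\<lambda>i j. M $$ (i, j)) x i = (M *\<^sub>v vec n x) $ i"
  by (simp add: matvec_def scalar_prod_def atLeast0LessThan)

lemma invertible_imp_solvable:
  fixes M :: "nat \<Rightarrow> nat \<Rightarrow> real"
  assumes inj: "\<And>x. (\<And>i. i < n \<Longrightarrow> matvec n M x i = 0) \<Longrightarrow> (\<And>i. i < n \<Longrightarrow> x i = 0)"
  obtains x where "\<And>i. i < n \<Longrightarrow> matvec n M x i = y i"
proof -
  let ?M = "mat n n (\<lambda>(i, j). M i j)"
  have c: "?M \<in> carrier_mat n n" by simp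
  have mv: "(?M *\<^sub>v v) $ i = matvec n M (\<lambda>j. v $ j) i" if "i < n" "v \<in> carrier_vec n" for v i
    using that by (simp add: scalar_prod_def matvec_def atLeast0LessThan)
  have "det ?M \<noteq> 0"
  proof
    assume "det ?M = 0"
    then obtain v where v: "v \<in> carrier_vec n" "v \<noteq> 0\<^sub>v n" "?M *\<^sub>v v = 0\<^sub>v n"
      using det_0_iff_vec_prod_zero_field[OF c] by blast
    have "matvec n M (\<lambda>j. v $ j) i = 0" if "i < n" for i
      using mv[OF that v(1)] v(3) that by simp
    then have "v $ i = 0" if "i < n" for i using inj[of "\<lambda>j. v $ j"] that by blast
    then have "v = 0\<^sub>v n" using v(1) by (intro eq_vecI) auto
    then show False using v(2) by simp
  qed
  then have "?M \<in> Units (ring_mat TYPE(real) n ())" by (rule det_non_zero_imp_unit[OF c])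
  then obtain N where N: "N \<in> carrier_mat n n" "?M * N = 1\<^sub>m n"
    by (auto simp: Units_def ring_mat_def)
  show thesis
  proof (rule that)
    fix i assume i: "i < n"
    have w: "N *\<^sub>v vec n y \<in> carrier_vec n" using N by simp
    have "?M *\<^sub>v (N *\<^sub>v vec n y) = (?M * N) *\<^sub>v vec n y"
      using N by (intro assoc_mult_mat_vec[symmetric, of _ n n _ n]) auto
    then have "?M *\<^sub>v (N *\<^sub>v vec n y) = vec n y" using N by simp
    then show "matvec n M (\<lambda>j. (N *\<^sub>v vec n y) $ j) i = y i"
      using mv[OF i w] i by simp
  qed
qed

lemma underdetermined_system:
  fixes f :: "nat \<Rightarrow> nat \<Rightarrow> real"
  assumes "a < n"
  obtains z where "\<exists>k<n. z k \<noteq> 0" "\<And>j. j < n \<Longrightarrow> j \<noteq> a \<Longrightarrow> (\<Sum>k<n. f j k * z k) = 0"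
proof -
  \<comment> \<open>Equation \<open>a\<close> is replaced by a zero row, so the system is not
    solvable for the right side \<open>1\<close> and its kernel is therefore nontrivial.\<close>
  let ?M = "\<lambda>j k. if j = a then 0 else f j k"
  have "\<exists>z. (\<forall>i<n. matvec n ?M z i = 0) \<and> (\<exists>k<n. z k \<noteq> 0)"
  proof (rule ccontr)
    assume neg: "\<not> ?thesis"
    obtain x where "\<And>i. i < n \<Longrightarrow> matvec n ?M x i = 1"
      using invertible_imp_solvable[of n ?M "\<lambda>_. 1"] neg by blast
    from this[OF assms] show False by (simp add: matvec_def)
  qed
  then obtain z where z: "\<forall>i<n. matvec n ?M z i = 0" "\<exists>k<n. z k \<noteq> 0" by blast
  show thesis
  proof (rule that[OF z(2)])
    fix j assume j: "j < n" "j \<noteq> a"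
    then have "matvec n ?M z j = 0" using z(1) by blast
    then show "(\<Sum>k<n. f j k * z k) = 0" using j by (simp add: matvec_def)
  qed
qed

text \<open>A square matrix and its transpose have the same least singular value. Directly: solve
  \<open>M x = w\<close>, write the squared norm of \<open>w\<close> as the inner product of the
  transposed image of \<open>w\<close> with \<open>x\<close>, and bound \<open>x\<close> by
  \<open>lower\<close>.\<close>

lemma transpose_lower_bound:
  fixes M :: "nat \<Rightarrow> nat \<Rightarrow> real"
  assumes lower: "\<And>x. a * (vnorm n x)\<^sup>2 \<le> (vnorm n (matvec n M x))\<^sup>2" and a: "a > 0"
  shows "a * (vnorm n w)\<^sup>2 \<le> (vnorm n (matvec n (\<lambda>i j. M j i) w))\<^sup>2"
proof -
  have "x i = 0" if z: "\<And>i. i < n \<Longrightarrow> matvec n M x i = 0" and i: "i < n" for x i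
  proof -
    have "(vnorm n (matvec n M x))\<^sup>2 = 0" unfolding vnorm_square using z by simp
    then have "(vnorm n x)\<^sup>2 \<le> 0" using lower[of x] a by (simp add: mult_le_0_iff)
    then have "(\<Sum>i<n. (x i)\<^sup>2) = 0" unfolding vnorm_square using sum_nonneg[of "{..<n}" "\<lambda>i. (x i)\<^sup>2"] by simp
    then show ?thesis using i by (simp add: sum_nonneg_eq_0_iff)
  qed
  then obtain x where x: "\<And>i. i < n \<Longrightarrow> matvec n M x i = w i"
    using invertible_imp_solvable[of n M w] by blast
  have nw: "vnorm n (matvec n M x) = vnorm n w" using x by (rule vnorm_cong)
  let ?t = "vnorm n (matvec n (\<lambda>i j. M j i) w)"
  have "(vnorm n w)\<^sup>2 = (\<Sum>i<n. w i * matvec n M x i)"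
    unfolding vnorm_square using x by (simp add: power2_eq_square)
  also have "\<dots> = (\<Sum>i<n. \<Sum>j<n. w i * (M i j * x j))"
    by (simp add: matvec_def sum_distrib_left)
  also have "\<dots> = (\<Sum>j<n. \<Sum>i<n. w i * (M i j * x j))" by (rule sum.swap)
  also have "\<dots> = (\<Sum>j<n. matvec n (\<lambda>i j. M j i) w j * x j)"
    by (simp add: matvec_def sum_distrib_right sum_distrib_left mult_ac)
  also have "\<dots> \<le> ?t * vnorm n x" using abs_inner_le_vnorm abs_le_D1 by blast
  finally have "((vnorm n w)\<^sup>2)\<^sup>2 \<le> (?t * vnorm n x)\<^sup>2" by (intro power_mono) auto
  then have "a * ((vnorm n w)\<^sup>2)\<^sup>2 \<le> ?t\<^sup>2 * (a * (vnorm n x)\<^sup>2)"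
    using a by (simp add: power_mult_distrib mult_ac)
  also have "\<dots> \<le> ?t\<^sup>2 * (vnorm n w)\<^sup>2"
    using lower[of x] nw by (intro mult_left_mono) auto
  finally have le: "(a * (vnorm n w)\<^sup>2) * (vnorm n w)\<^sup>2 \<le> ?t\<^sup>2 * (vnorm n w)\<^sup>2"
    by (simp add: power2_eq_square mult_ac)
  show ?thesis
  proof (cases "vnorm n w = 0")
    case False
    then have "(vnorm n w)\<^sup>2 > 0" by simp
    with le show ?thesis by simp
  qed simp
qed

section \<open>Block means and residuals\<close>

definition block_size :: "nat \<Rightarrow> (nat \<Rightarrow> nat) \<Rightarrow> nat \<Rightarrow> real" where
  "block_size n g k = real (card {i. i < n \<and> g i = k})"

definition block_mean :: "nat \<Rightarrow> (nat \<Rightarrow> nat) \<Rightarrow> (nat \<Rightarrow> real) \<Rightarrow> nat \<Rightarrow> real" where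
  "block_mean n g x k = (\<Sum>i | i < n \<and> g i = k. x i) / block_size n g k"

text \<open>The residual is the component of \<open>x\<close> orthogonal to the vectors that are constant on blocks.\<close>

definition block_residual :: "nat \<Rightarrow> (nat \<Rightarrow> nat) \<Rightarrow> (nat \<Rightarrow> real) \<Rightarrow> nat \<Rightarrow> real" where
  "block_residual n g x i = x i - block_mean n g x (g i)"

locale blocks =
  fixes n K :: nat and g :: "nat \<Rightarrow> nat"
  assumes block_less: "i < n \<Longrightarrow> g i < K"
    and block_nonempty: "k < K \<Longrightarrow> block_size n g k > 0"
begin

lemma sum_blocks: "(\<Sum>i<n. f i) = (\<Sum>k<K. \<Sum>i | i < n \<and> g i = k. f i)" for f :: "nat \<Rightarrow> real"
proof -
  have "(\<Sum>k<K. \<Sum>i | i \<in> {..<n} \<and> g i = k. f i) = (\<Sum>i<n. f i)"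
    by (rule sum.group) (use block_less in auto)
  then show ?thesis by simp
qed

lemma sum_block_const: "(\<Sum>i<n. f (g i)) = (\<Sum>k<K. block_size n g k * f k)" for f :: "nat \<Rightarrow> real"
  unfolding sum_blocks by (simp add: block_size_def)

lemma sum_block_residual:
  assumes "k < K"
  shows "(\<Sum>i | i < n \<and> g i = k. block_residual n g x i) = 0"
proof -
  have "(\<Sum>i | i < n \<and> g i = k. block_residual n g x i) =
      (\<Sum>i | i < n \<and> g i = k. x i - block_mean n g x k)"
    by (intro sum.cong) (auto simp: block_residual_def)
  also have "\<dots> = (\<Sum>i | i < n \<and> g i = k. x i) - block_size n g k * block_mean n g x k"
    by (simp add: sum_subtractf block_size_def)
  finally show ?thesis using block_nonempty[OF assms] by (simp add: block_mean_def)
qed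

text \<open>The cross terms vanish because residuals sum to zero on each block.\<close>

lemma block_pythagoras:
  "(vnorm n x)\<^sup>2 = (\<Sum>k<K. block_size n g k * (block_mean n g x k)\<^sup>2) + (vnorm n (block_residual n g x))\<^sup>2"
proof -
  have "(\<Sum>i | i < n \<and> g i = k. (x i)\<^sup>2) = block_size n g k * (block_mean n g x k)\<^sup>2
      + (\<Sum>i | i < n \<and> g i = k. (block_residual n g x i)\<^sup>2)" if "k < K" for k
  proof -
    have "(\<Sum>i | i < n \<and> g i = k. (x i)\<^sup>2) =
        (\<Sum>i | i < n \<and> g i = k. (block_mean n g x k)\<^sup>2 + 2 * block_mean n g x k * block_residual n g x i
            + (block_residual n g x i)\<^sup>2)"
      by (intro sum.cong) (auto simp: block_residual_def power2_eq_square algebra_simps)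
    also have "\<dots> = block_size n g k * (block_mean n g x k)\<^sup>2
        + 2 * block_mean n g x k * (\<Sum>i | i < n \<and> g i = k. block_residual n g x i)
        + (\<Sum>i | i < n \<and> g i = k. (block_residual n g x i)\<^sup>2)"
      by (simp add: sum.distrib sum_distrib_left block_size_def)
    finally show ?thesis using sum_block_residual[OF that] by simp
  qed
  then show ?thesis unfolding vnorm_square sum_blocks by (simp add: sum.distrib)
qed

lemma vnorm_block_residual_le: "vnorm n (block_residual n g x) \<le> vnorm n x"
proof (rule power2_le_imp_le)
  have "(\<Sum>k<K. block_size n g k * (block_mean n g x k)\<^sup>2) \<ge> 0"
    by (intro sum_nonneg mult_nonneg_nonneg) (auto simp: block_size_def)
  then show "(vnorm n (block_residual n g x))\<^sup>2 \<le> (vnorm n x)\<^sup>2"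
    unfolding block_pythagoras[of x] by simp
qed simp

lemma block_residual_const:
  assumes "\<And>i. i < n \<Longrightarrow> x i = y (g i)" "i < n"
  shows "block_residual n g x i = 0"
proof -
  have "(\<Sum>j | j < n \<and> g j = g i. x j) = (\<Sum>j | j < n \<and> g j = g i. y (g i))"
    using assms by (intro sum.cong) auto
  also have "\<dots> = block_size n g (g i) * y (g i)" by (simp add: block_size_def)
  finally have "block_mean n g x (g i) = y (g i)"
    using block_nonempty[OF block_less[OF assms(2)]] by (simp only: block_mean_def) simp
  then show ?thesis using assms by (simp add: block_residual_def)
qed

lemma block_mean_lin:
  "block_mean n g (\<lambda>i. \<Sum>c\<in>C. u c i * x c) k = (\<Sum>c\<in>C. block_mean n g (u c) k * x c)"
proof -
  have "(\<Sum>i | i < n \<and> g i = k. \<Sum>c\<in>C. u c i * x c) = (\<Sum>c\<in>C. (\<Sum>i | i < n \<and> g i = k. u c i) * x c)"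
    by (subst sum.swap) (simp add: sum_distrib_right)
  moreover have "(\<Sum>c\<in>C. s c * x c) / N = (\<Sum>c\<in>C. s c / N * x c)" for s and N :: real
    by (simp add: sum_divide_distrib)
  ultimately show ?thesis by (simp only: block_mean_def)
qed

lemma block_residual_lin:
  "block_residual n g (\<lambda>i. \<Sum>c\<in>C. u c i * x c) i = (\<Sum>c\<in>C. block_residual n g (u c) i * x c)"
  by (simp add: block_residual_def block_mean_lin left_diff_distrib sum_subtractf)

lemma block_mean_diff:
  "block_mean n g (\<lambda>i. x i - y i) k = block_mean n g x k - block_mean n g y k"
  by (simp add: block_mean_def sum_subtractf diff_divide_distrib)

lemma block_mean_scale: "block_mean n g (\<lambda>i. c * x i) k = c * block_mean n g x k"
  by (simp add: block_mean_def flip: sum_distrib_left)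

text \<open>One-sided Davis--Kahan: since the signal \<open>P\<close> maps into the block-constant vectors, the residual
  of an eigenvector of \<open>A\<close> is controlled by \<open>A - P\<close> alone.\<close>

lemma eigenvector_residual_le:
  assumes eig: "\<And>i. i < n \<Longrightarrow> matvec n A u i = l * u i"
    and noise: "vnorm n (matvec n (\<lambda>i j. A i j - b (g i) (g j)) u) \<le> \<eta> * vnorm n u"
  shows "\<bar>l\<bar> * vnorm n (block_residual n g u) \<le> \<eta> * vnorm n u"
proof -
  let ?D = "matvec n (\<lambda>i j. A i j - b (g i) (g j)) u"
  have D: "?D i = l * u i - matvec n (\<lambda>i j. b (g i) (g j)) u i" if "i < n" for i
    using eig[OF that] by (simp add: matvec_def left_diff_distrib sum_subtractf)
  have const: "block_residual n g (matvec n (\<lambda>i j. b (g i) (g j)) u) i = 0" if "i < n" for i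
    by (rule block_residual_const[of _ "\<lambda>k. \<Sum>j<n. b k (g j) * u j"]) (use that in \<open>auto simp: matvec_def\<close>)
  have "l * block_residual n g u i = block_residual n g ?D i" if i: "i < n" for i
  proof -
    have "block_mean n g ?D (g i) =
        block_mean n g (\<lambda>i. l * u i - matvec n (\<lambda>i j. b (g i) (g j)) u i) (g i)"
      unfolding block_mean_def by (intro arg_cong2[of _ _ _ _ "(/)"] sum.cong) (auto simp: D)
    then have "block_residual n g ?D i =
        block_residual n g (\<lambda>i. l * u i - matvec n (\<lambda>i j. b (g i) (g j)) u i) i"
      using D[OF i] by (simp add: block_residual_def)
    also have "\<dots> = l * block_residual n g u i - block_residual n g (matvec n (\<lambda>i j. b (g i) (g j)) u) i"
      by (simp add: block_residual_def block_mean_diff block_mean_scale right_diff_distrib)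
    finally show ?thesis using const[OF i] by simp
  qed
  then have "vnorm n (\<lambda>i. l * block_residual n g u i) = vnorm n (block_residual n g ?D)"
    by (intro vnorm_cong)
  then have "\<bar>l\<bar> * vnorm n (block_residual n g u) = vnorm n (block_residual n g ?D)"
    by (simp add: vnorm_scale)
  then show ?thesis using vnorm_block_residual_le[of ?D] noise by linarith
qed

text \<open>Courant--Fischer: a block-constant vector orthogonal to \<open>K - 1\<close> of the leading eigenvectors
  bounds the remaining leading eigenvalue from below.\<close>

lemma leading_eigenvalue_ge:
  assumes parseval: "\<And>x. (vnorm n x)\<^sup>2 = (\<Sum>j<n. (\<Sum>i<n. v j i * x i)\<^sup>2)"
    and eig: "\<And>x j. j < n \<Longrightarrow> (\<Sum>i<n. v j i * matvec n A x i) = es ! j * (\<Sum>i<n. v j i * x i)"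
    and top: "\<And>i j. i < K \<Longrightarrow> K \<le> j \<Longrightarrow> j < n \<Longrightarrow> \<bar>es ! j\<bar> \<le> \<bar>es ! i\<bar>"
    and noise: "\<And>x. vnorm n (matvec n (\<lambda>i j. A i j - b (g i) (g j)) x) \<le> \<eta> * vnorm n x"
    and signal: "\<And>y. \<gamma> * vnorm n (\<lambda>i. y (g i)) \<le> vnorm n (matvec n (\<lambda>i j. b (g i) (g j)) (\<lambda>i. y (g i)))"
    and a: "a < K"
  shows "\<gamma> - \<eta> \<le> \<bar>es ! a\<bar>"
proof -
  \<comment> \<open>\<open>K - 1\<close> linear conditions on the \<open>K\<close> block values
    leave a nonzero choice.\<close>
  obtain z where z: "\<exists>k<K. z k \<noteq> 0"
    "\<And>j. j < K \<Longrightarrow> j \<noteq> a \<Longrightarrow> (\<Sum>k<K. (\<Sum>i | i < n \<and> g i = k. v j i) * z k) = 0"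
    by (rule underdetermined_system[OF a, of "\<lambda>j k. \<Sum>i | i < n \<and> g i = k. v j i"]) blast
  define x where "x i = z (g i)" for i
  have coord: "(\<Sum>i<n. v j i * x i) = 0" if "j < K" "j \<noteq> a" for j
    unfolding sum_blocks using z(2)[OF that] by (simp add: x_def sum_distrib_right)
  have x0: "vnorm n x > 0"
  proof -
    obtain k where k: "k < K" "z k \<noteq> 0" using z(1) by blast
    have "block_size n g k > 0" using block_nonempty k by simp
    then have "{i. i < n \<and> g i = k} \<noteq> {}" unfolding block_size_def by (metis card.empty of_nat_0 less_irrefl)
    then obtain i where i: "i < n" "g i = k" by auto
    have "0 < (x i)\<^sup>2" using k i by (simp add: x_def)
    also have "\<dots> \<le> (\<Sum>i<n. (x i)\<^sup>2)" using i by (intro member_le_sum) auto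
    finally have "(vnorm n x)\<^sup>2 > 0" by (simp only: vnorm_square)
    then show ?thesis using vnorm_nonneg[of n x] by (simp add: less_le)
  qed
  have "(vnorm n (matvec n A x))\<^sup>2 = (\<Sum>j<n. (es ! j * (\<Sum>i<n. v j i * x i))\<^sup>2)"
    unfolding parseval using eig by (intro sum.cong) auto
  also have "\<dots> \<le> (\<Sum>j<n. (es ! a)\<^sup>2 * (\<Sum>i<n. v j i * x i)\<^sup>2)"
  proof (rule sum_mono)
    fix j assume j: "j \<in> {..<n}"
    show "(es ! j * (\<Sum>i<n. v j i * x i))\<^sup>2 \<le> (es ! a)\<^sup>2 * (\<Sum>i<n. v j i * x i)\<^sup>2"
    proof (cases "j < K \<and> j \<noteq> a")
      case True
      then show ?thesis using coord by simp
    next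
      case False
      then have "\<bar>es ! j\<bar> \<le> \<bar>es ! a\<bar>" using top[OF a] j by (cases "j = a") auto
      then have "(es ! j)\<^sup>2 \<le> (es ! a)\<^sup>2" by (simp add: abs_le_square_iff)
      then show ?thesis unfolding power_mult_distrib by (intro mult_right_mono) auto
    qed
  qed
  also have "\<dots> = (\<bar>es ! a\<bar> * vnorm n x)\<^sup>2"
    by (simp add: parseval[of x] power_mult_distrib sum_distrib_left)
  finally have up: "vnorm n (matvec n A x) \<le> \<bar>es ! a\<bar> * vnorm n x"
    by (rule power2_le_imp_le) simp
  have split: "matvec n (\<lambda>i j. b (g i) (g j)) x =
      (\<lambda>i. matvec n A x i - matvec n (\<lambda>i j. A i j - b (g i) (g j)) x i)"
    by (simp add: matvec_def fun_eq_iff left_diff_distrib sum_subtractf)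
  have "vnorm n (matvec n (\<lambda>i j. b (g i) (g j)) x)
      \<le> vnorm n (matvec n A x) + vnorm n (matvec n (\<lambda>i j. A i j - b (g i) (g j)) x)"
    unfolding split by (rule vnorm_triangle_diff)
  then have "\<gamma> * vnorm n x \<le> \<bar>es ! a\<bar> * vnorm n x + \<eta> * vnorm n x"
    using signal[of z] up noise[of x] unfolding x_def by linarith
  then have "(\<gamma> - \<eta>) * vnorm n x \<le> \<bar>es ! a\<bar> * vnorm n x" by (simp add: left_diff_distrib)
  then show ?thesis using x0 by simp
qed

text \<open>Let \<open>M\<close> be the \<open>K\<close> by \<open>K\<close> matrix of block means
  with row \<open>k\<close> scaled by the root of the block size. By Pythagoras, \<open>M\<close>
  shrinks squared norms by at most the factor \<open>1 - \<tau>\<close>, and so does its transpose.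
  Testing the transpose on a suitable \<open>w\<close> gives the claim.\<close>

lemma block_means_separated:
  assumes orth: "\<And>x. (vnorm n (\<lambda>i. \<Sum>c<K. u c i * x c))\<^sup>2 = (vnorm K x)\<^sup>2"
    and res: "(\<Sum>c<K. (vnorm n (block_residual n g (u c)))\<^sup>2) \<le> \<tau>" and \<tau>: "\<tau> < 1"
    and kl: "k < K" "l < K" "k \<noteq> l"
  shows "(1 - \<tau>) * (1 / block_size n g k + 1 / block_size n g l)
      \<le> (\<Sum>c<K. (block_mean n g (u c) k - block_mean n g (u c) l)\<^sup>2)"
proof -
  let ?s = "\<lambda>k. sqrt (block_size n g k)"
  define M where "M k c = ?s k * block_mean n g (u c) k" for k c
  have s: "?s k > 0" "(?s k)\<^sup>2 = block_size n g k" if "k < K" for k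
    using block_nonempty[OF that] by auto
  have lower: "(1 - \<tau>) * (vnorm K x)\<^sup>2 \<le> (vnorm K (matvec K M x))\<^sup>2" for x
  proof -
    let ?y = "\<lambda>i. \<Sum>c<K. u c i * x c"
    have "(vnorm K (matvec K M x))\<^sup>2 = (\<Sum>k<K. block_size n g k * (block_mean n g ?y k)\<^sup>2)"
      unfolding vnorm_square
    proof (rule sum.cong)
      fix k assume k: "k \<in> {..<K}"
      have "matvec K M x k = ?s k * block_mean n g ?y k"
        by (simp add: matvec_def M_def block_mean_lin sum_distrib_left mult.assoc)
      then show "(matvec K M x k)\<^sup>2 = block_size n g k * (block_mean n g ?y k)\<^sup>2"
        using s(2)[of k] k by (simp add: power_mult_distrib)
    qed simp
    moreover have "(vnorm n (block_residual n g ?y))\<^sup>2 \<le> \<tau> * (vnorm K x)\<^sup>2"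
    proof -
      have "(vnorm n (block_residual n g ?y))\<^sup>2 = (\<Sum>i<n. (\<Sum>c<K. block_residual n g (u c) i * x c)\<^sup>2)"
        unfolding vnorm_square by (simp add: block_residual_lin)
      also have "\<dots> \<le> (\<Sum>i<n. (\<Sum>c<K. (block_residual n g (u c) i)\<^sup>2) * (\<Sum>c<K. (x c)\<^sup>2))"
        by (intro sum_mono Cauchy_Schwarz_ineq_sum)
      also have "\<dots> = (\<Sum>i<n. \<Sum>c<K. (block_residual n g (u c) i)\<^sup>2) * (\<Sum>c<K. (x c)\<^sup>2)"
        by (simp add: sum_distrib_right)
      also have "(\<Sum>i<n. \<Sum>c<K. (block_residual n g (u c) i)\<^sup>2) = (\<Sum>c<K. (vnorm n (block_residual n g (u c)))\<^sup>2)"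
        unfolding vnorm_square by (rule sum.swap)
      also have "(\<Sum>c<K. (vnorm n (block_residual n g (u c)))\<^sup>2) * (\<Sum>c<K. (x c)\<^sup>2) \<le> \<tau> * (\<Sum>c<K. (x c)\<^sup>2)"
        using res by (intro mult_right_mono sum_nonneg) auto
      finally show ?thesis by (simp only: vnorm_square[of K x])
    qed
    ultimately show ?thesis
      using block_pythagoras[of ?y] orth[of x] by (simp add: left_diff_distrib)
  qed
  \<comment> \<open>Undoes the row scaling, so that the transpose of \<open>M\<close> maps
    \<open>w\<close> to the difference of the two mean vectors, while its squared norm is the sum of
    the reciprocal block sizes.\<close>
  define w where "w j = (if j = k then 1 / ?s k else if j = l then - 1 / ?s l else 0)" for j
  have "(1 - \<tau>) * (vnorm K w)\<^sup>2 \<le> (vnorm K (matvec K (\<lambda>i j. M j i) w))\<^sup>2"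
    by (rule transpose_lower_bound[OF lower]) (use \<tau> in simp)
  moreover have "(vnorm K w)\<^sup>2 = 1 / block_size n g k + 1 / block_size n g l"
  proof -
    have "(\<Sum>j<K. (w j)\<^sup>2) = (\<Sum>j\<in>{k, l}. (w j)\<^sup>2)"
      using kl by (intro sum.mono_neutral_right) (auto simp: w_def)
    also have "\<dots> = 1 / block_size n g k + 1 / block_size n g l"
      using kl s(2)[of k] s(2)[of l] by (simp add: w_def power_divide)
    finally show ?thesis by (simp only: vnorm_square)
  qed
  moreover have "matvec K (\<lambda>i j. M j i) w c = block_mean n g (u c) k - block_mean n g (u c) l" for c
  proof -
    have "(\<Sum>j<K. M j c * w j) = (\<Sum>j\<in>{k, l}. M j c * w j)"
      using kl by (intro sum.mono_neutral_right) (auto simp: w_def)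
    also have "\<dots> = block_mean n g (u c) k - block_mean n g (u c) l"
      using kl s(1)[of k] s(1)[of l] by (simp add: w_def M_def)
    finally show ?thesis by (simp add: matvec_def)
  qed
  ultimately show ?thesis by (simp add: vnorm_square)
qed

text \<open>Two nodes of different blocks that are both well fitted cannot share a centre, as their
  block means would then be closer than \<open>block_means_separated\<close> allows. With at least
  one well fitted node in each of the \<open>K\<close> blocks and only \<open>K\<close> labels, the
  correspondence is a bijection.\<close>

lemma clustering_recovers_blocks:
  assumes orth: "\<And>x. (vnorm n (\<lambda>i. \<Sum>c<K. u c i * x c))\<^sup>2 = (vnorm K x)\<^sup>2"
    and res: "(\<Sum>c<K. (vnorm n (block_residual n g (u c)))\<^sup>2) \<le> \<tau>" and \<tau>: "\<tau> \<le> 1 / 2"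
    and h: "\<And>i. i < n \<Longrightarrow> h i < K" and \<epsilon>: "\<epsilon> > 0"
    and approx: "(\<Sum>i<n. \<Sum>c<K. (b (h i) c - u c i)\<^sup>2) \<le> (1 + \<epsilon>) * \<tau>"
    and small: "16 * (2 + \<epsilon>) * \<tau> < 1"
  obtains S \<sigma> where "\<And>k. k < K \<Longrightarrow> S k \<subseteq> {i. i < n \<and> g i = k}"
    "(\<Sum>k<K. real (card (S k)) / block_size n g k) \<le> 16 * (2 + \<epsilon>) * \<tau>"
    "bij_betw \<sigma> {..<K} {..<K}" "\<And>k i. k < K \<Longrightarrow> i < n \<Longrightarrow> g i = k \<Longrightarrow> i \<notin> S k \<Longrightarrow> h i = \<sigma> k"
proof -
  let ?N = "block_size n g"
  let ?m = "\<lambda>k c. block_mean n g (u c) k"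
  have \<tau>0: "\<tau> \<ge> 0" using res by (meson order_trans sum_nonneg zero_le_power2)
  define d where "d i = (\<Sum>c<K. (b (h i) c - ?m (g i) c)\<^sup>2)" for i
  \<comment> \<open>The quarter is chosen so that two distances below the threshold, doubled by the
    squared triangle inequality, stay under half of the separation.\<close>
  define S where "S k = {i. i < n \<and> g i = k \<and> (1 - \<tau>) / (4 * ?N k) \<le> d i}" for k
  have d0: "d i \<ge> 0" for i by (simp add: d_def sum_nonneg)
  have S: "S k \<subseteq> {i. i < n \<and> g i = k}" for k by (auto simp: S_def)
  have sum_d: "(\<Sum>i<n. d i) \<le> 2 * (2 + \<epsilon>) * \<tau>"
  proof -
    have sq: "(p - q)\<^sup>2 \<le> 2 * (p - r)\<^sup>2 + 2 * (r - q)\<^sup>2" for p q r :: real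
    proof -
      have "0 \<le> ((p - r) - (r - q))\<^sup>2" by simp
      then show ?thesis by (simp add: power2_eq_square algebra_simps)
    qed
    have "(\<Sum>i<n. d i) \<le> (\<Sum>i<n. \<Sum>c<K. 2 * (b (h i) c - u c i)\<^sup>2 + 2 * (u c i - ?m (g i) c)\<^sup>2)"
      unfolding d_def by (intro sum_mono sq)
    also have "\<dots> = 2 * (\<Sum>i<n. \<Sum>c<K. (b (h i) c - u c i)\<^sup>2) + 2 * (\<Sum>i<n. \<Sum>c<K. (block_residual n g (u c) i)\<^sup>2)"
      by (simp add: sum.distrib sum_distrib_left block_residual_def)
    also have "(\<Sum>i<n. \<Sum>c<K. (block_residual n g (u c) i)\<^sup>2) = (\<Sum>c<K. (vnorm n (block_residual n g (u c)))\<^sup>2)"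
      unfolding vnorm_square by (rule sum.swap)
    finally show ?thesis using approx res by (simp add: algebra_simps)
  qed
  \<comment> \<open>Each node of \<open>S k\<close> contributes at least
    \<open>(1 - \<tau>) / (4 * N k) >= 1 / (8 * N k)\<close>, where \<open>N k\<close> is the block
    size. With the factor \<open>2\<close> of \<open>sum_d\<close> this gives \<open>16\<close>, and
    the weights \<open>1 / N k\<close> appear by themselves.\<close>
  have card_S: "(\<Sum>k<K. real (card (S k)) / ?N k) \<le> 16 * (2 + \<epsilon>) * \<tau>"
  proof -
    have "(1 - \<tau>) / 4 * (\<Sum>k<K. real (card (S k)) / ?N k) = (\<Sum>k<K. \<Sum>i\<in>S k. (1 - \<tau>) / (4 * ?N k))"
      by (simp add: sum_distrib_left mult_ac)
    also have "\<dots> \<le> (\<Sum>k<K. \<Sum>i | i < n \<and> g i = k. d i)"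
    proof (rule sum_mono)
      fix k
      have "(\<Sum>i\<in>S k. (1 - \<tau>) / (4 * ?N k)) \<le> (\<Sum>i\<in>S k. d i)"
        by (rule sum_mono) (auto simp: S_def)
      also have "\<dots> \<le> (\<Sum>i | i < n \<and> g i = k. d i)"
        using S d0 by (intro sum_mono2) auto
      finally show "(\<Sum>i\<in>S k. (1 - \<tau>) / (4 * ?N k)) \<le> (\<Sum>i | i < n \<and> g i = k. d i)" .
    qed
    also have "\<dots> = (\<Sum>i<n. d i)" by (rule sum_blocks[symmetric])
    finally have "(1 - \<tau>) / 4 * (\<Sum>k<K. real (card (S k)) / ?N k) \<le> 2 * (2 + \<epsilon>) * \<tau>"
      using sum_d by linarith
    moreover have "1 / 8 * (\<Sum>k<K. real (card (S k)) / ?N k) \<le> (1 - \<tau>) / 4 * (\<Sum>k<K. real (card (S k)) / ?N k)"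
      using \<tau> by (intro mult_right_mono sum_nonneg) (auto simp: block_size_def)
    ultimately show ?thesis by linarith
  qed
  \<comment> \<open>The weighted sum is below \<open>1\<close>, so no single ratio can reach
    \<open>1\<close>; each block keeps a representative.\<close>
  have "\<exists>i. i < n \<and> g i = k \<and> i \<notin> S k" if k: "k < K" for k
  proof (rule ccontr)
    assume "\<not> ?thesis"
    then have "S k = {i. i < n \<and> g i = k}" using S by blast
    then have "real (card (S k)) = ?N k" by (simp only: block_size_def)
    then have "1 = real (card (S k)) / ?N k" using block_nonempty[OF k] by simp
    also have "\<dots> \<le> (\<Sum>k<K. real (card (S k)) / ?N k)"
      using k by (intro member_le_sum[where f = "\<lambda>k. real (card (S k)) / ?N k"]) (auto simp: block_size_def)
    finally show False using card_S small by linarith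
  qed
  then obtain r where r: "\<And>k. k < K \<Longrightarrow> r k < n \<and> g (r k) = k \<and> r k \<notin> S k" by metis
  have distinct: "h i \<noteq> h j" if i: "i < n" "i \<notin> S (g i)" and j: "j < n" "j \<notin> S (g j)" and ne: "g i \<noteq> g j" for i j
  proof
    assume eq: "h i = h j"
    have sq: "(p - q)\<^sup>2 \<le> 2 * (r - p)\<^sup>2 + 2 * (r - q)\<^sup>2" for p q r :: real
    proof -
      have "0 \<le> ((r - p) + (r - q))\<^sup>2" by simp
      then show ?thesis by (simp add: power2_eq_square algebra_simps)
    qed
    have "(1 - \<tau>) * (1 / ?N (g i) + 1 / ?N (g j)) \<le> (\<Sum>c<K. (?m (g i) c - ?m (g j) c)\<^sup>2)"
      using \<tau> block_less i j ne by (intro block_means_separated orth res) auto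
    also have "\<dots> \<le> (\<Sum>c<K. 2 * (b (h i) c - ?m (g i) c)\<^sup>2 + 2 * (b (h i) c - ?m (g j) c)\<^sup>2)"
      by (intro sum_mono sq)
    also have "\<dots> = 2 * d i + 2 * d j"
      by (simp add: d_def eq sum.distrib sum_distrib_left)
    also have "\<dots> < 2 * ((1 - \<tau>) / (4 * ?N (g i))) + 2 * ((1 - \<tau>) / (4 * ?N (g j)))"
      using i j by (intro add_strict_mono mult_strict_left_mono) (auto simp: S_def)
    also have "\<dots> = (1 - \<tau>) / 2 * (1 / ?N (g i) + 1 / ?N (g j))"
    proof -
      have "2 * (x / (4 * y)) + 2 * (x / (4 * z)) = x / 2 * (1 / y + 1 / z)" for x y z :: real
        by (simp add: distrib_left)
      then show ?thesis .
    qed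
    also have "\<dots> \<le> (1 - \<tau>) * (1 / ?N (g i) + 1 / ?N (g j))"
      using \<tau> by (intro mult_right_mono) (auto simp: block_size_def)
    finally show False by simp
  qed
  define \<sigma> where "\<sigma> k = h (r k)" for k
  have inj: "inj_on \<sigma> {..<K}"
  proof (rule inj_onI)
    fix k l assume "k \<in> {..<K}" "l \<in> {..<K}" "\<sigma> k = \<sigma> l"
    then show "k = l" using distinct[of "r k" "r l"] r[of k] r[of l] by (auto simp: \<sigma>_def)
  qed
  \<comment> \<open>Surjectivity matters: it places the label of any well fitted node among the
    labels of the representatives, and \<open>distinct\<close> then identifies the block.\<close>
  have "\<sigma> ` {..<K} \<subseteq> {..<K}" using r h by (auto simp: \<sigma>_def)
  then have img: "\<sigma> ` {..<K} = {..<K}" using inj by (intro endo_inj_surj) auto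
  show thesis
  proof (rule that[of S \<sigma>])
    show "bij_betw \<sigma> {..<K} {..<K}" using inj img by (simp add: bij_betw_def)
    fix k i assume i: "k < K" "i < n" "g i = k" "i \<notin> S k"
    have "h i \<in> \<sigma> ` {..<K}" using h[OF i(2)] img by simp
    then obtain l where l: "l < K" "h i = \<sigma> l" by auto
    have "l = k"
    proof (rule ccontr)
      assume "l \<noteq> k"
      then have "h i \<noteq> h (r l)" using distinct[of i "r l"] i r[OF l(1)] by auto
      then show False using l by (simp add: \<sigma>_def)
    qed
    then show "h i = \<sigma> k" using l by simp
  qed (use S card_S in auto)
qed

end

section \<open>Recovery of the communities\<close>

text \<open>A maximal independent set of columns of \<open>P\<close> has \<open>K\<close> elements
  and lies among the at most \<open>K\<close> distinct columns of \<open>M\<close>. It therefore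
  exhausts them, so the columns of \<open>M\<close> are distinct and independent.\<close>

lemma rank_eq_imp_injective:
  fixes M P :: "real mat"
  assumes M: "M \<in> carrier_mat n K" and P: "P \<in> carrier_mat n m"
    and sub: "set (cols P) \<subseteq> set (cols M)" and rank: "vec_space.rank n P = K"
    and v: "v \<in> carrier_vec K" "M *\<^sub>v v = 0\<^sub>v n"
  shows "v = 0\<^sub>v K"
proof (rule ccontr)
  assume v0: "v \<noteq> 0\<^sub>v K"
  interpret vec_space "TYPE(real)" n .
  have "lin_indpt {}" by (simp add: lin_dep_def)
  then obtain S where S: "finite S" "maximal S (\<lambda>T. T \<subseteq> set (cols P) \<and> lin_indpt T)"
    using maximal_exists_superset[of "set (cols P)" "\<lambda>T. T \<subseteq> set (cols P) \<and> lin_indpt T" "{}"] by auto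
  then have SP: "S \<subseteq> set (cols P)" "lin_indpt S" by (auto simp: maximal_def)
  have cS: "card S = K" using rank_card_indpt[OF P S(2)] rank by simp
  have len: "length (cols M) = K" using M by simp
  have le: "card (set (cols M)) \<le> K" using card_length[of "cols M"] len by simp
  have "S = set (cols M)"
    using SP sub cS le by (intro card_seteq) auto
  then have "distinct (cols M)" "lin_indpt (set (cols M))"
    using cS len SP by (auto intro: card_distinct)
  then show False using lin_depI[OF M v(1) v0 v(2)] by blast
qed

lemma mult_mat_entry:
  assumes "M \<in> carrier_mat n m" "N \<in> carrier_mat m k" "i < n" "j < k"
  shows "(M * N) $$ (i, j) = (\<Sum>l<m. M $$ (i, l) * N $$ (l, j))"
  using assms by (simp add: scalar_prod_def atLeast0LessThan)

lemma sbm_mean_entry: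
  assumes "is_sbm n K \<Theta> B" "i < n" "j < n"
  shows "(\<Theta> * B * \<Theta>\<^sup>T) $$ (i, j) = B $$ (label \<Theta> i, label \<Theta> j)"
proof -
  have \<Theta>m: "\<Theta> \<in> membership_matrices n K" and B: "B \<in> carrier_mat K K"
    using assms by (auto simp: is_sbm_def)
  then have \<Theta>: "\<Theta> \<in> carrier_mat n K" by (simp add: membership_matrices_def)
  note lab = label_props[OF \<Theta>m]
  have \<Theta>B: "(\<Theta> * B) $$ (i, l) = B $$ (label \<Theta> i, l)" if "l < K" for l
  proof -
    have "(\<Theta> * B) $$ (i, l) = (\<Sum>k<K. \<Theta> $$ (i, k) * B $$ (k, l))"
      using \<Theta> B assms that by (intro mult_mat_entry)
    also have "\<dots> = (\<Sum>k<K. if k = label \<Theta> i then B $$ (k, l) else 0)"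
      using lab(2)[OF assms(2)] by (intro sum.cong) auto
    finally show ?thesis using lab(1)[OF assms(2)] by simp
  qed
  have "(\<Theta> * B * \<Theta>\<^sup>T) $$ (i, j) = (\<Sum>l<K. (\<Theta> * B) $$ (i, l) * \<Theta>\<^sup>T $$ (l, j))"
    using \<Theta> B assms by (intro mult_mat_entry) auto
  also have "\<dots> = (\<Sum>l<K. (\<Theta> * B) $$ (i, l) * \<Theta> $$ (j, l))"
    using \<Theta> assms by (intro sum.cong) auto
  also have "\<dots> = (\<Sum>l<K. if l = label \<Theta> j then B $$ (label \<Theta> i, l) else 0)"
    using lab(2)[OF assms(3)] \<Theta>B by (intro sum.cong) auto
  finally show ?thesis using lab(1)[OF assms(3)] by simp
qed

text \<open>The columns of \<open>P\<close> are columns of \<open>\<Theta> * B\<close>, so rank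
  \<open>K\<close> makes \<open>\<Theta> * B\<close> injective. This forces \<open>B\<close> to be
  nonsingular and, by the witness below, all communities to be nonempty.\<close>

lemma sbm_full_rank:
  assumes sbm: "is_sbm n K \<Theta> B" and rank: "vec_space.rank n (\<Theta> * B * \<Theta>\<^sup>T) = K"
  shows "\<And>x. (\<And>k. k < K \<Longrightarrow> matvec K (\<lambda>k l. B $$ (k, l)) x k = 0) \<Longrightarrow> (\<And>k. k < K \<Longrightarrow> x k = 0)"
    and "blocks n K (label \<Theta>)"
proof -
  have \<Theta>m: "\<Theta> \<in> membership_matrices n K" and B: "B \<in> carrier_mat K K"
    using sbm by (auto simp: is_sbm_def)
  then have \<Theta>: "\<Theta> \<in> carrier_mat n K" by (simp add: membership_matrices_def)
  note lab = label_props[OF \<Theta>m]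
  have \<Theta>B: "\<Theta> * B \<in> carrier_mat n K" using \<Theta> B by simp
  define P where "P = \<Theta> * B * \<Theta>\<^sup>T"
  have P: "P \<in> carrier_mat n n" using \<Theta> B by (simp add: P_def)
  have rankP: "vec_space.rank n P = K" using rank by (simp add: P_def)
  have \<Theta>v: "(\<Theta> *\<^sub>v w) $ i = w $ label \<Theta> i" if "i < n" "w \<in> carrier_vec K" for w i
  proof -
    have "(\<Theta> *\<^sub>v w) $ i = (\<Sum>k<K. \<Theta> $$ (i, k) * w $ k)"
      using \<Theta> that by (simp add: scalar_prod_def atLeast0LessThan)
    also have "\<dots> = (\<Sum>k<K. if k = label \<Theta> i then w $ k else 0)"
      using lab(2)[OF that(1)] by (intro sum.cong) auto
    finally show ?thesis using lab(1)[OF that(1)] by simp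
  qed
  have colP: "col P j = col (\<Theta> * B) (label \<Theta> j)" if j: "j < n" for j
  proof (rule eq_vecI)
    fix i assume "i < dim_vec (col (\<Theta> * B) (label \<Theta> j))"
    then have i: "i < n" using \<Theta> by simp
    have "(\<Theta> * B) $$ (i, label \<Theta> j) = (\<Theta> *\<^sub>v col B (label \<Theta> j)) $ i"
      using \<Theta> B i lab(1)[OF j] by simp
    also have "\<dots> = B $$ (label \<Theta> i, label \<Theta> j)"
      using \<Theta>v[OF i, of "col B (label \<Theta> j)"] B lab(1)[OF i] lab(1)[OF j] by simp
    finally show "col P j $ i = col (\<Theta> * B) (label \<Theta> j) $ i"
      using sbm_mean_entry[OF sbm i j, folded P_def] index_col[of i P j]
        index_col[of i "\<Theta> * B" "label \<Theta> j"] carrier_matD[OF P] carrier_matD[OF \<Theta>B] i j lab(1)[OF j]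
      by (simp only:)
  qed (use P \<Theta> in simp)
  have "set (cols P) \<subseteq> set (cols (\<Theta> * B))"
  proof
    fix w assume "w \<in> set (cols P)"
    then obtain j where j: "j < n" "w = col P j"
      using P by (auto simp: cols_def)
    then show "w \<in> set (cols (\<Theta> * B))"
      using colP lab(1)[OF j(1)] \<Theta>B by (auto simp: cols_def)
  qed
  then have inj: "w = 0\<^sub>v K" if "w \<in> carrier_vec K" "(\<Theta> * B) *\<^sub>v w = 0\<^sub>v n" for w
    using rank_eq_imp_injective[OF \<Theta>B P _ rankP that] by blast
  have \<Theta>Bw: "(\<Theta> * B) *\<^sub>v w = \<Theta> *\<^sub>v (B *\<^sub>v w)" if "w \<in> carrier_vec K" for w
    using \<Theta> B that by (intro assoc_mult_mat_vec[of _ n K _ K]) auto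
  have Bx: "B *\<^sub>v vec K x = vec K (matvec K (\<lambda>k l. B $$ (k, l)) x)" for x
    using B matvec_eq_mult_mat_vec[OF B, of _ x] by (intro eq_vecI) auto
  show Binj: "x k = 0" if x: "\<And>k. k < K \<Longrightarrow> matvec K (\<lambda>k l. B $$ (k, l)) x k = 0" and k: "k < K" for x k
  proof -
    have "B *\<^sub>v vec K x = 0\<^sub>v K" unfolding Bx using x by (intro eq_vecI) auto
    then have "(\<Theta> * B) *\<^sub>v vec K x = 0\<^sub>v n"
      using \<Theta>Bw[of "vec K x"] \<Theta> \<Theta>v by (intro eq_vecI) auto
    then have "vec K x = 0\<^sub>v K" by (intro inj) auto
    then have "vec K x $ k = 0\<^sub>v K $ k" by simp
    then show ?thesis using k by simp
  qed
  show "blocks n K (label \<Theta>)"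
  proof
    fix i assume "i < n" then show "label \<Theta> i < K" by (rule lab(1))
  next
    fix k assume k: "k < K"
    have "{i. i < n \<and> label \<Theta> i = k} \<noteq> {}"
    proof
      assume empty: "{i. i < n \<and> label \<Theta> i = k} = {}"
      \<comment> \<open>If community \<open>k\<close> were empty, \<open>\<Theta>\<close> would
        annihilate the \<open>k\<close>-th unit vector, and \<open>x\<close> is its preimage under
        \<open>B\<close>.\<close>
      obtain x where x: "\<And>l. l < K \<Longrightarrow> matvec K (\<lambda>k l. B $$ (k, l)) x l = of_bool (l = k)"
        using invertible_imp_solvable[of K "\<lambda>k l. B $$ (k, l)" "\<lambda>l. of_bool (l = k)"] Binj by blast
      have "(\<Theta> * B) *\<^sub>v vec K x = 0\<^sub>v n"
      proof (rule eq_vecI)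
        fix i assume "i < dim_vec (0\<^sub>v n :: real vec)"
        then have i: "i < n" by simp
        then have "label \<Theta> i \<noteq> k" using empty by auto
        then show "((\<Theta> * B) *\<^sub>v vec K x) $ i = 0\<^sub>v n $ i"
          using \<Theta>Bw[of "vec K x"] Bx[of x] \<Theta>v[OF i, of "B *\<^sub>v vec K x"] B x lab(1)[OF i] i by simp
      qed (use \<Theta> in simp)
      then have "vec K x = 0\<^sub>v K" by (intro inj) auto
      then have "x l = 0" if "l < K" for l using that by (metis index_vec index_zero_vec(1))
      then have "matvec K (\<lambda>k l. B $$ (k, l)) x k = 0" by (simp add: matvec_def)
      then show False using x[OF k] by simp
    qed
    then show "block_size n (label \<Theta>) k > 0" by (auto simp: block_size_def card_gt_0_iff)
  qed
qed

text \<open>Every block-constant vector lies in the range of \<open>P\<close>, hence has no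
  component along eigenvalue \<open>0\<close>; all other eigenvalues are at least \<gamma> in
  absolute value.\<close>

lemma (in blocks) signal_lower_bound:
  fixes P :: "real mat"
  assumes P: "P \<in> carrier_mat n n" "\<And>i j. i < n \<Longrightarrow> j < n \<Longrightarrow> P $$ (i, j) = b (g i) (g j)"
    and sym: "P\<^sup>T = P"
    and inj: "\<And>x. (\<And>k. k < K \<Longrightarrow> matvec K b x k = 0) \<Longrightarrow> (\<And>k. k < K \<Longrightarrow> x k = 0)"
    and \<gamma>: "\<gamma> > 0" "min_abs_nonzero_eigenvalue P \<ge> \<gamma>"
  shows "\<gamma> * vnorm n (\<lambda>i. y (g i)) \<le> vnorm n (matvec n (\<lambda>i j. b (g i) (g j)) (\<lambda>i. y (g i)))"
proof -
  obtain es where es: "length es = n" "char_poly P = (\<Prod>e\<leftarrow>es. [:- e, 1:])"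
    using real_symmetric_char_poly_splits[OF P(1) sym] by blast
  obtain v where v: "\<And>x. (vnorm n x)\<^sup>2 = (\<Sum>j<n. (\<Sum>i<n. v j i * x i)\<^sup>2)"
    "\<And>x j. j < n \<Longrightarrow> (\<Sum>i<n. v j i * matvec n (\<lambda>i j. P $$ (i, j)) x i) = es ! j * (\<Sum>i<n. v j i * x i)"
    using spectral_decomposition[OF P(1) sym es(2)] by blast
  define x where "x i = y (g i)" for i
  have Pm: "matvec n (\<lambda>i j. P $$ (i, j)) w i = matvec n (\<lambda>i j. b (g i) (g j)) w i" if "i < n" for w i
    unfolding matvec_def using that P(2) by (intro sum.cong) auto
  obtain s where s: "\<And>k. k < K \<Longrightarrow> matvec K b s k = y k"
    using invertible_imp_solvable[of K b y] inj by blast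
  \<comment> \<open>Summing over a block multiplies by its size; the division compensates, so that
    \<open>P\<close> acts on \<open>w\<close> as \<open>b\<close> acts on \<open>s\<close>.\<close>
  define w where "w i = s (g i) / block_size n g (g i)" for i
  have Pw: "matvec n (\<lambda>i j. b (g i) (g j)) w i = x i" if i: "i < n" for i
  proof -
    have "matvec n (\<lambda>i j. b (g i) (g j)) w i = (\<Sum>k<K. block_size n g k * (b (g i) k * (s k / block_size n g k)))"
      unfolding matvec_def w_def by (rule sum_block_const)
    also have "\<dots> = (\<Sum>k<K. b (g i) k * s k)"
      using block_nonempty by (intro sum.cong) (auto simp: less_le)
    also have "\<dots> = y (g i)" using s[OF block_less[OF i]] by (simp add: matvec_def)
    finally show ?thesis by (simp add: x_def)
  qed
  have x_zero: "(\<Sum>i<n. v j i * x i) = 0" if "j < n" "es ! j = 0" for j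
  proof -
    have "(\<Sum>i<n. v j i * x i) = (\<Sum>i<n. v j i * matvec n (\<lambda>i j. P $$ (i, j)) w i)"
      using Pm Pw by (intro sum.cong) auto
    then show ?thesis using v(2)[OF that(1), of w] that(2) by simp
  qed
  have ge: "\<gamma> \<le> \<bar>es ! j\<bar>" if j: "j < n" "es ! j \<noteq> 0" for j
  proof -
    have "poly (char_poly P) (es ! j) = 0"
      unfolding es(2) poly_prod_list using j es(1) by (auto simp: prod_list_zero_iff image_iff)
    then have "es ! j \<in> spectrum P - {0}"
      using j eigenvalue_root_char_poly[OF P(1)] by (simp add: spectrum_def)
    then have "min_abs_nonzero_eigenvalue P \<le> \<bar>es ! j\<bar>"
      unfolding min_abs_nonzero_eigenvalue_def
      using card_finite_spectrum(1)[OF P(1)] by (intro Min_le) auto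
    then show ?thesis using \<gamma> by linarith
  qed
  have "(\<gamma> * vnorm n x)\<^sup>2 = (\<Sum>j<n. \<gamma>\<^sup>2 * (\<Sum>i<n. v j i * x i)\<^sup>2)"
    by (simp add: power_mult_distrib v(1)[of x] sum_distrib_left)
  also have "\<dots> \<le> (\<Sum>j<n. (es ! j * (\<Sum>i<n. v j i * x i))\<^sup>2)"
  proof (rule sum_mono)
    fix j assume "j \<in> {..<n}"
    then have j: "j < n" by simp
    show "\<gamma>\<^sup>2 * (\<Sum>i<n. v j i * x i)\<^sup>2 \<le> (es ! j * (\<Sum>i<n. v j i * x i))\<^sup>2"
    proof (cases "es ! j = 0")
      case False
      then have "\<bar>\<gamma>\<bar> \<le> \<bar>es ! j\<bar>" using ge[OF j] \<gamma> by simp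
      then have "\<gamma>\<^sup>2 \<le> (es ! j)\<^sup>2" by (simp only: abs_le_square_iff)
      then show ?thesis unfolding power_mult_distrib by (intro mult_right_mono) auto
    qed (simp add: x_zero[OF j])
  qed
  also have "\<dots> = (vnorm n (matvec n (\<lambda>i j. P $$ (i, j)) x))\<^sup>2"
    unfolding v(1)[of "matvec n (\<lambda>i j. P $$ (i, j)) x"] using v(2) by (intro sum.cong) auto
  finally have "\<gamma> * vnorm n x \<le> vnorm n (matvec n (\<lambda>i j. P $$ (i, j)) x)"
    by (rule power2_le_imp_le) simp
  also have "\<dots> = vnorm n (matvec n (\<lambda>i j. b (g i) (g j)) x)"
    using Pm by (rule vnorm_cong)
  finally show ?thesis unfolding x_def .
qed

section \<open>Deterministic recovery guarantee\<close>

lemma orthonormal_columns_isometry: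
  fixes U :: "real mat"
  assumes U: "U \<in> carrier_mat n K" "U\<^sup>T * U = 1\<^sub>m K"
  shows "(vnorm n (\<lambda>i. \<Sum>c<K. U $$ (i, c) * x c))\<^sup>2 = (vnorm K x)\<^sup>2"
proof -
  let ?w = "vec K x"
  have entry: "(U *\<^sub>v ?w) $ i = (\<Sum>c<K. U $$ (i, c) * x c)" if "i < n" for i
    using U that by (simp add: scalar_prod_def atLeast0LessThan)
  have "(vnorm n (\<lambda>i. \<Sum>c<K. U $$ (i, c) * x c))\<^sup>2 = (\<Sum>i<n. (U *\<^sub>v ?w) $ i * (U *\<^sub>v ?w) $ i)"
    unfolding vnorm_square by (intro sum.cong) (simp_all only: lessThan_iff entry power2_eq_square)
  also have "\<dots> = (U *\<^sub>v ?w) \<bullet> (U *\<^sub>v ?w)"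
  proof -
    have "dim_vec (U *\<^sub>v ?w) = n" using U by simp
    then show ?thesis by (simp only: scalar_prod_def atLeast0LessThan)
  qed
  also have "\<dots> = (U\<^sup>T *\<^sub>v (U *\<^sub>v ?w)) \<bullet> ?w"
    using U by (intro transpose_vec_mult_scalar[symmetric]) auto
  also have "U\<^sup>T *\<^sub>v (U *\<^sub>v ?w) = (U\<^sup>T * U) *\<^sub>v ?w"
    using U by (intro assoc_mult_mat_vec[symmetric, of _ K n _ K]) auto
  also have "\<dots> = ?w" by (simp add: U(2))
  also have "?w \<bullet> ?w = (vnorm K x)\<^sup>2"
    unfolding vnorm_square by (simp add: scalar_prod_def power2_eq_square atLeast0LessThan)
  finally show ?thesis .
qed

lemma membership_mult_entry:
  assumes "\<Theta> \<in> membership_matrices n K" "X \<in> carrier_mat K m" "i < n" "c < m"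
  shows "(\<Theta> * X) $$ (i, c) = X $$ (label \<Theta> i, c)"
proof -
  have \<Theta>: "\<Theta> \<in> carrier_mat n K" using assms by (simp add: membership_matrices_def)
  have "(\<Theta> * X) $$ (i, c) = (\<Sum>k<K. \<Theta> $$ (i, k) * X $$ (k, c))"
    using \<Theta> assms by (intro mult_mat_entry)
  also have "\<dots> = (\<Sum>k<K. if k = label \<Theta> i then X $$ (k, c) else 0)"
    using label_props(2)[OF assms(1,3)] by (intro sum.cong) auto
  finally show ?thesis using label_props(1)[OF assms(1,3)] by simp
qed

lemma frobenius_norm_square:
  "M \<in> carrier_mat n m \<Longrightarrow> (frobenius_norm M)\<^sup>2 = (\<Sum>i<n. \<Sum>j<m. (M $$ (i, j))\<^sup>2)"
  by (simp add: frobenius_norm_def sum_nonneg)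

lemma rows_of_relabel:
  assumes \<Theta>: "\<Theta> \<in> membership_matrices n K" and \<Theta>h: "\<Theta>h \<in> membership_matrices n K"
    and G: "G \<subseteq> {..<n}" and \<sigma>: "bij_betw \<sigma> {..<K} {..<K}"
    and lab: "\<And>i. i \<in> G \<Longrightarrow> label \<Theta>h i = \<sigma> (label \<Theta> i)"
  shows "\<exists>J. permutation_matrix K J \<and> rows_of \<Theta>h G * J = rows_of \<Theta> G"
proof -
  \<comment> \<open>Right multiplication by \<open>J\<close> moves column \<open>l\<close> to column
    \<open>p l\<close>, so \<open>p\<close> has to undo \<sigma>; outside the labels it is the
    identity, as \<open>permutes\<close> demands.\<close>
  define p where "p l = (if l < K then inv_into {..<K} \<sigma> l else l)" for l
  have "bij_betw (inv_into {..<K} \<sigma>) {..<K} {..<K}" using \<sigma> by (rule bij_betw_inv_into)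
  then have "bij_betw p {..<K} {..<K}"
    by (subst bij_betw_cong[of _ p "inv_into {..<K} \<sigma>"]) (auto simp: p_def)
  then have "p permutes {..<K}" by (rule bij_imp_permutes) (simp add: p_def)
  define J where "J = mat K K (\<lambda>(i, j). if p i = j then 1 else 0 :: real)"
  have J: "permutation_matrix K J"
    unfolding permutation_matrix_def J_def using \<open>p permutes {..<K}\<close> by blast
  have p\<sigma>: "p (\<sigma> k) = k" if "k < K" for k
    using that \<sigma> unfolding p_def bij_betw_def by (auto simp: inv_into_f_f)
  have c: "\<Theta> \<in> carrier_mat n K" "\<Theta>h \<in> carrier_mat n K" using \<Theta> \<Theta>h by (auto simp: membership_matrices_def)
  have GI: "{i. i < n \<and> i \<in> G} = G" using G by auto
  have dims: "dim_row (rows_of M G) = card G" "dim_col (rows_of M G) = K" if "M \<in> carrier_mat n K" for M :: "real mat"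
    using that GI by (auto simp: dim_submatrix)
  have idx: "rows_of M G $$ (i, j) = M $$ (pick G i, j)" if "M \<in> carrier_mat n K" "i < card G" "j < K" for M :: "real mat" and i j
    using that GI by (subst submatrix_index) (auto simp: pick_UNIV)
  have "rows_of \<Theta>h G * J = rows_of \<Theta> G"
  proof (rule eq_matI)
    fix i j assume "i < dim_row (rows_of \<Theta> G)" "j < dim_col (rows_of \<Theta> G)"
    then have ij: "i < card G" "j < K" using dims c by auto
    have pG: "pick G i \<in> G" using ij(1) by (rule pick_in_set_le)
    then have pn: "pick G i < n" using G by auto
    let ?v = "pick G i"
    have "(rows_of \<Theta>h G * J) $$ (i, j) = (\<Sum>l<K. rows_of \<Theta>h G $$ (i, l) * J $$ (l, j))"
      using dims[OF c(2)] ij by (simp add: scalar_prod_def J_def atLeast0LessThan)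
    also have "\<dots> = (\<Sum>l<K. if l = label \<Theta>h ?v then J $$ (l, j) else 0)"
      using idx[OF c(2) ij(1)] label_props(2)[OF \<Theta>h pn] by (intro sum.cong) auto
    also have "\<dots> = J $$ (label \<Theta>h ?v, j)" using label_props(1)[OF \<Theta>h pn] by simp
    also have "\<dots> = of_bool (p (label \<Theta>h ?v) = j)"
      using label_props(1)[OF \<Theta>h pn] ij by (simp add: J_def)
    also have "p (label \<Theta>h ?v) = label \<Theta> ?v"
      using lab[OF pG] p\<sigma> label_props(1)[OF \<Theta> pn] by simp
    also have "of_bool (label \<Theta> ?v = j) = \<Theta> $$ (?v, j)"
      using label_props(2)[OF \<Theta> pn ij(2)] by (simp add: eq_commute)
    also have "\<dots> = rows_of \<Theta> G $$ (i, j)" using idx[OF c(1) ij] by simp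
    finally show "(rows_of \<Theta>h G * J) $$ (i, j) = rows_of \<Theta> G $$ (i, j)" .
  qed (use dims c in \<open>auto simp: J_def\<close>)
  with J show ?thesis by blast
qed

lemma spectral_clustering_recovers:
  fixes \<eta> :: real
  assumes sbm: "is_sbm n K \<Theta> B" and rank: "vec_space.rank n (\<Theta> * B * \<Theta>\<^sup>T) = K"
    and n: "n \<ge> 1" and \<gamma>: "\<gamma> > 0" "min_abs_nonzero_eigenvalue (\<Theta> * B * \<Theta>\<^sup>T) \<ge> \<gamma>" and \<epsilon>: "\<epsilon> > 0"
    and A: "A \<in> carrier_mat n n" "A\<^sup>T = A" and \<eta>: "\<eta> \<ge> 0"
    and noise: "\<And>x. vnorm n (matvec n (\<lambda>i j. A $$ (i, j) - B $$ (label \<Theta> i, label \<Theta> j)) x) \<le> \<eta> * vnorm n x"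
    and small: "64 * ((2 + \<epsilon>) * (real K * \<eta>\<^sup>2 / \<gamma>\<^sup>2)) < 1"
    and out: "spectral_clustering_output K \<epsilon> A \<Theta>h"
  shows "\<exists>S J. (\<forall>k<K. S k \<subseteq> community \<Theta> k) \<and> permutation_matrix K J \<and>
     (let G = (\<Union>k<K. community \<Theta> k - S k) in rows_of \<Theta>h G * J = rows_of \<Theta> G) \<and>
     (\<Sum>k<K. real (card (S k)) / real (card (community \<Theta> k))) \<le> 64 * ((2 + \<epsilon>) * (real K * \<eta>\<^sup>2 / \<gamma>\<^sup>2))"
proof -
  define g where "g = label \<Theta>"
  interpret blocks n K g unfolding g_def by (rule sbm_full_rank(2)[OF sbm rank])
  have \<Theta>m: "\<Theta> \<in> membership_matrices n K" and B: "B \<in> carrier_mat K K" and Bs: "B\<^sup>T = B"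
    using sbm by (auto simp: is_sbm_def)
  then have \<Theta>: "\<Theta> \<in> carrier_mat n K" by (simp add: membership_matrices_def)
  have K: "K \<ge> 1" using block_less[of 0] n by simp
  define P where "P = \<Theta> * B * \<Theta>\<^sup>T"
  have P: "P \<in> carrier_mat n n" using \<Theta> B by (simp add: P_def)
  have Pe: "P $$ (i, j) = B $$ (g i, g j)" if "i < n" "j < n" for i j
    unfolding P_def g_def by (rule sbm_mean_entry[OF sbm that])
  have Bsym: "B $$ (k, l) = B $$ (l, k)" if "k < K" "l < K" for k l
    using Bs B that by (metis carrier_matD index_transpose_mat(1))
  have Psym: "P\<^sup>T = P"
  proof (rule eq_matI)
    fix i j assume "i < dim_row P" "j < dim_col P"
    then have ij: "i < n" "j < n" using P by auto
    have "P\<^sup>T $$ (i, j) = P $$ (j, i)" using ij P by simp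
    also have "\<dots> = P $$ (i, j)" unfolding Pe[OF ij] Pe[OF ij(2,1)] using Bsym block_less ij by blast
    finally show "P\<^sup>T $$ (i, j) = P $$ (i, j)" .
  qed (use P in auto)
  have signal: "\<gamma> * vnorm n (\<lambda>i. y (g i)) \<le> vnorm n (matvec n (\<lambda>i j. B $$ (g i, g j)) (\<lambda>i. y (g i)))" for y
    using signal_lower_bound[OF P Pe Psym] sbm_full_rank(1)[OF sbm rank] \<gamma>[folded P_def] by blast
  from out obtain U X where lead: "leading_eigenvectors K A U"
    and \<Theta>h: "\<Theta>h \<in> membership_matrices n K" and X: "X \<in> carrier_mat K K"
    and km: "(frobenius_norm (\<Theta>h * X - U))\<^sup>2 \<le> (1 + \<epsilon>) * kmeans_min K U"
    using A by (auto simp: spectral_clustering_output_def)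
  from lead obtain es where U: "U \<in> carrier_mat n K" "U\<^sup>T * U = 1\<^sub>m K"
    and cp: "char_poly A = (\<Prod>e\<leftarrow>es. [:- e, 1:])"
    and top: "\<And>i j. i < K \<Longrightarrow> K \<le> j \<Longrightarrow> j < n \<Longrightarrow> \<bar>es ! j\<bar> \<le> \<bar>es ! i\<bar>"
    and ev: "\<And>i. i < K \<Longrightarrow> eigenvector A (col U i) (es ! i)"
    using A by (auto simp: leading_eigenvectors_def)
  obtain v where v: "\<And>x. (vnorm n x)\<^sup>2 = (\<Sum>j<n. (\<Sum>i<n. v j i * x i)\<^sup>2)"
    "\<And>x j. j < n \<Longrightarrow> (\<Sum>i<n. v j i * matvec n (\<lambda>i j. A $$ (i, j)) x i) = es ! j * (\<Sum>i<n. v j i * x i)"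
    using spectral_decomposition[OF A cp] by blast
  have noise': "vnorm n (matvec n (\<lambda>i j. A $$ (i, j) - B $$ (g i, g j)) x) \<le> \<eta> * vnorm n x" for x
    using noise by (simp add: g_def)
  define u where "u c i = U $$ (i, c)" for c i
  \<comment> \<open>Each of the \<open>K\<close> eigenvectors has residual norm at most
    \<open>2 * \<eta> / \<gamma>\<close>. The \<open>4\<close> here and the \<open>16\<close> of the
    clustering step give the constant \<open>64\<close>.\<close>
  define \<tau> where "\<tau> = 4 * (real K * \<eta>\<^sup>2 / \<gamma>\<^sup>2)"
  have orth: "(vnorm n (\<lambda>i. \<Sum>c<K. u c i * x c))\<^sup>2 = (vnorm K x)\<^sup>2" for x
    unfolding u_def by (rule orthonormal_columns_isometry[OF U])
  have \<tau>0: "\<tau> \<ge> 0" by (simp add: \<tau>_def)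
  have small': "16 * (2 + \<epsilon>) * \<tau> < 1" using small by (simp add: \<tau>_def algebra_simps)
  have "32 * \<tau> \<le> 16 * (2 + \<epsilon>) * \<tau>"
    using \<epsilon> \<tau>0 by (intro mult_right_mono) auto
  then have \<tau>1: "\<tau> < 1 / 32" using small' by linarith
  \<comment> \<open>The noise takes away at most half of the signal, so the leading eigenvalues of
    \<open>A\<close> are at least \<open>\<gamma> / 2\<close> in absolute value.\<close>
  have \<eta>\<gamma>: "\<eta> \<le> \<gamma> / 2"
  proof (rule power2_le_imp_le)
    have "\<eta>\<^sup>2 / \<gamma>\<^sup>2 \<le> real K * (\<eta>\<^sup>2 / \<gamma>\<^sup>2)"
      using mult_right_mono[of 1 "real K" "\<eta>\<^sup>2 / \<gamma>\<^sup>2"] K by simp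
    also have "\<dots> \<le> 1 / 4" using \<tau>1 by (simp add: \<tau>_def)
    finally have "\<eta>\<^sup>2 \<le> 1 / 4 * \<gamma>\<^sup>2" using \<gamma> by (simp add: pos_divide_le_eq)
    then show "\<eta>\<^sup>2 \<le> (\<gamma> / 2)\<^sup>2" by (simp add: power_divide)
  qed (use \<gamma> in simp)
  have res: "(\<Sum>c<K. (vnorm n (block_residual n g (u c)))\<^sup>2) \<le> \<tau>"
  proof -
    have "(vnorm n (block_residual n g (u c)))\<^sup>2 \<le> 4 * (\<eta>\<^sup>2 / \<gamma>\<^sup>2)" if c: "c < K" for c
    proof -
      have "\<gamma> - \<eta> \<le> \<bar>es ! c\<bar>"
        by (rule leading_eigenvalue_ge[OF v top noise' signal c])
      then have lam: "\<gamma> / 2 \<le> \<bar>es ! c\<bar>" using \<eta>\<gamma> by linarith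
      have col: "vec n (u c) = col U c" using U c by (intro eq_vecI) (auto simp: u_def)
      have "vnorm n (u c) = 1"
      proof -
        have "(\<Sum>c'<K. u c' i * of_bool (c' = c)) = u c i" for i
          using c by (simp add: of_bool_def if_distrib[of "\<lambda>a. _ * a"] cong: if_cong)
        then have "(vnorm n (u c))\<^sup>2 = (vnorm K (\<lambda>c'. of_bool (c' = c)))\<^sup>2"
          using orth[of "\<lambda>c'. of_bool (c' = c)"] by simp
        also have "\<dots> = 1"
          unfolding vnorm_square using c by (simp add: of_bool_def if_distrib[of "\<lambda>a. a ^ _"] cong: if_cong)
        finally show ?thesis using vnorm_nonneg[of n "u c"] by (simp add: power2_eq_1_iff)
      qed
      moreover have "\<bar>es ! c\<bar> * vnorm n (block_residual n g (u c)) \<le> \<eta> * vnorm n (u c)"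
      proof (rule eigenvector_residual_le[where b = "\<lambda>k l. B $$ (k, l)" and A = "\<lambda>i j. A $$ (i, j)"])
        fix i assume i: "i < n"
        have "A *\<^sub>v col U c = (es ! c) \<cdot>\<^sub>v col U c" using ev[OF c] by (simp add: eigenvector_def)
        then show "matvec n (\<lambda>i j. A $$ (i, j)) (u c) i = es ! c * u c i"
          using matvec_eq_mult_mat_vec[OF A(1) i, of "u c"] i U c unfolding col by (simp add: u_def)
      qed (rule noise')
      moreover have "\<gamma> / 2 * vnorm n (block_residual n g (u c)) \<le> \<bar>es ! c\<bar> * vnorm n (block_residual n g (u c))"
        using lam by (intro mult_right_mono) auto
      ultimately have "\<gamma> / 2 * vnorm n (block_residual n g (u c)) \<le> \<eta>" by simp
      then have "(\<gamma> / 2 * vnorm n (block_residual n g (u c)))\<^sup>2 \<le> \<eta>\<^sup>2"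
        using \<gamma> by (intro power_mono) auto
      then show ?thesis using \<gamma> by (simp add: power_mult_distrib power_divide field_simps)
    qed
    then have "(\<Sum>c<K. (vnorm n (block_residual n g (u c)))\<^sup>2) \<le> (\<Sum>c<K. 4 * (\<eta>\<^sup>2 / \<gamma>\<^sup>2))"
      by (intro sum_mono) auto
    then show ?thesis by (simp add: \<tau>_def mult_ac)
  qed
  have "kmeans_min K U \<le> \<tau>"
  proof -
    let ?f = "\<lambda>(\<Theta>', X'). (frobenius_norm (\<Theta>' * X' - U))\<^sup>2"
    define X' where "X' = mat K K (\<lambda>(k, c). block_mean n g (u c) k)"
    have X': "X' \<in> carrier_mat K K" by (simp add: X'_def)
    have "kmeans_min K U \<le> ?f (\<Theta>, X')"
      unfolding kmeans_min_def
    proof (rule cINF_lower)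
      show "bdd_below (?f ` (membership_matrices (dim_row U) K \<times> carrier_mat K K))"
        by (rule bdd_belowI2[of _ 0]) auto
      show "(\<Theta>, X') \<in> membership_matrices (dim_row U) K \<times> carrier_mat K K"
        using U \<Theta>m X' by simp
    qed
    also have "?f (\<Theta>, X') = (\<Sum>i<n. \<Sum>c<K. ((\<Theta> * X' - U) $$ (i, c))\<^sup>2)"
    proof -
      have "\<Theta> * X' - U \<in> carrier_mat n K" using U(1) by (rule minus_carrier_mat)
      then show ?thesis unfolding prod.case by (rule frobenius_norm_square)
    qed
    also have "\<dots> = (\<Sum>i<n. \<Sum>c<K. (block_residual n g (u c) i)\<^sup>2)"
    proof (intro sum.cong refl)
      fix i c assume "i \<in> {..<n}" "c \<in> {..<K}"
      then have ic: "i < n" "c < K" by auto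
      have "(\<Theta> * X' - U) $$ (i, c) = block_mean n g (u c) (g i) - u c i"
        using membership_mult_entry[OF \<Theta>m X' ic] U \<Theta> X' ic block_less[OF ic(1)]
        by (simp add: X'_def g_def u_def)
      then show "((\<Theta> * X' - U) $$ (i, c))\<^sup>2 = (block_residual n g (u c) i)\<^sup>2"
        by (simp add: block_residual_def power2_commute)
    qed
    also have "\<dots> = (\<Sum>c<K. (vnorm n (block_residual n g (u c)))\<^sup>2)"
      unfolding vnorm_square by (rule sum.swap)
    finally show ?thesis using res by linarith
  qed
  then have "(1 + \<epsilon>) * kmeans_min K U \<le> (1 + \<epsilon>) * \<tau>"
    using \<epsilon> by (intro mult_left_mono) auto
  then have "(frobenius_norm (\<Theta>h * X - U))\<^sup>2 \<le> (1 + \<epsilon>) * \<tau>" using km by linarith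
  moreover have "\<Theta>h * X - U \<in> carrier_mat n K" using U(1) by (rule minus_carrier_mat)
  ultimately have fr: "(\<Sum>i<n. \<Sum>c<K. ((\<Theta>h * X - U) $$ (i, c))\<^sup>2) \<le> (1 + \<epsilon>) * \<tau>"
    by (simp add: frobenius_norm_square)
  have \<Theta>hc: "\<Theta>h \<in> carrier_mat n K" using \<Theta>h by (simp add: membership_matrices_def)
  have "(\<Sum>i<n. \<Sum>c<K. ((\<Theta>h * X - U) $$ (i, c))\<^sup>2) = (\<Sum>i<n. \<Sum>c<K. (X $$ (label \<Theta>h i, c) - u c i)\<^sup>2)"
  proof (intro sum.cong refl)
    fix i c assume "i \<in> {..<n}" "c \<in> {..<K}"
    then have ic: "i < n" "c < K" by auto
    then show "((\<Theta>h * X - U) $$ (i, c))\<^sup>2 = (X $$ (label \<Theta>h i, c) - u c i)\<^sup>2"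
      using membership_mult_entry[OF \<Theta>h X ic] U \<Theta>hc X by (simp add: u_def)
  qed
  with fr have approx: "(\<Sum>i<n. \<Sum>c<K. (X $$ (label \<Theta>h i, c) - u c i)\<^sup>2) \<le> (1 + \<epsilon>) * \<tau>" by simp
  have "\<tau> \<le> 1 / 2" using \<tau>1 by simp
  from clustering_recovers_blocks[where b = "\<lambda>k c. X $$ (k, c)" and u = u and h = "label \<Theta>h",
      OF orth res this label_props(1)[OF \<Theta>h] \<epsilon> approx small']
  obtain S \<sigma> where S: "\<And>k. k < K \<Longrightarrow> S k \<subseteq> {i. i < n \<and> g i = k}"
    and sum: "(\<Sum>k<K. real (card (S k)) / block_size n g k) \<le> 16 * (2 + \<epsilon>) * \<tau>"
    and \<sigma>: "bij_betw \<sigma> {..<K} {..<K}"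
    and lab: "\<And>k i. k < K \<Longrightarrow> i < n \<Longrightarrow> g i = k \<Longrightarrow> i \<notin> S k \<Longrightarrow> label \<Theta>h i = \<sigma> k" by blast
  have comm: "community \<Theta> k = {i. i < n \<and> g i = k}" for k
    using \<Theta> by (auto simp: community_def g_def)
  let ?G = "\<Union>k<K. community \<Theta> k - S k"
  have "\<exists>J. permutation_matrix K J \<and> rows_of \<Theta>h ?G * J = rows_of \<Theta> ?G"
    by (rule rows_of_relabel[OF \<Theta>m \<Theta>h _ \<sigma>]) (use lab in \<open>auto simp: comm g_def\<close>)
  then obtain J where J: "permutation_matrix K J" "rows_of \<Theta>h ?G * J = rows_of \<Theta> ?G" by blast
  have "(\<Sum>k<K. real (card (S k)) / real (card (community \<Theta> k))) \<le> 64 * ((2 + \<epsilon>) * (real K * \<eta>\<^sup>2 / \<gamma>\<^sup>2))"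
  proof -
    have "16 * (2 + \<epsilon>) * \<tau> = 64 * ((2 + \<epsilon>) * (real K * \<eta>\<^sup>2 / \<gamma>\<^sup>2))"
      unfolding \<tau>_def by (simp add: mult.assoc)
    with sum show ?thesis by (simp add: comm block_size_def)
  qed
  with S J show ?thesis unfolding Let_def
    by (intro exI[of _ S] exI[of _ J]) (auto simp: comm)
qed

theorem theorem3p1:
  "\<exists>c::real. c > 0 \<and>
    (\<forall>(n::nat) (K::nat) (\<Theta>::real mat) (B::real mat) (\<gamma>::real) (\<alpha>::real) (\<epsilon>::real).
      n \<ge> 1 \<longrightarrow> is_sbm n K \<Theta> B \<longrightarrow>
      vec_space.rank n (\<Theta> * B * transpose_mat \<Theta>) = K \<longrightarrow>
      \<gamma> > 0 \<longrightarrow> min_abs_nonzero_eigenvalue (\<Theta> * B * transpose_mat \<Theta>) \<ge> \<gamma> \<longrightarrow>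
      (\<forall>k<K. \<forall>l<K. B $$ (k, l) \<le> \<alpha>) \<longrightarrow> \<alpha> \<ge> ln (real n) / real n \<longrightarrow>
      \<epsilon> > 0 \<longrightarrow>
      (2 + \<epsilon>) * (real K * real n * \<alpha> / \<gamma>\<^sup>2) < c \<longrightarrow>
      measure_pmf.prob (sbm_adjacency n \<Theta> B)
        {A. \<forall>\<Theta>h. spectral_clustering_output K \<epsilon> A \<Theta>h \<longrightarrow>
              (\<exists>S J. (\<forall>k<K. S k \<subseteq> community \<Theta> k) \<and> permutation_matrix K J \<and>
                 (let G = (\<Union>k<K. community \<Theta> k - S k) in
                    rows_of \<Theta>h G * J = rows_of \<Theta> G) \<and>
                 (\<Sum>k<K. real (card (S k)) / real (card (community \<Theta> k)))
                   \<le> inverse c * (2 + \<epsilon>) * (real K * real n * \<alpha> / \<gamma>\<^sup>2))}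
        \<ge> 1 - inverse (real n))"
proof -
  define C where "C = concentration_const"
  have C: "C > 0" unfolding C_def by (rule concentration_const_pos)
  \<comment> \<open>With \<open>\<eta>^2 = C * n * \<alpha>\<close> this choice turns the hypothesis
    on \<open>c\<close> into the smallness condition of \<open>spectral_clustering_recovers\<close>,
    and its error bound into the one claimed.\<close>
  define c where "c = inverse (64 * C)"
  have c: "c > 0" "inverse c = 64 * C"
    unfolding c_def inverse_inverse_eq using C by simp_all
  show ?thesis
  proof (intro exI[of _ c] conjI c(1) allI impI)
    fix n K :: nat and \<Theta> B :: "real mat" and \<gamma> \<alpha> \<epsilon> :: real
    assume n: "n \<ge> 1" and sbm: "is_sbm n K \<Theta> B" and rank: "vec_space.rank n (\<Theta> * B * \<Theta>\<^sup>T) = K"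
      and \<gamma>: "\<gamma> > 0" "min_abs_nonzero_eigenvalue (\<Theta> * B * \<Theta>\<^sup>T) \<ge> \<gamma>"
      and B: "\<forall>k<K. \<forall>l<K. B $$ (k, l) \<le> \<alpha>" and \<alpha>: "\<alpha> \<ge> ln (real n) / real n" and \<epsilon>: "\<epsilon> > 0"
      and small: "(2 + \<epsilon>) * (real K * real n * \<alpha> / \<gamma>\<^sup>2) < c"
    define \<eta> where "\<eta> = sqrt (C * (real n * \<alpha>))"
    have "ln (real n) / real n \<ge> 0" using n by simp
    then have \<alpha>0: "\<alpha> \<ge> 0" using \<alpha> by linarith
    then have \<eta>: "\<eta> \<ge> 0" "\<eta>\<^sup>2 = C * (real n * \<alpha>)" using C by (auto simp: \<eta>_def)
    have id: "64 * ((2 + \<epsilon>) * (real K * \<eta>\<^sup>2 / \<gamma>\<^sup>2)) = inverse c * (2 + \<epsilon>) * (real K * real n * \<alpha> / \<gamma>\<^sup>2)"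
      unfolding \<eta>(2) c(2) by (simp add: mult_ac)
    have "inverse c * ((2 + \<epsilon>) * (real K * real n * \<alpha> / \<gamma>\<^sup>2)) < inverse c * c"
      using small c(1) by (intro mult_strict_left_mono) auto
    then have small': "64 * ((2 + \<epsilon>) * (real K * \<eta>\<^sup>2 / \<gamma>\<^sup>2)) < 1"
      unfolding id using c(1) by (simp add: mult.assoc)
    let ?goal = "{A. \<forall>\<Theta>h. spectral_clustering_output K \<epsilon> A \<Theta>h \<longrightarrow>
              (\<exists>S J. (\<forall>k<K. S k \<subseteq> community \<Theta> k) \<and> permutation_matrix K J \<and>
                 (let G = (\<Union>k<K. community \<Theta> k - S k) in
                    rows_of \<Theta>h G * J = rows_of \<Theta> G) \<and>
                 (\<Sum>k<K. real (card (S k)) / real (card (community \<Theta> k)))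
                   \<le> inverse c * (2 + \<epsilon>) * (real K * real n * \<alpha> / \<gamma>\<^sup>2))}"
    let ?conc = "{A. A \<in> carrier_mat n n \<and> A\<^sup>T = A \<and>
        (\<forall>x. vnorm n (matvec n (\<lambda>i j. A $$ (i, j) - B $$ (label \<Theta> i, label \<Theta> j)) x) \<le> \<eta> * vnorm n x)}"
    show "measure_pmf.prob (sbm_adjacency n \<Theta> B) ?goal \<ge> 1 - inverse (real n)"
    \<comment> \<open>For \<open>n = 1\<close> the required probability is \<open>0\<close>; the
      concentration bound is available from \<open>n = 2\<close> on.\<close>
    proof (cases "n = 1")
      case False
      then have n2: "n \<ge> 2" using n by simp
      have "1 - inverse (real n) \<le> measure_pmf.prob (sbm_adjacency n \<Theta> B) ?conc"
        unfolding \<eta>_def C_def using B by (intro sbm_adjacency_concentration[OF sbm n2 _ \<alpha>]) auto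
      also have "\<dots> \<le> measure_pmf.prob (sbm_adjacency n \<Theta> B) ?goal"
      proof (rule measure_pmf.finite_measure_mono)
        show "?conc \<subseteq> ?goal"
        proof (intro subsetI CollectI allI impI)
          fix A \<Theta>h assume "A \<in> ?conc" and out: "spectral_clustering_output K \<epsilon> A \<Theta>h"
          then have A: "A \<in> carrier_mat n n" "A\<^sup>T = A"
            "\<And>x. vnorm n (matvec n (\<lambda>i j. A $$ (i, j) - B $$ (label \<Theta> i, label \<Theta> j)) x) \<le> \<eta> * vnorm n x"
            by auto
          show "\<exists>S J. (\<forall>k<K. S k \<subseteq> community \<Theta> k) \<and> permutation_matrix K J \<and>
                 (let G = (\<Union>k<K. community \<Theta> k - S k) in
                    rows_of \<Theta>h G * J = rows_of \<Theta> G) \<and>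
                 (\<Sum>k<K. real (card (S k)) / real (card (community \<Theta> k)))
                   \<le> inverse c * (2 + \<epsilon>) * (real K * real n * \<alpha> / \<gamma>\<^sup>2)"
            using spectral_clustering_recovers[OF sbm rank n \<gamma> \<epsilon> A(1,2) \<eta>(1) A(3) small' out]
            unfolding id .
        qed
      qed simp
      finally show ?thesis .
    qed simp
  qed
qed

end
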